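(* Let $\mathbb T=[0,1]^d/\sim$ be the $d$-dimensional torus, $\eta_s$ a Poisson process on $\mathbb T$ with intensity measure $\lambda_s(\mathrm dx)=s\,\mathrm dx$, and $r_s\in(0,1/2)$ with $sr_s^d\to\infty$ as $s\to\infty$. For $k\in\mathbb N$ let $$I_{s,k}(\eta_s)=\sum_{x\in\eta_s}\mathbf 1\big(|B(x,r_s)\cap\eta_s|\le k\big)$$ (the number of vertices of degree at most $k-1$ in the random geometric graph on $\eta_s$ with radius $r_s$), and for $t\ge0$ let $$\mathcal N_k^t=\{y\in\eta_s^t:\exists x\in\eta_s^t\cap B(y,r_s)\setminus\{y\}\text{ with }|\eta_s^t\cap B(x,r_s)|=k+1\}.$$ Then: (i) there is $C\in(0,\infty)$ with $\operatorname{Var}(I_{s,k}(\eta_s))\le \frac{C}{sr_s^d}\,\mathbb E\int_{\mathbb T}(D_xI_{s,k}(\eta_s))^2\,\lambda_s(\mathrm dx)$; (ii) $\operatorname{Var}(I_{s,k})\asymp\int_0^\infty\mathbb E|\mathcal N_k^0\cap\mathcal N_k^t|\,\mathrm dt$; (iii) there is $C'\in(0,\infty)$ such that for any $\delta_s>0$ with $\delta_s\to0$ and $\delta_s\,sr_s^d\to\infty$ as $s\to\infty$, the set $\mathcal N_k:=\mathcal N_k^0$ is $(C'(\delta_s\,sr_s^d)^{-1},\delta_s)$-chaotic, i.e. for all $s$ and all $t\ge\delta_s$, $e^{-t}\,\mathbb E|\mathcal N_k^0\cap\mathcal N_k^t|\le C'(\delta_s\,sr_s^d)^{-1}\,\mathbb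 E|\mathcal N_k^0|$.
   Context: $B(x,r)$ is the closed ball of radius $r$ around $x$ in the torus metric. $D_xF(\mu)=F(\mu+\delta_x)-F(\mu)$. For $t\ge0$, $\eta_s^t$ is obtained by keeping each point of $\eta_s$ independently with probability $e^{-t}$ and adding an independent Poisson process with intensity $(1-e^{-t})s\,\mathrm dx$. $f\asymp g$ means $C_1\le f/g\le C_2$ for constants $0<C_1\le C_2<\infty$ independent of $s$ (for $s$ large). $|\cdot|$ is cardinality. *)

theory Defs
  imports "HOL-Probability.Probability"
begin

text \<open>Points of the torus are represented by their representatives in the
half-open unit cube [0,1)^d; the dimension d is CARD('d).\<close>

definition cube :: "(real^'d) set" where
  "cube = {x. \<forall>i. 0 \<le> x$i \<and> x$i < 1}"

definition tdist :: "real^'d \<Rightarrow> real^'d \<Rightarrow> real" where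
  "tdist x y = sqrt (\<Sum>i\<in>UNIV. (min (frac (x$i - y$i)) (1 - frac (x$i - y$i)))^2)"

definition tball :: "real^'d \<Rightarrow> real \<Rightarrow> (real^'d) set" where
  "tball x \<rho> = {y. tdist x y \<le> \<rho>}"

definition unif_T :: "(real^'d) measure" where
  "unif_T = uniform_measure lborel cube"

definition ball_count :: "(real^'d) multiset \<Rightarrow> real^'d \<Rightarrow> real \<Rightarrow> nat" where
  "ball_count \<mu> x \<rho> = size (filter_mset (\<lambda>y. y \<in> tball x \<rho>) \<mu>)"

definition I_sk :: "real \<Rightarrow> nat \<Rightarrow> (real^'d) multiset \<Rightarrow> real" where
  "I_sk \<rho> k \<mu> = (\<Sum>x\<in>#\<mu>. if ball_count \<mu> x \<rho> \<le> k then 1 else 0)"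

definition Dop :: "('a multiset \<Rightarrow> real) \<Rightarrow> 'a \<Rightarrow> 'a multiset \<Rightarrow> real" where
  "Dop F x \<mu> = F (add_mset x \<mu>) - F \<mu>"

definition Nset :: "real \<Rightarrow> nat \<Rightarrow> (real^'d) multiset \<Rightarrow> (real^'d) set" where
  "Nset \<rho> k \<mu> = {y. y \<in># \<mu> \<and>
      (\<exists>x. x \<in># \<mu> \<and> x \<in> tball y \<rho> \<and> x \<noteq> y \<and> ball_count \<mu> x \<rho> = k + 1)}"

definition poi :: "real \<Rightarrow> nat pmf" where
  "poi a = (if 0 < a then poisson_pmf a else return_pmf 0)"

text \<open>Underlying probability space: N ~ Poisson(s), X_0, X_1, ... iid uniform on T,
  independent; the Poisson process is eta_s = X_0 + ... + X_{N-1}.\<close>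
definition PPspace :: "'d::finite itself \<Rightarrow> real \<Rightarrow> (nat \<times> (nat \<Rightarrow> real^'d)) measure" where
  "PPspace _ s = measure_pmf (poi s) \<Otimes>\<^sub>M (\<Pi>\<^sub>M i\<in>UNIV. unif_T)"

definition PPconf :: "nat \<times> (nat \<Rightarrow> 'a) \<Rightarrow> 'a multiset" where
  "PPconf \<omega> = mset (map (snd \<omega>) [0..<fst \<omega>])"

text \<open>Coupling (eta_s, eta_s^t): additionally iid uniform [0,1] marks U_i
  (X_i is kept iff U_i <= e^{-t}) and an independent Poisson process
  Z_0 + ... + Z_{M-1}, M ~ Poisson((1-e^{-t}) s), Z_j iid uniform on T.\<close>
definition CPspace :: "'d::finite itself \<Rightarrow> real \<Rightarrow> real \<Rightarrow>
    (nat \<times> (nat \<Rightarrow> real^'d) \<times> (nat \<Rightarrow> real) \<times> nat \<times> (nat \<Rightarrow> real^'d)) measure" where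
  "CPspace _ s t = measure_pmf (poi s) \<Otimes>\<^sub>M ((\<Pi>\<^sub>M i\<in>UNIV. unif_T) \<Otimes>\<^sub>M
      ((\<Pi>\<^sub>M i\<in>UNIV. uniform_measure lborel {0..1::real}) \<Otimes>\<^sub>M
      (measure_pmf (poi ((1 - exp (- t)) * s)) \<Otimes>\<^sub>M (\<Pi>\<^sub>M i\<in>UNIV. unif_T))))"

definition CPconf0 :: "nat \<times> (nat \<Rightarrow> 'a) \<times> (nat \<Rightarrow> real) \<times> nat \<times> (nat \<Rightarrow> 'a) \<Rightarrow> 'a multiset" where
  "CPconf0 \<omega> = (case \<omega> of (n, x, u, m, z) \<Rightarrow> mset (map x [0..<n]))"

definition CPconft :: "real \<Rightarrow> nat \<times> (nat \<Rightarrow> 'a) \<times> (nat \<Rightarrow> real) \<times> nat \<times> (nat \<Rightarrow> 'a) \<Rightarrow> 'a multiset" where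
  "CPconft t \<omega> = (case \<omega> of (n, x, u, m, z) \<Rightarrow>
      mset (map x (filter (\<lambda>i. u i \<le> exp (- t)) [0..<n])) + mset (map z [0..<m]))"

definition EI :: "'d::finite itself \<Rightarrow> real \<Rightarrow> real \<Rightarrow> nat \<Rightarrow> real" where
  "EI D s \<rho> k = (\<integral>\<omega>. I_sk \<rho> k (PPconf \<omega>) \<partial>PPspace D s)"

definition VarI :: "'d::finite itself \<Rightarrow> real \<Rightarrow> real \<Rightarrow> nat \<Rightarrow> real" where
  "VarI D s \<rho> k = (\<integral>\<omega>. (I_sk \<rho> k (PPconf \<omega>) - EI D s \<rho> k)^2 \<partial>PPspace D s)"

definition EDsq :: "'d::finite itself \<Rightarrow> real \<Rightarrow> real \<Rightarrow> nat \<Rightarrow> real" where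
  "EDsq D s \<rho> k = (\<integral>\<omega>. s * set_lebesgue_integral lborel (cube :: (real^'d) set)
        (\<lambda>x. (Dop (I_sk \<rho> k) x (PPconf \<omega>))^2) \<partial>PPspace D s)"

definition ENoverlap :: "'d::finite itself \<Rightarrow> real \<Rightarrow> real \<Rightarrow> nat \<Rightarrow> real \<Rightarrow> real" where
  "ENoverlap D s \<rho> k t = (\<integral>\<omega>. real (card (Nset \<rho> k (CPconf0 \<omega>) \<inter> Nset \<rho> k (CPconft t \<omega>)))
        \<partial>CPspace D s t)"

definition EN :: "'d::finite itself \<Rightarrow> real \<Rightarrow> real \<Rightarrow> nat \<Rightarrow> real" where
  "EN D s \<rho> k = (\<integral>\<omega>. real (card (Nset \<rho> k (PPconf \<omega>))) \<partial>PPspace D s)"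

end

theory Submission
  imports Defs "HOL-Real_Asymp.Real_Asymp"
begin

text \<open>
Everything is reduced to the numbers \<open>p\<^sub>j(a) = a\<^sup>j e\<^sup>-\<^sup>a / j!\<close> at \<open>a = s |B(x, r)|\<close>, which is
comparable to \<open>s r\<^sup>d\<close>.  Expectations are computed with the Mecke formula alone; it also yields
the Poisson law of counts and their independence on disjoint sets, via a recursion in the count.
The second tool is deterministic: a grid with cells of diameter at most \<open>r\<close> shows that each ball of
radius \<open>2r\<close> contains boundedly many points of degree below \<open>k\<close>.

Pairs of low-degree points at distance above \<open>2r\<close> have zero covariance and the others are controlled
by this packing bound, so \<open>Var I\<close> is at most a constant times \<open>E I\<close>, and at least half of \<open>E I\<close> once
\<open>s r\<^sup>d\<close> is large.  For (i) note \<open>(D\<^sub>x I)\<^sup>2 \<ge> W - 1(|B(x, r)| < k)\<close>, where \<open>W\<close> is the number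
of points in \<open>B(x, r)\<close> that lose low degree, and \<open>E W\<close> exceeds \<open>E I / s\<close> by a factor of order \<open>s r\<^sup>d\<close>.

For (ii) and (iii), a point of \<open>N\<^sub>k\<^sup>t\<close> forces a nearby cell to hold at most \<open>k + 1\<close> of the points
added up to time \<open>t\<close>.  These are independent of the initial process, and the event has probability of order
\<open>exp (- c (1 - e\<^sup>-\<^sup>t) s r\<^sup>d)\<close>; integrated against the survival probability \<open>e\<^sup>-\<^sup>t\<close> this is
\<open>O(1 / (s r\<^sup>d))\<close>.  Conversely, up to times of order \<open>1 / (s r\<^sup>d)\<close> a ball with \<open>k + 1\<close> points
is unchanged with probability bounded below.
\<close>

section \<open>The torus metric and its grid cells\<close>

text \<open>The ball volume \<open>vol\<close> is kept as a function of its centre and is known only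
  up to constants, between \<open>lo\<close> and K times \<open>hi\<close>. Inserting these bounds
  into e^-a would lose a factor exponential in s r^d. So wherever two quantities must match, they
  are compared pointwise in x under the integral by means of (j + 1) p_(j+1)(a) = a p_j(a), and the
  volume bounds enter only through the polynomial factor a. The identity also shows why the orders
  in (ii) agree: centres with k + 1 points in their ball are, in the mean, of order s r^d times as
  many as the points of low degree, and the time integral gives this factor back.

  In (i) and (iii) one constant must serve all s > 0, not only large s. For (i) this forces a second
  lower bound on the right-hand side, from empty balls, when s r^d is bounded. For (iii) put q = 1 -
  e^-t: a factor 1/q coming from the exponential is cancelled by e^-t \<le> q / \<delta>. Since a
  point counts itself, k = 0 makes both I and N_k vanish.\<close>

definition circle_norm :: "real \<Rightarrow> real" where
  "circle_norm z = min (frac z) (1 - frac z)"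

text \<open>\<open>circle_norm\<close> is the distance to the nearest integer. Together with
  \<open>circle_norm_attained\<close> this replaces case distinctions on \<open>frac\<close> by a
  choice of integers, which yields evenness and the triangle inequality. The location of the
  minimiser is recorded for \<open>card_cells_near\<close>.\<close>

lemma circle_norm_le: "circle_norm z \<le> \<bar>z - of_int n\<bar>"
proof (cases "n \<le> \<lfloor>z\<rfloor>")
  case True
  then have "frac z \<le> z - of_int n" by (simp add: frac_def)
  then show ?thesis by (simp add: circle_norm_def)
next
  case False
  then have "of_int \<lfloor>z\<rfloor> + 1 \<le> (of_int n :: real)"
    by (metis of_int_1 of_int_add of_int_le_iff zless_imp_add1_zle not_le)
  then have "1 - frac z \<le> of_int n - z" by (simp add: frac_def)
  then show ?thesis by (simp add: circle_norm_def)
qed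

lemma circle_norm_attained:
  obtains n where "circle_norm z = \<bar>z - of_int n\<bar>" "n \<in> {\<lfloor>z\<rfloor>, \<lfloor>z\<rfloor> + 1}"
proof (cases "frac z \<le> 1 - frac z")
  case True
  then have "circle_norm z = \<bar>z - of_int \<lfloor>z\<rfloor>\<bar>"
    by (simp add: circle_norm_def frac_def)
  then show ?thesis using that by blast
next
  case False
  then have "circle_norm z = \<bar>z - of_int (\<lfloor>z\<rfloor> + 1)\<bar>"
    using frac_lt_1[of z] by (simp add: circle_norm_def frac_def)
  then show ?thesis using that by blast
qed

lemma circle_norm_nonneg: "0 \<le> circle_norm z"
  using frac_lt_1[of z] frac_ge_0[of z] by (simp add: circle_norm_def)

lemma circle_norm_minus: "circle_norm (- z) = circle_norm z"
proof -
  have "circle_norm (- z) \<le> circle_norm z" for z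
  proof -
    obtain n where "circle_norm z = \<bar>z - of_int n\<bar>" by (rule circle_norm_attained)
    then show ?thesis using circle_norm_le[of "- z" "- n"] by simp
  qed
  from this[of z] this[of "- z"] show ?thesis by simp
qed

lemma circle_norm_triangle: "circle_norm (a + b) \<le> circle_norm a + circle_norm b"
proof -
  obtain m where m: "circle_norm a = \<bar>a - of_int m\<bar>" by (rule circle_norm_attained)
  obtain n where n: "circle_norm b = \<bar>b - of_int n\<bar>" by (rule circle_norm_attained)
  show ?thesis using circle_norm_le[of "a + b" "m + n"] m n by simp
qed

lemma tdist_eq_L2: "tdist x y = L2_set (\<lambda>i. circle_norm (x $ i - y $ i)) UNIV"
  by (simp add: tdist_def L2_set_def circle_norm_def)

lemma tdist_commute: "tdist x y = tdist y x"
  unfolding tdist_eq_L2 by (metis circle_norm_minus minus_diff_eq)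

lemma tdist_self [simp]: "tdist x x = 0"
  by (simp add: tdist_def)

lemma tdist_triangle: "tdist x z \<le> tdist x y + tdist y z"
proof -
  have "tdist x z \<le> L2_set (\<lambda>i. circle_norm (x $ i - y $ i) + circle_norm (y $ i - z $ i)) UNIV"
    unfolding tdist_eq_L2
    using circle_norm_triangle[of "x $ i - y $ i" "y $ i - z $ i" for i]
    by (intro L2_set_mono) (auto simp: circle_norm_nonneg)
  also have "\<dots> \<le> tdist x y + tdist y z"
    unfolding tdist_eq_L2 by (rule L2_set_triangle_ineq)
  finally show ?thesis .
qed

lemma circle_norm_le_tdist: "circle_norm (x $ i - y $ i) \<le> tdist x y"
  unfolding tdist_eq_L2 by (rule member_le_L2_set) auto

lemma measurable_tdist [measurable (raw)]:
  fixes f g :: "'w \<Rightarrow> real^'d"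
  assumes [measurable]: "f \<in> borel_measurable N" "g \<in> borel_measurable N"
  shows "(\<lambda>w. tdist (f w) (g w)) \<in> borel_measurable N"
proof -
  have [measurable]: "(\<lambda>w. f w $ i) \<in> borel_measurable N" "(\<lambda>w. g w $ i) \<in> borel_measurable N" for i
    using assms by (auto intro!: borel_measurable_nth measurable_compose[OF _ borel_measurable_nth])
  show ?thesis unfolding tdist_def frac_def by measurable
qed

lemma mem_tball: "y \<in> tball x \<rho> \<longleftrightarrow> tdist x y \<le> \<rho>"
  by (simp add: tball_def)

lemma sets_tball [measurable]: "tball x \<rho> \<in> sets borel"
  unfolding tball_def by measurable

lemma disjoint_tballs:
  assumes "tdist x y > 2 * \<rho>" shows "tball x \<rho> \<inter> tball y \<rho> = {}"
proof -
  have "\<not> (tdist x z \<le> \<rho> \<and> tdist y z \<le> \<rho>)" for z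
    using assms tdist_triangle[of x y z] tdist_commute[of y z] by linarith
  then show ?thesis by (auto simp: tball_def)
qed

section \<open>Uniform measure on the torus and the grid\<close>

lemma emeasure_half_open_box:
  fixes a :: "real^'d"
  assumes "c \<ge> 0"
  shows "emeasure lborel {x. \<forall>i. a $ i \<le> x $ i \<and> x $ i < a $ i + c} = ennreal (c ^ CARD('d))"
proof -
  let ?b = "\<chi> i. a $ i + c" and ?H = "{x. \<forall>i. a $ i \<le> x $ i \<and> x $ i < a $ i + c}"
  have cb: "emeasure lborel (cbox a ?b) = ennreal (c ^ CARD('d))"
  proof -
    have "emeasure lborel (cbox a ?b) \<noteq> top" by (simp add: emeasure_lborel_cbox_eq)
    moreover have "measure lborel (cbox a ?b) = c ^ CARD('d)"
      using content_cbox_cart[of a ?b] assms by (simp add: interval_eq_empty_cart not_less)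
    ultimately show ?thesis by (simp add: emeasure_eq_ennreal_measure)
  qed
  have "emeasure lborel (box a ?b) = emeasure lborel (cbox a ?b)"
    by (simp add: emeasure_lborel_box_eq emeasure_lborel_cbox_eq)
  moreover have [measurable]: "?H \<in> sets borel"
  proof -
    have [measurable]: "(\<lambda>x. x $ i) \<in> borel_measurable (borel :: (real^'d) measure)" for i by (rule borel_measurable_nth)
    have "{x \<in> space borel. \<forall>i. a $ i \<le> x $ i \<and> x $ i < a $ i + c} \<in> sets borel" by measurable
    then show ?thesis by simp
  qed
  \<comment> \<open>The open and the closed box have the same volume, so the half-open box between
    them is squeezed.\<close>
  moreover have "box a ?b \<subseteq> ?H" "?H \<subseteq> cbox a ?b"
    by (auto simp: mem_box_cart less_imp_le)
  ultimately show ?thesis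
    using cb emeasure_mono[of "box a ?b" ?H lborel] emeasure_mono[of ?H "cbox a ?b" lborel] by simp
qed

lemma emeasure_cube: "emeasure lborel (cube :: (real^'d) set) = 1"
  using emeasure_half_open_box[of 1 "0::real^'d"] by (simp add: cube_def)

text \<open>A non-measurable set has \<open>emeasure\<close> 0 by convention, which contradicts
  \<open>emeasure_cube\<close>.\<close>

lemma sets_cube [measurable]: "(cube :: (real^'d) set) \<in> sets borel"
proof (rule ccontr)
  assume "cube \<notin> sets (borel :: (real^'d) measure)"
  then have "emeasure lborel (cube :: (real^'d) set) = 0"
    by (intro emeasure_notin_sets) simp
  then show False by (simp add: emeasure_cube)
qed

lemma sets_unif_T [simp, measurable_cong]: "sets (unif_T :: (real^'d) measure) = sets borel"
  by (simp add: unif_T_def)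

lemma space_unif_T [simp]: "space (unif_T :: (real^'d) measure) = UNIV"
  by (simp add: unif_T_def)

lemma prob_space_unif_T: "prob_space (unif_T :: (real^'d) measure)"
  unfolding unif_T_def by (rule prob_space_uniform_measure) (simp_all add: emeasure_cube)

lemma emeasure_unif_T:
  assumes "A \<in> sets borel"
  shows "emeasure unif_T A = emeasure lborel (cube \<inter> A)"
  using assms by (simp add: unif_T_def emeasure_cube divide_ennreal_def)

text \<open>Taking \<open>frac\<close> makes the cells periodic like \<open>tdist\<close>, so
  statements about cells hold for all of \<open>real^'d\<close> and not only for representatives in
  \<open>cube\<close>.\<close>

definition grid_cell :: "nat \<Rightarrow> real^'d \<Rightarrow> 'd \<Rightarrow> int" where
  "grid_cell m y = (\<lambda>i. \<lfloor>real m * frac (y $ i)\<rfloor>)"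

lemma sets_grid_cell [measurable]: "{y :: real^'d. grid_cell m y = j} \<in> sets borel"
proof -
  have [measurable]: "(\<lambda>x. x $ i) \<in> borel_measurable (borel :: (real^'d) measure)" for i by (rule borel_measurable_nth)
  have "{y \<in> space borel. \<forall>i. of_int \<lfloor>real m * (y $ i - of_int \<lfloor>y $ i\<rfloor>)\<rfloor> = (of_int (j i)::real)} \<in> sets borel"
    by measurable
  then show ?thesis by (simp add: grid_cell_def fun_eq_iff frac_def)
qed

text \<open>Equal floors put the coordinates within 1/m of each other modulo 1. Bounding the
  Euclidean norm by the sum norm costs the factor d.\<close>

lemma tdist_same_cell:
  fixes y z :: "real^'d"
  assumes "m > 0" and eq: "grid_cell m y = grid_cell m z"
  shows "tdist y z \<le> real CARD('d) / real m"
proof -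
  have "circle_norm (y $ i - z $ i) \<le> 1 / real m" for i
  proof -
    have "\<lfloor>real m * frac (y $ i)\<rfloor> = \<lfloor>real m * frac (z $ i)\<rfloor>"
      using fun_cong[OF eq, of i] by (simp add: grid_cell_def)
    then have "\<bar>real m * frac (y $ i) - real m * frac (z $ i)\<bar> \<le> 1"
      by linarith
    then have "real m * \<bar>frac (y $ i) - frac (z $ i)\<bar> \<le> 1"
      by (simp add: abs_mult flip: right_diff_distrib)
    then have "\<bar>frac (y $ i) - frac (z $ i)\<bar> \<le> 1 / real m"
      using \<open>m > 0\<close> by (simp add: field_simps)
    then show ?thesis
      using circle_norm_le[of "y $ i - z $ i" "\<lfloor>y $ i\<rfloor> - \<lfloor>z $ i\<rfloor>"] by (simp add: frac_def algebra_simps)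
  qed
  then have "(\<Sum>i\<in>UNIV. circle_norm (y $ i - z $ i)) \<le> (\<Sum>i\<in>(UNIV::'d set). 1 / real m)"
    by (intro sum_mono)
  moreover have "tdist y z \<le> (\<Sum>i\<in>UNIV. circle_norm (y $ i - z $ i))"
    unfolding tdist_eq_L2 by (rule L2_set_le_sum) (simp add: circle_norm_nonneg)
  ultimately show ?thesis by simp
qed

text \<open>In each coordinate, \<open>frac (y $ i)\<close> lies within R of
  \<open>frac (x $ i)\<close> shifted by an integer n. Both fractional parts lie in [0,1), so n is
  -1, 0 or 1. Each shift allows at most 2 m R + 2 floors, hence 3 K cell indices per
  coordinate.\<close>

lemma card_cells_near:
  fixes x :: "real^'d"
  assumes "R \<ge> 0" and K: "2 * real m * R + 2 \<le> real K"
  shows "finite (grid_cell m ` {y. tdist x y \<le> R})"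
    and "card (grid_cell m ` {y. tdist x y \<le> R}) \<le> (3 * K) ^ CARD('d)"
proof -
  define I where "I i n = {\<lfloor>real m * (frac (x $ i) - of_int n - R)\<rfloor>..\<lfloor>real m * (frac (x $ i) - of_int n + R)\<rfloor>}"
    for i n
  define S where "S i = (\<Union>n\<in>{-1,0,1}. I i n)" for i
  have "card (I i n) \<le> K" for i n
  proof -
    have "real_of_int (\<lfloor>real m * (frac (x $ i) - of_int n + R)\<rfloor> - \<lfloor>real m * (frac (x $ i) - of_int n - R)\<rfloor> + 1)
        \<le> real m * (frac (x $ i) - of_int n + R) - (real m * (frac (x $ i) - of_int n - R) - 1) + 1"
      by linarith
    also have "\<dots> \<le> real K" using K by (simp add: algebra_simps)
    finally show ?thesis by (simp add: I_def)
  qed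
  then have cS: "card (S i) \<le> 3 * K" for i
    using card_UN_le[of "{-1,0,1::int}" "I i"] sum_mono[of "{-1,0,1::int}" "\<lambda>n. card (I i n)" "\<lambda>_. K"]
    unfolding S_def by fastforce
  have fS: "finite (S i)" for i by (simp add: S_def I_def)
  have sub: "grid_cell m ` {y. tdist x y \<le> R} \<subseteq> Pi\<^sub>E UNIV S"
  proof safe
    fix y i assume "tdist x y \<le> R"
    obtain n where n: "circle_norm (frac (x $ i) - frac (y $ i)) = \<bar>frac (x $ i) - frac (y $ i) - of_int n\<bar>"
        "n \<in> {\<lfloor>frac (x $ i) - frac (y $ i)\<rfloor>, \<lfloor>frac (x $ i) - frac (y $ i)\<rfloor> + 1}"
      by (rule circle_norm_attained)
    have "\<lfloor>frac (x $ i) - frac (y $ i)\<rfloor> = -1 \<or> \<lfloor>frac (x $ i) - frac (y $ i)\<rfloor> = 0"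
      using frac_ge_0[of "x $ i"] frac_ge_0[of "y $ i"] frac_lt_1[of "x $ i"] frac_lt_1[of "y $ i"]
      by linarith
    then have n': "n \<in> {-1, 0, 1}" using n(2) by auto
    have "circle_norm (frac (x $ i) - frac (y $ i)) \<le> circle_norm (x $ i - y $ i)"
    proof -
      obtain l where "circle_norm (x $ i - y $ i) = \<bar>x $ i - y $ i - of_int l\<bar>" by (rule circle_norm_attained)
      then show ?thesis
        using circle_norm_le[of "frac (x $ i) - frac (y $ i)" "l - \<lfloor>x $ i\<rfloor> + \<lfloor>y $ i\<rfloor>"]
        by (simp add: frac_def algebra_simps)
    qed
    then have "\<bar>frac (x $ i) - frac (y $ i) - of_int n\<bar> \<le> R"
      using n(1) \<open>tdist x y \<le> R\<close> circle_norm_le_tdist[of x i y] by linarith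
    then have "frac (x $ i) - of_int n - R \<le> frac (y $ i)" "frac (y $ i) \<le> frac (x $ i) - of_int n + R"
      by linarith+
    then have "grid_cell m y i \<in> I i n"
      unfolding I_def grid_cell_def by (auto intro!: floor_mono mult_left_mono)
    then show "grid_cell m y i \<in> S i" using n' unfolding S_def by blast
  qed auto
  have fin: "finite (Pi\<^sub>E UNIV S)" by (intro finite_PiE) (auto simp: fS)
  then show "finite (grid_cell m ` {y. tdist x y \<le> R})" using sub finite_subset by blast
  have "card (grid_cell m ` {y. tdist x y \<le> R}) \<le> card (Pi\<^sub>E UNIV S)"
    using fin sub by (rule card_mono)
  also have "\<dots> = (\<Prod>i\<in>UNIV. card (S i))" by (simp add: card_PiE)
  also have "\<dots> \<le> (\<Prod>i\<in>(UNIV::'d set). 3 * K)" by (intro prod_mono) (auto simp: cS)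
  finally show "card (grid_cell m ` {y. tdist x y \<le> R}) \<le> (3 * K) ^ CARD('d)" by simp
qed

text \<open>Inside \<open>cube\<close> the function \<open>frac\<close> is the identity, so there a
  cell is a half-open box of side 1/m.\<close>

lemma measure_cell:
  fixes y :: "real^'d"
  assumes "m > 0"
  shows "measure unif_T {z. grid_cell m z = grid_cell m y} = (1 / real m) ^ CARD('d)"
proof -
  define a :: "real^'d" where "a = (\<chi> i. of_int (grid_cell m y i) / real m)"
  have g: "0 \<le> grid_cell m y i" "grid_cell m y i < int m" for i
    using assms frac_ge_0[of "y $ i"] frac_lt_1[of "y $ i"]
    by (auto simp: grid_cell_def floor_less_iff mult_less_cancel_left1)
  have "cube \<inter> {z. grid_cell m z = grid_cell m y} = {z. \<forall>i. a $ i \<le> z $ i \<and> z $ i < a $ i + 1 / real m}"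
  proof -
    have *: "(0 \<le> t \<and> t < 1) \<and> \<lfloor>real m * frac t\<rfloor> = j \<longleftrightarrow> of_int j / real m \<le> t \<and> t < of_int j / real m + 1 / real m"
      if "0 \<le> j" "j < int m" for t :: real and j :: int
    proof -
      have "of_int j / real m \<ge> 0" using that by simp
      moreover have "of_int j + 1 \<le> real m" using that
        by linarith
      then have "of_int j / real m + 1 / real m \<le> 1" using assms by (simp add: field_simps)
      ultimately have "of_int j / real m \<le> t \<and> t < of_int j / real m + 1 / real m \<Longrightarrow> 0 \<le> t \<and> t < 1" by linarith
      moreover have "\<lfloor>real m * t\<rfloor> = j \<longleftrightarrow> of_int j / real m \<le> t \<and> t < of_int j / real m + 1 / real m"
        using assms by (simp add: floor_eq_iff field_simps)
      moreover have "frac t = t" if "0 \<le> t \<and> t < 1" using that by (simp add: frac_eq)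
      ultimately show ?thesis by auto
    qed
    show ?thesis
      using *[OF g] by (auto simp: cube_def a_def grid_cell_def fun_eq_iff)
  qed
  then have "emeasure unif_T {z. grid_cell m z = grid_cell m y} = ennreal ((1 / real m) ^ CARD('d))"
    using emeasure_half_open_box[of "1 / real m" a] by (simp add: emeasure_unif_T)
  then show ?thesis by (simp add: measure_def)
qed

text \<open>The side length is comparable to \<open>\<rho>\<close> because \<open>\<rho> < 1/2\<close> keeps the number of cells bounded below.\<close>

lemma torus_cells:
  obtains K :: nat and c0 :: real where "K > 0" "c0 > 0"
    "\<And>\<rho>. 0 < \<rho> \<Longrightarrow> \<rho> < 1/2 \<Longrightarrow> \<exists>cell :: real^'d \<Rightarrow> 'd \<Rightarrow> int.
       (\<forall>j. {y. cell y = j} \<in> sets borel) \<and>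
       (\<forall>y z. cell y = cell z \<longrightarrow> tdist y z \<le> \<rho>) \<and>
       (\<forall>x. finite (cell ` {y. tdist x y \<le> 2 * \<rho>}) \<and> card (cell ` {y. tdist x y \<le> 2 * \<rho>}) \<le> K) \<and>
       (\<forall>y. c0 * \<rho> ^ CARD('d) \<le> measure unif_T {z. cell z = cell y} \<and>
            measure unif_T {z. cell z = cell y} \<le> \<rho> ^ CARD('d))"
proof
  let ?d = "CARD('d)"
  \<comment> \<open>For m = ceiling(d / \<rho>) one has d \<le> m \<rho> \<le> d + 1. The left
    inequality gives diameter at most \<rho>. The right one gives the side length at least \<rho> /
    (d + 1), hence \<open>?c0\<close>, and bounds 2 m R + 2 in \<open>card_cells_near\<close> with R
    = 2 \<rho>, hence \<open>?K\<close>.\<close>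
  let ?K = "(3 * (4 * (?d + 1) + 2)) ^ ?d" and ?c0 = "(1 / (real ?d + 1)) ^ ?d"
  show "?K > 0" "?c0 > 0" by simp_all
  fix \<rho> :: real assume \<rho>: "0 < \<rho>" "\<rho> < 1/2"
  define m where "m = nat \<lceil>real ?d / \<rho>\<rceil>"
  have "real ?d / \<rho> > 0" using \<rho> by simp
  then have m: "m > 0" "real ?d / \<rho> \<le> real m" "real m \<le> real ?d / \<rho> + 1" unfolding m_def by linarith+
  have m1: "real ?d \<le> real m * \<rho>" using m(2) \<rho> by (simp add: field_simps)
  have m2: "real m * \<rho> \<le> real ?d + 1" using m(3) \<rho> by (simp add: field_simps)
  have d1: "1 \<le> real ?d" using zero_less_card_finite[where 'a = 'd] by linarith
  have A: "tdist y z \<le> \<rho>" if "grid_cell m y = grid_cell m z" for y z :: "real^'d"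
  proof -
    have "real ?d / real m \<le> \<rho>" using m1 m(1) by (simp add: field_simps)
    then show ?thesis using tdist_same_cell[OF m(1) that] by linarith
  qed
  have kk: "2 * real m * (2 * \<rho>) + 2 \<le> real (4 * (?d + 1) + 2)"
    using m2 by simp
  have "1 \<le> real m * \<rho>" using m1 d1 by (rule order_trans[rotated])
  then have B: "1 / real m \<le> \<rho>" using m(1) by (simp add: field_simps)
  have C: "1 / (real ?d + 1) * \<rho> \<le> 1 / real m" using m2 m(1) by (simp add: field_simps)
  have D: "(1 / real m) ^ ?d \<le> \<rho> ^ ?d" using B by (intro power_mono) auto
  have E: "?c0 * \<rho> ^ ?d \<le> (1 / real m) ^ ?d"
    unfolding power_mult_distrib[symmetric] using C \<rho> by (intro power_mono) auto
  show "\<exists>cell :: real^'d \<Rightarrow> 'd \<Rightarrow> int.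
       (\<forall>j. {y. cell y = j} \<in> sets borel) \<and>
       (\<forall>y z. cell y = cell z \<longrightarrow> tdist y z \<le> \<rho>) \<and>
       (\<forall>x. finite (cell ` {y. tdist x y \<le> 2 * \<rho>}) \<and> card (cell ` {y. tdist x y \<le> 2 * \<rho>}) \<le> ?K) \<and>
       (\<forall>y. ?c0 * \<rho> ^ ?d \<le> measure unif_T {z. cell z = cell y} \<and>
            measure unif_T {z. cell z = cell y} \<le> \<rho> ^ ?d)"
    using A card_cells_near[OF _ kk] D E \<rho>
    by (intro exI[of _ "grid_cell m"] conjI allI) (simp_all add: sets_grid_cell measure_cell[OF m(1)])
qed

section \<open>Poisson processes and the Mecke formula\<close>

abbreviation seq_space :: "'a measure \<Rightarrow> (nat \<Rightarrow> 'a) measure" where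
  "seq_space M \<equiv> (\<Pi>\<^sub>M i\<in>UNIV. M)"

text \<open>The construction of \<open>PPspace\<close> over an arbitrary probability space; it also
  describes the points added in the coupling, whose intensity is different.\<close>

definition pp :: "'a measure \<Rightarrow> real \<Rightarrow> (nat \<times> (nat \<Rightarrow> 'a)) measure" where
  "pp M s = measure_pmf (poi s) \<Otimes>\<^sub>M seq_space M"

definition conf :: "nat \<Rightarrow> (nat \<Rightarrow> 'a) \<Rightarrow> 'a multiset" where
  "conf n x = mset (map x [0..<n])"

lemma conf_0 [simp]: "conf 0 x = {#}"
  by (simp add: conf_def)

lemma conf_Suc: "conf (Suc n) x = add_mset (x n) (conf n x)"
  by (simp add: conf_def)

lemma PPconf_pair [simp]: "PPconf (n, x) = conf n x"
  by (simp add: PPconf_def conf_def)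

definition pois :: "real \<Rightarrow> nat \<Rightarrow> real" where
  "pois a j = a ^ j / fact j * exp (- a)"

text \<open>The inequality is strict because of the Mecke formula: the added point lies in its own
  ball, so a count of at most k leaves fewer than k for the others.\<close>

definition pois_less :: "nat \<Rightarrow> real \<Rightarrow> real" where
  "pois_less k a = (\<Sum>j<k. pois a j)"

lemma pois_nonneg: "0 \<le> a \<Longrightarrow> 0 \<le> pois a j"
  by (simp add: pois_def)

lemma pois_less_nonneg: "0 \<le> a \<Longrightarrow> 0 \<le> pois_less k a"
  by (simp add: pois_less_def pois_nonneg sum_nonneg)

lemma pmf_poi: "0 \<le> s \<Longrightarrow> pmf (poi s) n = pois s n"
  by (cases "s = 0"; cases n) (auto simp: poi_def pois_def)

text \<open>This identity drives both the Mecke formula and the later comparison of Poisson weights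
  with neighbouring indices.\<close>

lemma pois_Suc: "real (Suc n) * pois a (Suc n) = a * pois a n"
  by (simp add: pois_def field_simps del: of_nat_Suc)

lemma measurable_of_bool [measurable (raw)]:
  assumes [measurable]: "Measurable.pred N P"
  shows "(\<lambda>w. of_bool (P w) :: 'b::{zero_neq_one,topological_space}) \<in> borel_measurable N"
  unfolding of_bool_def by measurable

lemma sum_mset_conf: "(\<Sum>y\<in>#conf n x. g y) = (\<Sum>i<n. g (x i))"
  by (induction n) (simp_all add: conf_Suc add.commute)

lemma size_filter_conf: "size (filter_mset P (conf n x)) = (\<Sum>i<n. of_bool (P (x i)))"
  by (induction n) (auto simp: conf_Suc)

text \<open>A configuration forgets the order, so a point put in front of the sequence is a point
  added to it. Splitting off the first coordinate of the product space thus produces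
  \<open>add_mset\<close>.\<close>

lemma conf_case_nat: "conf (Suc n) (case_nat y x) = add_mset y (conf n x)"
  by (induction n) (simp_all add: conf_Suc)

lemma conf_eq_image: "conf n x = image_mset x (mset_set {..<n})"
  by (induction n) (simp_all add: conf_Suc lessThan_Suc)

lemma conf_permute:
  assumes "\<tau> permutes {..<n}" shows "conf n (\<lambda>i. x (\<tau> i)) = conf n x"
proof -
  have "conf n (\<lambda>i. x (\<tau> i)) = image_mset x (image_mset \<tau> (mset_set {..<n}))"
    by (simp only: conf_eq_image multiset.map_comp comp_def)
  also have "image_mset \<tau> (mset_set {..<n}) = mset_set {..<n}"
    using assms by (simp add: image_mset_mset_set permutes_inj_on permutes_image)
  finally show ?thesis by (simp add: conf_eq_image)
qed

lemma ennreal_mult3: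
  "0 \<le> u \<Longrightarrow> 0 \<le> v \<Longrightarrow> 0 \<le> w \<Longrightarrow> ennreal u * (ennreal v * (ennreal w * z)) = ennreal (u * v * w) * z"
  by (simp add: ennreal_mult mult.assoc)

context
  fixes M :: "'a measure"
  assumes prob: "prob_space M"
begin

interpretation M: prob_space M by (rule prob)
interpretation S: sequence_space M ..

lemma prob_space_pp: "prob_space (pp M s)"
  unfolding pp_def by (intro prob_space_pair measure_pmf.prob_space_axioms S.P.prob_space_axioms)

text \<open>The number of points is discrete, so measurability may be checked for each fixed n,
  where functions of the configuration are finite sums over indices.\<close>

lemma pp_measurable:
  assumes "\<And>n. (\<lambda>x. F (n, x)) \<in> measurable (seq_space M) N"
  shows "F \<in> measurable (pp M s) N"
proof -
  have "F \<in> measurable (count_space UNIV \<Otimes>\<^sub>M seq_space M) N"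
    using assms by (intro measurable_pair_measure_countable1) auto
  moreover have "sets (pp M s) = sets (count_space UNIV \<Otimes>\<^sub>M seq_space M)"
    unfolding pp_def by (intro sets_pair_measure_cong) auto
  ultimately show ?thesis using measurable_cong_sets by blast
qed

lemma nn_integral_pp:
  assumes [measurable]: "\<And>n. (\<lambda>x. F (n, x)) \<in> borel_measurable (seq_space M)"
  shows "(\<integral>\<^sup>+\<omega>. F \<omega> \<partial>pp M s) = (\<Sum>n. ennreal (pmf (poi s) n) * (\<integral>\<^sup>+x. F (n, x) \<partial>seq_space M))"
proof -
  have "F \<in> borel_measurable (pp M s)" by (intro pp_measurable) measurable
  then have "(\<integral>\<^sup>+\<omega>. F \<omega> \<partial>pp M s) = (\<integral>\<^sup>+n. \<integral>\<^sup>+x. F (n, x) \<partial>seq_space M \<partial>measure_pmf (poi s))"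
    unfolding pp_def by (intro S.P.nn_integral_fst[symmetric])
  then show ?thesis by (simp add: nn_integral_measure_pmf nn_integral_count_space_nat)
qed

lemma nn_integral_seq_permute:
  assumes f: "f \<in> borel_measurable (seq_space M)" and \<tau>: "inj \<tau>"
  shows "(\<integral>\<^sup>+x. f (\<lambda>i. x (\<tau> i)) \<partial>seq_space M) = (\<integral>\<^sup>+x. f x \<partial>seq_space M)"
proof -
  have "distr (seq_space M) (seq_space M) (\<lambda>x. \<lambda>i\<in>UNIV. x (\<tau> i)) = seq_space M"
    by (rule distr_PiM_reindex) (use \<tau> prob in auto)
  then have D: "distr (seq_space M) (seq_space M) (\<lambda>x i. x (\<tau> i)) = seq_space M"
    by (simp add: restrict_UNIV)
  have [measurable]: "(\<lambda>x i. x (\<tau> i)) \<in> measurable (seq_space M) (seq_space M)"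
    by (rule measurable_PiM_single') (auto simp: space_PiM PiE_iff)
  show ?thesis
    using f by (subst (2) D[symmetric]) (simp add: nn_integral_distr)
qed

lemma nn_integral_seq_case_nat:
  assumes [measurable]: "f \<in> borel_measurable (seq_space M)"
  shows "(\<integral>\<^sup>+x. f x \<partial>seq_space M) = (\<integral>\<^sup>+y. \<integral>\<^sup>+x. f (case_nat y x) \<partial>seq_space M \<partial>M)"
proof -
  have "(\<integral>\<^sup>+x. f x \<partial>seq_space M) = (\<integral>\<^sup>+z. f (case z of (y, x) \<Rightarrow> case_nat y x) \<partial>(M \<Otimes>\<^sub>M seq_space M))"
    by (subst S.PiM_iter[symmetric]) (simp add: nn_integral_distr)
  also have "\<dots> = (\<integral>\<^sup>+y. \<integral>\<^sup>+x. f (case_nat y x) \<partial>seq_space M \<partial>M)"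
    by (subst S.P.nn_integral_fst[symmetric]) simp_all
  finally show ?thesis .
qed

text \<open>The \<open>n\<close> summands have equal integrals by exchangeability, and \<open>n p\<^sub>n = s p\<^sub>n\<^sub>-\<^sub>1\<close> for Poisson weights.\<close>

theorem mecke:
  assumes "0 \<le> s"
    and f: "\<And>n. (\<lambda>(y, x). f y (conf n x)) \<in> borel_measurable (M \<Otimes>\<^sub>M seq_space M)"
  shows "(\<integral>\<^sup>+\<omega>. (\<Sum>y\<in>#PPconf \<omega>. f y (PPconf \<omega>)) \<partial>pp M s)
    = ennreal s * (\<integral>\<^sup>+y. \<integral>\<^sup>+\<omega>. f y (add_mset y (PPconf \<omega>)) \<partial>pp M s \<partial>M)"
proof -
  define J where "J n = (\<integral>\<^sup>+x. f (x 0) (conf n x) \<partial>seq_space M)" for n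
  have fi [measurable]: "(\<lambda>x. f (x i) (conf n x)) \<in> borel_measurable (seq_space M)" for i n
    using measurable_compose[OF _ f[of n], of "\<lambda>x. (x i, x)" "seq_space M"] by simp
  have fa [measurable]: "(\<lambda>(y, x). f y (add_mset y (conf n x))) \<in> borel_measurable (M \<Otimes>\<^sub>M seq_space M)" for n
    using measurable_compose[OF _ f[of "Suc n"], of "\<lambda>(y, x). (y, case_nat y x)" "M \<Otimes>\<^sub>M seq_space M"]
    unfolding case_prod_beta fst_conv snd_conv conf_case_nat by measurable
  have J: "(\<integral>\<^sup>+x. f (x i) (conf n x) \<partial>seq_space M) = J n" if "i < n" for i n
  proof -
    define \<tau> where "\<tau> = Transposition.transpose 0 i"
    have \<tau>: "\<tau> permutes {..<n}" unfolding \<tau>_def using that by (intro permutes_swap_id) auto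
    have "J n = (\<integral>\<^sup>+x. f (x (\<tau> i)) (conf n (\<lambda>j. x (\<tau> j))) \<partial>seq_space M)"
      unfolding J_def conf_permute[OF \<tau>] by (simp add: \<tau>_def)
    also have "\<dots> = (\<integral>\<^sup>+x. f (x i) (conf n x) \<partial>seq_space M)"
      by (rule nn_integral_seq_permute[OF fi]) (rule permutes_inj[OF \<tau>])
    finally show ?thesis by simp
  qed
  have JS: "J (Suc n) = (\<integral>\<^sup>+y. \<integral>\<^sup>+x. f y (add_mset y (conf n x)) \<partial>seq_space M \<partial>M)" for n
    unfolding J_def by (subst nn_integral_seq_case_nat[OF fi]) (simp add: conf_case_nat)
  have "(\<integral>\<^sup>+\<omega>. (\<Sum>y\<in>#PPconf \<omega>. f y (PPconf \<omega>)) \<partial>pp M s)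
      = (\<Sum>n. ennreal (pmf (poi s) n) * (\<integral>\<^sup>+x. (\<Sum>i<n. f (x i) (conf n x)) \<partial>seq_space M))"
    by (subst nn_integral_pp) (simp_all add: sum_mset_conf)
  also have "\<dots> = (\<Sum>n. ennreal (pmf (poi s) n) * (of_nat n * J n))"
    by (simp add: nn_integral_sum J)
  also have "\<dots> = (\<Sum>n. ennreal (pmf (poi s) (Suc n)) * (of_nat (Suc n) * J (Suc n)))"
    using suminf_offset[of "\<lambda>n. ennreal (pmf (poi s) n) * (of_nat n * J n)" 1] by simp
  also have "\<dots> = (\<Sum>n. ennreal s * (ennreal (pmf (poi s) n) * J (Suc n)))"
  proof (intro suminf_cong)
    fix n
    have "ennreal (pmf (poi s) (Suc n)) * of_nat (Suc n) = ennreal s * ennreal (pmf (poi s) n)"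
      using pois_Suc[of n s] \<open>0 \<le> s\<close>
      by (simp add: pmf_poi pois_nonneg ennreal_of_nat_eq_real_of_nat mult.commute del: of_nat_Suc flip: ennreal_mult)
    then show "ennreal (pmf (poi s) (Suc n)) * (of_nat (Suc n) * J (Suc n)) = ennreal s * (ennreal (pmf (poi s) n) * J (Suc n))"
      by (metis mult.assoc)
  qed
  also have "\<dots> = ennreal s * (\<integral>\<^sup>+y. (\<Sum>n. ennreal (pmf (poi s) n) * (\<integral>\<^sup>+x. f y (add_mset y (conf n x)) \<partial>seq_space M)) \<partial>M)"
    by (simp add: JS nn_integral_suminf nn_integral_cmult)
  also have "\<dots> = ennreal s * (\<integral>\<^sup>+y. \<integral>\<^sup>+\<omega>. f y (add_mset y (PPconf \<omega>)) \<partial>pp M s \<partial>M)"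
  proof (intro arg_cong2[where f = "(*)"] nn_integral_cong refl)
    fix y assume "y \<in> space M"
    then have "(\<lambda>x. f y (add_mset y (conf n x))) \<in> borel_measurable (seq_space M)" for n
      using measurable_compose[OF measurable_Pair1' fa[of n]] by simp
    then show "(\<Sum>n. ennreal (pmf (poi s) n) * (\<integral>\<^sup>+x. f y (add_mset y (conf n x)) \<partial>seq_space M))
        = (\<integral>\<^sup>+\<omega>. f y (add_mset y (PPconf \<omega>)) \<partial>pp M s)"
      by (subst nn_integral_pp) simp_all
  qed
  finally show ?thesis .
qed

text \<open>\<open>inv\<close> expresses that H ignores points of A. Weighting the event of j + 1
  points in A by their number and applying \<open>mecke\<close> removes one of them without changing
  H, so (j + 1) c (j + 1) = a c j with a = s M(A). Thus c j is a^j / j! times c 0, and only c 0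
  remains to be found.\<close>

lemma poisson_count_indep:
  assumes "0 \<le> s" and A [measurable]: "A \<in> sets M"
    and H [measurable]: "\<And>n. (\<lambda>x. H (conf n x)) \<in> borel_measurable (seq_space M)"
    and inv: "\<And>y \<mu>. y \<in> A \<Longrightarrow> H (add_mset y \<mu>) = H \<mu>"
  shows "(\<integral>\<^sup>+\<omega>. of_bool (size (filter_mset (\<lambda>y. y \<in> A) (PPconf \<omega>)) = j) * H (PPconf \<omega>) \<partial>pp M s)
    = ennreal (pois (s * measure M A) j) * (\<integral>\<^sup>+\<omega>. H (PPconf \<omega>) \<partial>pp M s)"
proof -
  let ?N = "\<lambda>\<mu>. size (filter_mset (\<lambda>y. y \<in> A) \<mu>)" and ?a = "s * measure M A"
  define c where "c j = (\<integral>\<^sup>+\<omega>. of_bool (?N (PPconf \<omega>) = j) * H (PPconf \<omega>) \<partial>pp M s)" for j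
  have a0: "0 \<le> ?a" using \<open>0 \<le> s\<close> by simp
  have N [measurable]: "(\<lambda>x. ?N (conf n x)) \<in> measurable (seq_space M) (count_space UNIV)" for n
    unfolding size_filter_conf by measurable
  have c [measurable]: "(\<lambda>\<omega>. of_bool (?N (PPconf \<omega>) = j) * H (PPconf \<omega>)) \<in> borel_measurable (pp M s)" for j
    by (intro pp_measurable) simp
  have rec: "of_nat (Suc j) * c (Suc j) = ennreal ?a * c j" for j
  proof -
    have "of_nat (Suc j) * c (Suc j) = (\<integral>\<^sup>+\<omega>. (\<Sum>y\<in>#PPconf \<omega>. of_bool (y \<in> A) * (of_bool (?N (PPconf \<omega>) = Suc j) * H (PPconf \<omega>))) \<partial>pp M s)"
    proof -
      have "(\<Sum>y\<in>#\<mu>. of_bool (y \<in> A) * z) = of_nat (?N \<mu>) * z" for \<mu> and z :: ennreal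
        by (induction \<mu>) (auto simp: distrib_right)
      then have "(\<Sum>y\<in>#\<mu>. of_bool (y \<in> A) * (of_bool (?N \<mu> = Suc j) * H \<mu>)) = of_nat (Suc j) * (of_bool (?N \<mu> = Suc j) * H \<mu>)" for \<mu>
        by simp
      then show ?thesis by (simp add: c_def nn_integral_cmult)
    qed
    also have "\<dots> = ennreal s * (\<integral>\<^sup>+y. \<integral>\<^sup>+\<omega>. of_bool (y \<in> A) * (of_bool (?N (add_mset y (PPconf \<omega>)) = Suc j) * H (add_mset y (PPconf \<omega>))) \<partial>pp M s \<partial>M)"
      by (rule mecke) (use \<open>0 \<le> s\<close> in measurable)
    also have "\<dots> = ennreal s * (\<integral>\<^sup>+y. c j * indicator A y \<partial>M)"
      by (intro arg_cong2[where f = "(*)"] nn_integral_cong refl)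
        (auto simp: c_def inv indicator_def)
    also have "\<dots> = ennreal ?a * c j"
      using \<open>0 \<le> s\<close> by (simp add: nn_integral_cmult_indicator M.emeasure_eq_measure ennreal_mult mult_ac)
    finally show ?thesis .
  qed
  have cj: "c j = ennreal (?a ^ j / fact j) * c 0" for j
  proof (induction j)
    case (Suc j)
    have "c (Suc j) = ennreal (1 / real (Suc j)) * (of_nat (Suc j) * c (Suc j))"
      by (simp add: ennreal_of_nat_eq_real_of_nat flip: mult.assoc ennreal_mult del: of_nat_Suc)
    also have "\<dots> = ennreal (1 / real (Suc j)) * (ennreal ?a * (ennreal (?a ^ j / fact j) * c 0))"
      unfolding rec by (simp only: Suc)
    also have "\<dots> = ennreal (1 / real (Suc j) * ?a * (?a ^ j / fact j)) * c 0"
      using a0 by (intro ennreal_mult3) simp_all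
    also have "1 / real (Suc j) * ?a * (?a ^ j / fact j) = ?a ^ Suc j / fact (Suc j)"
      by (simp del: of_nat_Suc)
    finally show ?case .
  qed simp
  \<comment> \<open>Summing over all counts recovers the expectation of H, which determines c 0 as
    e^-a times it.\<close>
  have "(\<integral>\<^sup>+\<omega>. H (PPconf \<omega>) \<partial>pp M s) = (\<integral>\<^sup>+\<omega>. (\<Sum>j. of_bool (?N (PPconf \<omega>) = j) * H (PPconf \<omega>)) \<partial>pp M s)"
  proof -
    have "(\<Sum>j. of_bool (m = j) * z) = z" for m :: nat and z :: ennreal
      by (subst suminf_finite[of "{m}"]) auto
    then show ?thesis by (simp only:)
  qed
  also have "\<dots> = (\<Sum>j. c j)" unfolding c_def by (rule nn_integral_suminf) (rule c)
  also have "\<dots> = (\<Sum>j. ennreal (?a ^ j / fact j) * c 0)" by (intro suminf_cong cj)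
  also have "\<dots> = (\<Sum>j. ennreal (?a ^ j / fact j)) * c 0" by simp
  also have "(\<Sum>j. ennreal (?a ^ j / fact j)) = ennreal (exp ?a)"
  proof (rule suminf_ennreal_eq)
    show "(\<lambda>j. ?a ^ j / fact j) sums exp ?a"
      using exp_converges[of ?a] by (simp add: field_simps)
  qed (use a0 in simp)
  finally have total: "(\<integral>\<^sup>+\<omega>. H (PPconf \<omega>) \<partial>pp M s) = ennreal (exp ?a) * c 0" .
  have "ennreal (exp (- ?a)) * ennreal (exp ?a) = 1"
    by (simp add: exp_minus flip: ennreal_mult)
  then have "c 0 = ennreal (exp (- ?a)) * (\<integral>\<^sup>+\<omega>. H (PPconf \<omega>) \<partial>pp M s)"
    unfolding total by (simp only: mult.assoc[symmetric] mult_1)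
  moreover have "ennreal (pois ?a j) = ennreal (?a ^ j / fact j) * ennreal (exp (- ?a))"
    unfolding pois_def using a0 by (intro ennreal_mult) simp_all
  ultimately have "c j = ennreal (pois ?a j) * (\<integral>\<^sup>+\<omega>. H (PPconf \<omega>) \<partial>pp M s)"
    using cj[of j] by (simp only: mult.assoc)
  then show ?thesis by (simp add: c_def)
qed

lemma poisson_count_less_indep:
  assumes "0 \<le> s" and A [measurable]: "A \<in> sets M"
    and H [measurable]: "\<And>n. (\<lambda>x. H (conf n x)) \<in> borel_measurable (seq_space M)"
    and inv: "\<And>y \<mu>. y \<in> A \<Longrightarrow> H (add_mset y \<mu>) = H \<mu>"
  shows "(\<integral>\<^sup>+\<omega>. of_bool (size (filter_mset (\<lambda>y. y \<in> A) (PPconf \<omega>)) < k) * H (PPconf \<omega>) \<partial>pp M s)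
    = ennreal (pois_less k (s * measure M A)) * (\<integral>\<^sup>+\<omega>. H (PPconf \<omega>) \<partial>pp M s)"
proof -
  have eq: "of_bool (m < k) * z = (\<Sum>j<k. of_bool (m = j) * z)" for m and z :: ennreal
    by (simp add: of_bool_def flip: sum_distrib_right)
  have [measurable]: "(\<lambda>x. size (filter_mset (\<lambda>y. y \<in> A) (conf n x))) \<in> measurable (seq_space M) (count_space UNIV)" for n
    unfolding size_filter_conf by measurable
  have "(\<lambda>\<omega>. of_bool (size (filter_mset (\<lambda>y. y \<in> A) (PPconf \<omega>)) = j) * H (PPconf \<omega>)) \<in> borel_measurable (pp M s)" for j
    by (intro pp_measurable) simp
  then have "(\<integral>\<^sup>+\<omega>. of_bool (size (filter_mset (\<lambda>y. y \<in> A) (PPconf \<omega>)) < k) * H (PPconf \<omega>) \<partial>pp M s)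
      = (\<Sum>j<k. \<integral>\<^sup>+\<omega>. of_bool (size (filter_mset (\<lambda>y. y \<in> A) (PPconf \<omega>)) = j) * H (PPconf \<omega>) \<partial>pp M s)"
    unfolding eq by (rule nn_integral_sum)
  also have "\<dots> = (\<Sum>j<k. ennreal (pois (s * measure M A) j)) * (\<integral>\<^sup>+\<omega>. H (PPconf \<omega>) \<partial>pp M s)"
    by (simp only: poisson_count_indep[OF assms] sum_distrib_right)
  also have "(\<Sum>j<k. ennreal (pois (s * measure M A) j)) = ennreal (pois_less k (s * measure M A))"
    using \<open>0 \<le> s\<close> by (simp add: pois_less_def pois_nonneg sum_ennreal)
  finally show ?thesis .
qed

lemma poisson_count:
  assumes "0 \<le> s" "A \<in> sets M"
  shows "(\<integral>\<^sup>+\<omega>. of_bool (size (filter_mset (\<lambda>y. y \<in> A) (PPconf \<omega>)) = j) \<partial>pp M s) = ennreal (pois (s * measure M A) j)"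
    and "(\<integral>\<^sup>+\<omega>. of_bool (size (filter_mset (\<lambda>y. y \<in> A) (PPconf \<omega>)) < j) \<partial>pp M s) = ennreal (pois_less j (s * measure M A))"
proof -
  interpret prob_space "pp M s" by (rule prob_space_pp)
  show "(\<integral>\<^sup>+\<omega>. of_bool (size (filter_mset (\<lambda>y. y \<in> A) (PPconf \<omega>)) = j) \<partial>pp M s) = ennreal (pois (s * measure M A) j)"
    using poisson_count_indep[OF assms, of "\<lambda>_. 1"] by (simp add: emeasure_space_1)
  show "(\<integral>\<^sup>+\<omega>. of_bool (size (filter_mset (\<lambda>y. y \<in> A) (PPconf \<omega>)) < j) \<partial>pp M s) = ennreal (pois_less j (s * measure M A))"
    using poisson_count_less_indep[OF assms, of "\<lambda>_. 1"] by (simp add: emeasure_space_1)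
qed

text \<open>Replacing coordinate i by an independent copy leaves the product law unchanged. With the
  other coordinates fixed, the fresh value almost surely differs from x j; Fubini concludes.\<close>

lemma AE_seq_distinct:
  assumes meas: "Measurable.pred (M \<Otimes>\<^sub>M M) (\<lambda>(y, z). y = z)"
    and null: "\<And>y. AE z in M. z \<noteq> y"
  shows "AE x in seq_space M. \<forall>i j. i \<noteq> j \<longrightarrow> x i \<noteq> x j"
proof -
  have "AE x in seq_space M. x i \<noteq> x j" if "i \<noteq> j" for i j :: nat
  proof -
    have mu: "(\<lambda>(y, x). x(i := y)) \<in> measurable (M \<Otimes>\<^sub>M seq_space M) (seq_space M)"
      using measurable_add_dim[of i UNIV "\<lambda>_. M"] measurable_compose[OF measurable_pair_swap'] by (auto simp: case_prod_beta)
    have D: "distr (M \<Otimes>\<^sub>M seq_space M) (seq_space M) (\<lambda>(y, x). x(i := y)) = seq_space M"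
      using distr_pair_PiM_eq_PiM[of UNIV "\<lambda>_. M" i] prob by simp
    have [measurable]: "Measurable.pred (seq_space M) (\<lambda>x. x i = x j)"
      using measurable_compose[OF _ meas, of "\<lambda>x. (x i, x j)" "seq_space M"] by simp
    have [measurable]: "Measurable.pred (M \<Otimes>\<^sub>M seq_space M) (\<lambda>z. fst z = snd z j)"
      using measurable_compose[OF _ meas, of "\<lambda>z. (fst z, snd z j)" "M \<Otimes>\<^sub>M seq_space M"] by simp
    interpret pair_sigma_finite M "seq_space M" ..
    have "AE x in seq_space M. AE y in M. y \<noteq> x j" using null by simp
    then have "AE y in M. AE x in seq_space M. y \<noteq> x j"
      by (subst AE_commute) simp_all
    then have "AE z in M \<Otimes>\<^sub>M seq_space M. fst z \<noteq> snd z j"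
      by (intro AE_pair_measure) simp_all
    then show ?thesis
      using that by (subst D[symmetric], subst AE_distr_iff[OF mu]) (auto simp: case_prod_beta)
  qed
  then show ?thesis by (simp add: AE_all_countable)
qed

lemma AE_pp_snd:
  assumes A: "AE x in seq_space M. P x"
  shows "AE \<omega> in pp M s. P (snd \<omega>)"
proof -
  have D: "distr (pp M s) (seq_space M) snd = seq_space M"
  proof (rule measure_eqI)
    fix B assume "B \<in> sets (distr (pp M s) (seq_space M) snd)"
    then have B: "B \<in> sets (seq_space M)" by simp
    then have "snd -` B \<inter> space (pp M s) = UNIV \<times> B"
      using sets.sets_into_space[OF B] by (auto simp: pp_def space_pair_measure)
    then show "emeasure (distr (pp M s) (seq_space M) snd) B = emeasure (seq_space M) B"
      using B S.P.emeasure_pair_measure_Times[of UNIV "measure_pmf (poi s)" B]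
      by (simp add: emeasure_distr pp_def measure_pmf.emeasure_space_1[simplified])
  qed simp
  have "AE z in distr (pp M s) (seq_space M) snd. P z" unfolding D by (rule A)
  then show ?thesis by (rule AE_distrD[rotated]) (simp add: pp_def)
qed

text \<open>A countable union of null events. It will ensure that a point common to the
  configurations at times 0 and t is a surviving one.\<close>

lemma AE_pp_avoid:
  assumes "\<And>y. AE z in M. z \<noteq> y"
  shows "AE \<omega> in pp M s. \<forall>i j. snd \<omega> j \<noteq> x (i :: nat)"
proof -
  have "AE z in seq_space M. z j \<noteq> x i" for i j :: nat
    using AE_PiM_component[of UNIV "\<lambda>_. M" j "\<lambda>z. z \<noteq> x i"] prob assms by simp
  then show ?thesis
    using AE_pp_snd[of "\<lambda>z. \<forall>i j. z j \<noteq> x i"] by (simp add: AE_all_countable)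
qed

end

section \<open>Ball counts of the Poisson process on the torus\<close>

lemma pois_less_le_1: "0 \<le> a \<Longrightarrow> pois_less k a \<le> 1"
proof -
  assume a: "0 \<le> a"
  have s: "(\<lambda>j. a ^ j / fact j) sums exp a"
    using exp_converges[of a] by (simp add: field_simps)
  have "(\<Sum>j<k. a ^ j / fact j) \<le> exp a"
    using sum_le_suminf[OF sums_summable[OF s], of "{..<k}"] sums_unique[OF s] a by simp
  then have "(\<Sum>j<k. a ^ j / fact j) * exp (- a) \<le> exp a * exp (- a)"
    by (intro mult_right_mono) auto
  then show ?thesis
    by (simp add: pois_less_def pois_def sum_distrib_right exp_minus)
qed

lemma measurable_pois [measurable (raw)]:
  assumes [measurable]: "f \<in> borel_measurable N"
  shows "(\<lambda>w. pois (f w) j) \<in> borel_measurable N"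
  unfolding pois_def by measurable

lemma measurable_pois_less [measurable (raw)]:
  assumes [measurable]: "f \<in> borel_measurable N"
  shows "(\<lambda>w. pois_less k (f w)) \<in> borel_measurable N"
  unfolding pois_less_def by measurable

lemma sum_mset_of_bool:
  "(\<Sum>y\<in>#\<mu>. of_bool (P y) * z) = of_nat (size (filter_mset P \<mu>)) * (z :: 'b :: comm_semiring_1)"
  by (induction \<mu>) (auto simp: distrib_right)

lemma sum_mset_of_bool': "(\<Sum>y\<in>#\<mu>. of_bool (P y)) = (of_nat (size (filter_mset P \<mu>)) :: 'b :: comm_semiring_1)"
  using sum_mset_of_bool[of P 1 \<mu>] by simp

lemma ball_count_eq: "ball_count \<mu> x \<rho> = size (filter_mset (\<lambda>y. y \<in> tball x \<rho>) \<mu>)"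
  by (simp add: ball_count_def)

lemma ball_count_add: "ball_count (add_mset y \<mu>) x \<rho> = of_bool (tdist x y \<le> \<rho>) + ball_count \<mu> x \<rho>"
  by (simp add: ball_count_def mem_tball)

lemma ball_count_conf: "ball_count (conf n X) x \<rho> = (\<Sum>i<n. of_bool (tdist x (X i) \<le> \<rho>))"
  by (simp add: ball_count_def size_filter_conf mem_tball)

lemma measurable_ball_count_conf [measurable (raw)]:
  assumes [measurable]: "\<And>i. (\<lambda>w. X w i) \<in> borel_measurable N" "f \<in> borel_measurable N"
  shows "(\<lambda>w. ball_count (conf n (X w)) (f w) \<rho>) \<in> measurable N (count_space UNIV)"
  unfolding ball_count_conf by measurable

lemma measurable_ball_count_add_conf [measurable (raw)]:
  assumes [measurable]: "\<And>i. (\<lambda>w. X w i) \<in> borel_measurable N" "f \<in> borel_measurable N" "g \<in> borel_measurable N"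
  shows "(\<lambda>w. ball_count (add_mset (g w) (conf n (X w))) (f w) \<rho>) \<in> measurable N (count_space UNIV)"
proof -
  have "(\<lambda>w. ball_count (conf (Suc n) (case_nat (g w) (X w))) (f w) \<rho>) \<in> measurable N (count_space UNIV)"
    by measurable
  then show ?thesis by (simp only: conf_case_nat)
qed

lemma I_sk_eq: "I_sk \<rho> k \<mu> = real (size (filter_mset (\<lambda>x. ball_count \<mu> x \<rho> \<le> k) \<mu>))"
  using sum_mset_of_bool'[of "\<lambda>x. ball_count \<mu> x \<rho> \<le> k" \<mu>] by (simp add: I_sk_def of_bool_def)

definition vol :: "real \<Rightarrow> real^'d \<Rightarrow> real" where
  "vol \<rho> x = measure unif_T (tball x \<rho>)"

lemma vol_nonneg: "0 \<le> vol \<rho> x"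
  by (simp add: vol_def)

context
begin

interpretation U: prob_space "unif_T :: (real^'d) measure" by (rule prob_space_unif_T)

lemma emeasure_tball: "emeasure (unif_T :: (real^'d) measure) (tball x \<rho>) = ennreal (vol \<rho> x)"
  by (simp add: vol_def U.emeasure_eq_measure)

lemma nn_integral_tball: "(\<integral>\<^sup>+y. of_bool (tdist x y \<le> \<rho>) \<partial>(unif_T :: (real^'d) measure)) = ennreal (vol \<rho> x)"
proof -
  have "(\<integral>\<^sup>+y. of_bool (tdist x y \<le> \<rho>) \<partial>(unif_T :: (real^'d) measure)) = (\<integral>\<^sup>+y. indicator (tball x \<rho>) y \<partial>unif_T)"
    by (intro nn_integral_cong) (simp add: indicator_def mem_tball)
  then show ?thesis by (simp add: emeasure_tball)
qed

lemma measurable_vol [measurable]: "vol \<rho> \<in> borel_measurable (borel :: (real^'d) measure)"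
proof -
  have "(\<lambda>x. enn2real (\<integral>\<^sup>+y. of_bool (tdist x y \<le> \<rho>) \<partial>(unif_T :: (real^'d) measure))) \<in> borel_measurable (borel :: (real^'d) measure)"
    by measurable
  then show ?thesis by (simp add: nn_integral_tball vol_nonneg)
qed

abbreviation PE :: "real \<Rightarrow> ((real^'d) multiset \<Rightarrow> ennreal) \<Rightarrow> ennreal" where
  "PE s F \<equiv> \<integral>\<^sup>+\<omega>. F (PPconf \<omega>) \<partial>pp (unif_T :: (real^'d) measure) s"

lemma mecke_torus:
  fixes f :: "real^'d \<Rightarrow> (real^'d) multiset \<Rightarrow> ennreal"
  assumes "0 \<le> s"
    and "\<And>n. (\<lambda>(y, x). f y (conf n x)) \<in> borel_measurable (borel \<Otimes>\<^sub>M seq_space borel)"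
  shows "PE s (\<lambda>\<mu>. \<Sum>y\<in>#\<mu>. f y \<mu>) = ennreal s * (\<integral>\<^sup>+y. PE s (\<lambda>\<mu>. f y (add_mset y \<mu>)) \<partial>unif_T)"
proof (rule mecke[OF prob_space_unif_T \<open>0 \<le> s\<close>])
  show "(\<lambda>(y, x). f y (conf n x)) \<in> borel_measurable (unif_T \<Otimes>\<^sub>M seq_space unif_T)" for n
    using assms(2)[of n] by (simp cong: measurable_cong_sets sets_PiM_cong sets_pair_measure_cong)
qed

lemma PE_ball_count:
  fixes x :: "real^'d"
  assumes "0 \<le> s"
  shows "PE s (\<lambda>\<mu>. of_bool (ball_count \<mu> x \<rho> = j)) = ennreal (pois (s * vol \<rho> x) j)"
    and "PE s (\<lambda>\<mu>. of_bool (ball_count \<mu> x \<rho> < j)) = ennreal (pois_less j (s * vol \<rho> x))"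
  using poisson_count[OF prob_space_unif_T assms, of "tball x \<rho>"] by (simp_all add: ball_count_def vol_def)

text \<open>The balls are disjoint, so the count in the second is not affected by points added in
  the first, as \<open>poisson_count_less_indep\<close> requires.\<close>

lemma PE_two_balls:
  fixes x y :: "real^'d"
  assumes "0 \<le> s" "tdist x y > 2 * \<rho>"
  shows "PE s (\<lambda>\<mu>. of_bool (ball_count \<mu> x \<rho> < k \<and> ball_count \<mu> y \<rho> < k))
    = ennreal (pois_less k (s * vol \<rho> x)) * ennreal (pois_less k (s * vol \<rho> y))"
proof -
  have "PE s (\<lambda>\<mu>. of_bool (ball_count \<mu> x \<rho> < k) * of_bool (ball_count \<mu> y \<rho> < k))
    = ennreal (pois_less k (s * measure unif_T (tball x \<rho>))) * PE s (\<lambda>\<mu>. of_bool (ball_count \<mu> y \<rho> < k))"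
    unfolding ball_count_eq[of _ x]
  proof (rule poisson_count_less_indep[OF prob_space_unif_T \<open>0 \<le> s\<close>, where H = "\<lambda>\<mu>. of_bool (ball_count \<mu> y \<rho> < k)"])
    fix z and \<mu> :: "(real^'d) multiset" assume "z \<in> tball x \<rho>"
    then show "(of_bool (ball_count (add_mset z \<mu>) y \<rho> < k) :: ennreal) = of_bool (ball_count \<mu> y \<rho> < k)"
      using disjoint_tballs[OF assms(2)] by (auto simp: ball_count_add mem_tball)
  qed measurable
  then show ?thesis using PE_ball_count(2)[OF \<open>0 \<le> s\<close>, of y \<rho> k]
    by (simp add: vol_def of_bool_conj)
qed

lemma PE_count_eq:
  assumes "0 \<le> s" "0 \<le> \<rho>"
  shows "PE s (\<lambda>\<mu> :: (real^'d) multiset. \<Sum>x\<in>#\<mu>. of_bool (ball_count \<mu> x \<rho> = Suc j))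
    = ennreal s * (\<integral>\<^sup>+x. ennreal (pois (s * vol \<rho> x) j) \<partial>(unif_T :: (real^'d) measure))"
proof -
  have "PE s (\<lambda>\<mu> :: (real^'d) multiset. \<Sum>x\<in>#\<mu>. of_bool (ball_count \<mu> x \<rho> = Suc j))
      = ennreal s * (\<integral>\<^sup>+x. PE s (\<lambda>\<mu>. of_bool (ball_count (add_mset x \<mu>) x \<rho> = Suc j)) \<partial>(unif_T :: (real^'d) measure))"
    by (rule mecke_torus[OF \<open>0 \<le> s\<close>, where f = "\<lambda>x \<mu>. of_bool (ball_count \<mu> x \<rho> = Suc j)"]) measurable
  then show ?thesis using assms by (simp add: ball_count_add PE_ball_count)
qed

lemma PE_count_le:
  assumes "0 \<le> s" "0 \<le> \<rho>"
  shows "PE s (\<lambda>\<mu> :: (real^'d) multiset. \<Sum>x\<in>#\<mu>. of_bool (ball_count \<mu> x \<rho> \<le> k))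
    = ennreal s * (\<integral>\<^sup>+x. ennreal (pois_less k (s * vol \<rho> x)) \<partial>(unif_T :: (real^'d) measure))"
proof -
  have "PE s (\<lambda>\<mu> :: (real^'d) multiset. \<Sum>x\<in>#\<mu>. of_bool (ball_count \<mu> x \<rho> \<le> k))
      = ennreal s * (\<integral>\<^sup>+x. PE s (\<lambda>\<mu>. of_bool (ball_count (add_mset x \<mu>) x \<rho> \<le> k)) \<partial>(unif_T :: (real^'d) measure))"
    by (rule mecke_torus[OF \<open>0 \<le> s\<close>, where f = "\<lambda>x \<mu>. of_bool (ball_count \<mu> x \<rho> \<le> k)"]) measurable
  then show ?thesis using assms by (simp add: ball_count_add PE_ball_count flip: less_eq_Suc_le)
qed

text \<open>The Mecke formula is applied twice. The first application leaves a diagonal term, which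
  vanishes because x has distance 0 from itself. Neither added point lies in the ball of the other,
  so each count drops only by the centre itself.\<close>

lemma PE_far_pairs:
  assumes "0 \<le> s" "0 \<le> \<rho>"
  shows "PE s (\<lambda>\<mu> :: (real^'d) multiset. \<Sum>x\<in>#\<mu>. \<Sum>y\<in>#\<mu>. of_bool (tdist x y > 2 * \<rho> \<and> ball_count \<mu> x \<rho> \<le> k \<and> ball_count \<mu> y \<rho> \<le> k))
    = ennreal s * (\<integral>\<^sup>+x. ennreal s * (\<integral>\<^sup>+y. of_bool (tdist x y > 2 * \<rho>) *
        (ennreal (pois_less k (s * vol \<rho> x)) * ennreal (pois_less k (s * vol \<rho> y))) \<partial>unif_T) \<partial>(unif_T :: (real^'d) measure))"
proof -
  define g where "g x y \<mu> = (of_bool (tdist x y > 2 * \<rho> \<and> ball_count \<mu> x \<rho> \<le> k \<and> ball_count \<mu> y \<rho> \<le> k) :: ennreal)"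
    for x y :: "real^'d" and \<mu>
  have pair: "PE s (\<lambda>\<mu>. g x y (add_mset x (add_mset y \<mu>))) = of_bool (tdist x y > 2 * \<rho>) *
        (ennreal (pois_less k (s * vol \<rho> x)) * ennreal (pois_less k (s * vol \<rho> y)))" for x y
  proof (cases "tdist x y > 2 * \<rho>")
    case True
    then have "\<not> tdist x y \<le> \<rho>" "\<not> tdist y x \<le> \<rho>" using \<open>0 \<le> \<rho>\<close> tdist_commute[of x y] by auto
    then have "g x y (add_mset x (add_mset y \<mu>)) = of_bool (ball_count \<mu> x \<rho> < k \<and> ball_count \<mu> y \<rho> < k)" for \<mu>
      using True \<open>0 \<le> \<rho>\<close> by (simp add: g_def ball_count_add Suc_le_eq)
    then show ?thesis using PE_two_balls[OF \<open>0 \<le> s\<close> True] True by simp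
  qed (simp add: g_def)
  have g0: "g x x \<mu> = 0" for x \<mu>
    using assms by (simp add: g_def)
  have inner: "PE s (\<lambda>\<mu>. \<Sum>y\<in>#\<mu>. g x y (add_mset x \<mu>)) = ennreal s * (\<integral>\<^sup>+y. PE s (\<lambda>\<mu>. g x y (add_mset x (add_mset y \<mu>))) \<partial>unif_T)" for x
    by (rule mecke_torus[OF \<open>0 \<le> s\<close>, where f = "\<lambda>y \<mu>. g x y (add_mset x \<mu>)"])
      (unfold g_def, measurable)
  have "PE s (\<lambda>\<mu>. \<Sum>x\<in>#\<mu>. \<Sum>y\<in>#\<mu>. g x y \<mu>)
      = ennreal s * (\<integral>\<^sup>+x. PE s (\<lambda>\<mu>. \<Sum>y\<in>#add_mset x \<mu>. g x y (add_mset x \<mu>)) \<partial>unif_T)"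
    by (rule mecke_torus[OF \<open>0 \<le> s\<close>, where f = "\<lambda>x \<mu>. \<Sum>y\<in>#\<mu>. g x y \<mu>"]) (unfold sum_mset_conf g_def, measurable)
  also have "\<dots> = ennreal s * (\<integral>\<^sup>+x. PE s (\<lambda>\<mu>. \<Sum>y\<in>#\<mu>. g x y (add_mset x \<mu>)) \<partial>unif_T)"
    by (simp add: g0)
  also have "\<dots> = ennreal s * (\<integral>\<^sup>+x. ennreal s * (\<integral>\<^sup>+y. PE s (\<lambda>\<mu>. g x y (add_mset x (add_mset y \<mu>))) \<partial>unif_T) \<partial>unif_T)"
    unfolding inner ..
  finally show ?thesis unfolding pair unfolding g_def .
qed

end

section \<open>Variance bounds\<close>

lemma PPspace_eq: "PPspace TYPE('d::finite) s = pp (unif_T :: (real^'d) measure) s"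
  by (simp add: PPspace_def pp_def)

lemma unif_T_density: "(unif_T :: (real^'d) measure) = density lborel (\<lambda>x. ennreal (indicator cube x))"
  by (simp add: unif_T_def uniform_measure_def emeasure_cube ennreal_indicator divide_ennreal_def)

lemma set_integral_cube:
  fixes g :: "real^'d \<Rightarrow> real"
  assumes "g \<in> borel_measurable borel"
  shows "set_lebesgue_integral lborel cube g = (\<integral>x. g x \<partial>unif_T)"
  using assms by (simp add: unif_T_density set_lebesgue_integral_def integral_density)

lemma measurable_pp_pair:
  assumes "\<And>n. (\<lambda>(x, p). F (n, x) p) \<in> measurable (seq_space M \<Otimes>\<^sub>M N) L"
  shows "(\<lambda>(\<omega>, p). F \<omega> p) \<in> measurable (pp M s \<Otimes>\<^sub>M N) L"
proof -
  have "(\<lambda>w. F (n, snd (fst w)) (snd w)) \<in> measurable (pp M s \<Otimes>\<^sub>M N) L" for n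
    using measurable_compose[OF _ assms[of n], of "\<lambda>w. (snd (fst w), snd w)" "pp M s \<Otimes>\<^sub>M N"]
    by (simp add: pp_def)
  moreover have "(\<lambda>w. fst (fst w)) \<in> measurable (pp M s \<Otimes>\<^sub>M N) (count_space UNIV)"
  proof -
    have "fst \<in> measurable (pp M s) (measure_pmf (poi s))" unfolding pp_def by measurable
    then have "fst \<in> measurable (pp M s) (count_space UNIV)" by simp
    then show ?thesis by (rule measurable_compose[OF measurable_fst])
  qed
  ultimately have "(\<lambda>w. F (fst (fst w), snd (fst w)) (snd w)) \<in> measurable (pp M s \<Otimes>\<^sub>M N) L"
    by (rule measurable_compose_countable)
  then show ?thesis by (simp add: case_prod_beta)
qed

text \<open>The new point enters the count if its own degree is low. An old point y leaves it
  exactly when x falls into its ball and the count there was already k.\<close>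

lemma Dop_I_sk:
  assumes "0 \<le> \<rho>"
  shows "Dop (I_sk \<rho> k) x \<mu> = of_bool (ball_count \<mu> x \<rho> < k)
    - real (size (filter_mset (\<lambda>y. tdist x y \<le> \<rho> \<and> ball_count \<mu> y \<rho> = k) \<mu>))"
proof -
  have "size (filter_mset (\<lambda>y. f y \<le> k) \<nu>) = size (filter_mset (\<lambda>y. of_bool (tdist y x \<le> \<rho>) + f y \<le> k) \<nu>)
      + size (filter_mset (\<lambda>y. tdist x y \<le> \<rho> \<and> f y = k) \<nu>)" for \<nu> and f :: "_ \<Rightarrow> nat"
    by (induction \<nu>) (auto simp: tdist_commute)
  from this[of "\<lambda>y. ball_count \<mu> y \<rho>" \<mu>] show ?thesis
    using assms by (simp add: Dop_def I_sk_eq ball_count_add Suc_le_eq)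
qed

text \<open>What \<open>torus_cells\<close> provides at one scale. In the end \<open>lo\<close> and
  \<open>hi\<close> are c0 r^d and r^d, with K and c0 independent of s.\<close>

locale cell_cover =
  fixes cell :: "real^'d::finite \<Rightarrow> 'd \<Rightarrow> int" and \<rho> lo hi :: real and K :: nat
  assumes \<rho>_pos: "0 < \<rho>" and hi_nonneg: "0 \<le> hi"
    and sets_cell [measurable]: "\<And>j. {y. cell y = j} \<in> sets borel"
    and tdist_cell: "\<And>y z. cell y = cell z \<Longrightarrow> tdist y z \<le> \<rho>"
    and finite_near: "\<And>x. finite (cell ` {y. tdist x y \<le> 2 * \<rho>})"
    and card_near: "\<And>x. card (cell ` {y. tdist x y \<le> 2 * \<rho>}) \<le> K"
    and cell_ge: "\<And>y. lo \<le> measure unif_T {z. cell z = cell y}"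
    and cell_le: "\<And>y. measure unif_T {z. cell z = cell y} \<le> hi"
begin

interpretation U: prob_space "unif_T :: (real^'d) measure" by (rule prob_space_unif_T)

text \<open>A ball of radius \<rho> contains the cell of its centre. Conversely at most K cells
  cover the ball of radius 2 \<rho>, which gives the upper bounds below.\<close>

lemma vol_ge: fixes x :: "real^'d" shows "lo \<le> vol \<rho> x"
proof -
  have "measure unif_T {z. cell z = cell x} \<le> vol \<rho> x"
    unfolding vol_def using tdist_cell by (intro U.finite_measure_mono) (auto simp: mem_tball)
  then show ?thesis using cell_ge[of x] by linarith
qed

lemma vol_2_le: fixes x :: "real^'d" shows "vol (2 * \<rho>) x \<le> real K * hi"
proof -
  let ?J = "cell ` {y. tdist x y \<le> 2 * \<rho>}"
  have "(\<Union>j\<in>?J. {z. cell z = j}) \<in> sets unif_T"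
    using finite_near by (intro sets.finite_UN) auto
  then have "vol (2 * \<rho>) x \<le> measure unif_T (\<Union>j\<in>?J. {z. cell z = j})"
    unfolding vol_def by (intro U.finite_measure_mono) (auto simp: mem_tball)
  also have "\<dots> \<le> (\<Sum>j\<in>?J. measure unif_T {z. cell z = j})"
    using finite_near by (intro U.finite_measure_subadditive_finite) auto
  also have "\<dots> \<le> (\<Sum>j\<in>?J. hi)" using cell_le by (intro sum_mono) auto
  also have "\<dots> \<le> real K * hi" using card_near hi_nonneg by (simp add: mult_right_mono)
  finally show ?thesis .
qed

lemma vol_le: fixes x :: "real^'d" shows "vol \<rho> x \<le> real K * hi"
proof -
  have "vol \<rho> x \<le> vol (2 * \<rho>) x"
    unfolding vol_def using \<rho>_pos by (intro U.finite_measure_mono) (auto simp: mem_tball)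
  then show ?thesis using vol_2_le[of x] by linarith
qed

text \<open>Points whose ball holds at most \<open>k\<close> points fill each cell at most \<open>k\<close> times,
  because the ball contains the cell of its centre.\<close>

lemma packing:
  fixes x :: "real^'d"
  shows "size (filter_mset (\<lambda>y. tdist x y \<le> 2 * \<rho> \<and> ball_count \<mu> y \<rho> \<le> k) \<mu>) \<le> K * k"
proof -
  define F where "F = filter_mset (\<lambda>y. tdist x y \<le> 2 * \<rho> \<and> ball_count \<mu> y \<rho> \<le> k) \<mu>"
  have sub: "cell ` set_mset F \<subseteq> cell ` {y. tdist x y \<le> 2 * \<rho>}" by (auto simp: F_def)
  have "size F = size (image_mset cell F)" by simp
  also have "\<dots> = (\<Sum>j\<in>cell ` set_mset F. count (image_mset cell F) j)"
    by (simp add: size_multiset_overloaded_eq)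
  also have "\<dots> \<le> (\<Sum>j\<in>cell ` set_mset F. k)"
  proof (rule sum_mono)
    fix j assume "j \<in> cell ` set_mset F"
    then obtain y where y: "y \<in># F" "cell y = j" by auto
    have "count (image_mset cell F) j = size (filter_mset (\<lambda>z. cell z = j) F)"
      by (induction F) auto
    also have "\<dots> \<le> size (filter_mset (\<lambda>z. z \<in> tball y \<rho>) \<mu>)"
    proof (rule size_mset_mono)
      have "filter_mset (\<lambda>z. cell z = j) F \<subseteq># filter_mset (\<lambda>z. cell z = j) \<mu>"
        unfolding F_def by (intro multiset_filter_mono) simp
      also have "\<dots> \<subseteq># filter_mset (\<lambda>z. z \<in> tball y \<rho>) \<mu>"
        using y(2) tdist_cell by (intro filter_mset_mono_strong) (auto simp: mem_tball)
      finally show "filter_mset (\<lambda>z. cell z = j) F \<subseteq># filter_mset (\<lambda>z. z \<in> tball y \<rho>) \<mu>" .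
    qed
    also have "\<dots> \<le> k" using y(1) by (simp add: F_def ball_count_def)
    finally show "count (image_mset cell F) j \<le> k" .
  qed
  also have "\<dots> \<le> K * k"
    using card_mono[OF finite_near sub] card_near[of x] by (simp add: mult_right_mono)
  finally show ?thesis by (simp add: F_def)
qed

text \<open>The expectation of \<open>I_sk\<close>; see \<open>EI_eq\<close>.\<close>

definition low :: "real \<Rightarrow> nat \<Rightarrow> real" where
  "low s k = s * (\<integral>x. pois_less k (s * vol \<rho> x) \<partial>(unif_T :: (real^'d) measure))"

context
  fixes s :: real and k :: nat
  assumes s: "0 \<le> s"
begin

lemma integrable_pois_less: "integrable (unif_T :: (real^'d) measure) (\<lambda>x. pois_less k (s * vol \<rho> x))"
  using s by (intro U.integrable_const_bound[of _ 1]) (auto simp: pois_less_nonneg pois_less_le_1 vol_nonneg)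

lemma low_nonneg: "0 \<le> low s k"
  using s by (simp add: low_def pois_less_nonneg vol_nonneg)

lemma nn_low: "ennreal s * (\<integral>\<^sup>+x. ennreal (pois_less k (s * vol \<rho> x)) \<partial>(unif_T :: (real^'d) measure)) = ennreal (low s k)"
  using s by (simp add: nn_integral_eq_integral integrable_pois_less pois_less_nonneg vol_nonneg low_def ennreal_mult)

interpretation P: prob_space "pp (unif_T :: (real^'d) measure) s"
  by (rule prob_space_pp[OF prob_space_unif_T])

lemma measurable_I_sk [measurable]: "(\<lambda>\<omega>. I_sk \<rho> k (PPconf \<omega>)) \<in> borel_measurable (pp (unif_T :: (real^'d) measure) s)"
  by (rule pp_measurable[OF prob_space_unif_T]) (simp add: I_sk_eq size_filter_conf, measurable)

lemma nn_integral_I_sk: "(\<integral>\<^sup>+\<omega>. ennreal (I_sk \<rho> k (PPconf \<omega>)) \<partial>pp (unif_T :: (real^'d) measure) s) = ennreal (low s k)"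
proof -
  have "ennreal (I_sk \<rho> k \<mu>) = (\<Sum>x\<in>#\<mu>. of_bool (ball_count \<mu> x \<rho> \<le> k))" for \<mu> :: "(real^'d) multiset"
    by (simp add: I_sk_eq sum_mset_of_bool' ennreal_of_nat_eq_real_of_nat)
  then show ?thesis
    using PE_count_le[OF s, of \<rho> k, where 'd = 'd] \<rho>_pos nn_low by simp
qed

lemma I_sk_nonneg: fixes \<mu> :: "(real^'d) multiset" shows "0 \<le> I_sk \<rho> k \<mu>"
  by (simp add: I_sk_eq)

lemma integrable_I_sk: "integrable (pp (unif_T :: (real^'d) measure) s) (\<lambda>\<omega>. I_sk \<rho> k (PPconf \<omega>))"
  by (rule integrableI_nonneg) (simp_all add: I_sk_nonneg nn_integral_I_sk)

lemma EI_eq: "EI TYPE('d) s \<rho> k = low s k"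
  unfolding EI_def PPspace_eq
  by (rule integral_eq_nn_integral[THEN trans]) (simp_all add: I_sk_nonneg nn_integral_I_sk low_nonneg)

text \<open>The second moment of I is \<open>near2\<close> + \<open>far2\<close>. By independence
  beyond distance 2 \<rho>, the squared mean is \<open>far2\<close> + \<open>prod2\<close>. So the
  variance is \<open>near2\<close> - \<open>prod2\<close>. The pairs in \<open>near2\<close> include
  the diagonal.\<close>

definition near2 :: ennreal where
  "near2 = PE s (\<lambda>\<mu> :: (real^'d) multiset. \<Sum>x\<in>#\<mu>. \<Sum>y\<in>#\<mu>. of_bool (tdist x y \<le> 2 * \<rho> \<and> ball_count \<mu> x \<rho> \<le> k \<and> ball_count \<mu> y \<rho> \<le> k))"

definition far2 :: ennreal where
  "far2 = PE s (\<lambda>\<mu> :: (real^'d) multiset. \<Sum>x\<in>#\<mu>. \<Sum>y\<in>#\<mu>. of_bool (tdist x y > 2 * \<rho> \<and> ball_count \<mu> x \<rho> \<le> k \<and> ball_count \<mu> y \<rho> \<le> k))"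

definition prod2 :: ennreal where
  "prod2 = ennreal s * (\<integral>\<^sup>+x. ennreal s * (\<integral>\<^sup>+y. of_bool (tdist x y \<le> 2 * \<rho>) *
        (ennreal (pois_less k (s * vol \<rho> x)) * ennreal (pois_less k (s * vol \<rho> y))) \<partial>unif_T) \<partial>(unif_T :: (real^'d) measure))"

lemma near_inner: fixes x :: "real^'d" shows "(\<Sum>y\<in>#\<mu>. of_bool (tdist x y \<le> 2 * \<rho> \<and> ball_count \<mu> x \<rho> \<le> k \<and> ball_count \<mu> y \<rho> \<le> k))
    = (of_bool (ball_count \<mu> x \<rho> \<le> k) * of_nat (size (filter_mset (\<lambda>y. tdist x y \<le> 2 * \<rho> \<and> ball_count \<mu> y \<rho> \<le> k) \<mu>)) :: ennreal)"
  by (cases "ball_count \<mu> x \<rho> \<le> k") (simp_all add: sum_mset_of_bool')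

text \<open>For every configuration, \<open>packing\<close> leaves each low-degree point at most K k
  partners.\<close>

lemma near2_le: "near2 \<le> ennreal (real (K * k) * low s k)"
proof -
  have "near2 \<le> PE s (\<lambda>\<mu> :: (real^'d) multiset. of_nat (K * k) * (\<Sum>x\<in>#\<mu>. of_bool (ball_count \<mu> x \<rho> \<le> k)))"
    unfolding near2_def near_inner sum_mset_distrib_left
  proof (intro nn_integral_mono sum_mset_mono)
    fix \<omega> and x :: "real^'d"
    have "(of_nat (size (filter_mset (\<lambda>y. tdist x y \<le> 2 * \<rho> \<and> ball_count (PPconf \<omega>) y \<rho> \<le> k) (PPconf \<omega>))) :: ennreal) \<le> of_nat (K * k)"
      using packing[of x "PPconf \<omega>" k] by (simp add: ennreal_of_nat_eq_real_of_nat ennreal_leI del: of_nat_mult)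
    then show "of_bool (ball_count (PPconf \<omega>) x \<rho> \<le> k) * of_nat (size (filter_mset (\<lambda>y. tdist x y \<le> 2 * \<rho> \<and> ball_count (PPconf \<omega>) y \<rho> \<le> k) (PPconf \<omega>)))
        \<le> of_nat (K * k) * (of_bool (ball_count (PPconf \<omega>) x \<rho> \<le> k) :: ennreal)"
      by (cases "ball_count (PPconf \<omega>) x \<rho> \<le> k") (simp_all del: of_nat_mult)
  qed
  also have "\<dots> = of_nat (K * k) * ennreal (low s k)"
  proof (subst nn_integral_cmult)
    show "(\<lambda>\<omega>. \<Sum>x\<in>#PPconf \<omega>. of_bool (ball_count (PPconf \<omega>) x \<rho> \<le> k) :: ennreal) \<in> borel_measurable (pp (unif_T :: (real^'d) measure) s)"
      by (rule pp_measurable[OF prob_space_unif_T]) (simp only: PPconf_pair sum_mset_conf, measurable)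
  qed (use PE_count_le[OF s, of \<rho> k, where 'd = 'd] \<rho>_pos nn_low in simp)
  finally show ?thesis using low_nonneg by (simp add: ennreal_of_nat_eq_real_of_nat ennreal_mult)
qed

text \<open>The diagonal pairs alone contribute \<open>low s k\<close>.\<close>

lemma near2_ge: "ennreal (low s k) \<le> near2"
proof -
  have "ennreal (low s k) = PE s (\<lambda>\<mu> :: (real^'d) multiset. \<Sum>x\<in>#\<mu>. of_bool (ball_count \<mu> x \<rho> \<le> k))"
    using PE_count_le[OF s, of \<rho> k, where 'd = 'd] \<rho>_pos nn_low by simp
  also have "\<dots> \<le> near2"
    unfolding near2_def near_inner
  proof (intro nn_integral_mono sum_mset_mono)
    fix \<mu> and x :: "real^'d" assume x: "x \<in># \<mu>"
    have "1 \<le> size (filter_mset (\<lambda>y. tdist x y \<le> 2 * \<rho> \<and> ball_count \<mu> y \<rho> \<le> k) \<mu>)" if "ball_count \<mu> x \<rho> \<le> k"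
    proof -
      have "x \<in># filter_mset (\<lambda>y. tdist x y \<le> 2 * \<rho> \<and> ball_count \<mu> y \<rho> \<le> k) \<mu>"
        using x that \<rho>_pos by simp
      then show ?thesis by (metis Suc_le_eq One_nat_def empty_not_add_mset multi_member_split nonempty_has_size)
    qed
    then show "(of_bool (ball_count \<mu> x \<rho> \<le> k) :: ennreal) \<le> of_bool (ball_count \<mu> x \<rho> \<le> k) * of_nat (size (filter_mset (\<lambda>y. tdist x y \<le> 2 * \<rho> \<and> ball_count \<mu> y \<rho> \<le> k) \<mu>))"
      using of_nat_mono by (fastforce simp: of_bool_def)
  qed
  finally show ?thesis .
qed

lemma nn_integral_I_sk_sq:
  "(\<integral>\<^sup>+\<omega>. ennreal ((I_sk \<rho> k (PPconf \<omega>))\<^sup>2) \<partial>pp (unif_T :: (real^'d) measure) s) = near2 + far2"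
proof -
  have "ennreal ((I_sk \<rho> k \<mu>)\<^sup>2) = (\<Sum>x\<in>#\<mu>. \<Sum>y\<in>#\<mu>. of_bool (tdist x y \<le> 2 * \<rho> \<and> ball_count \<mu> x \<rho> \<le> k \<and> ball_count \<mu> y \<rho> \<le> k))
    + (\<Sum>x\<in>#\<mu>. \<Sum>y\<in>#\<mu>. of_bool (tdist x y > 2 * \<rho> \<and> ball_count \<mu> x \<rho> \<le> k \<and> ball_count \<mu> y \<rho> \<le> k))" for \<mu> :: "(real^'d) multiset"
  proof -
    have "ennreal ((I_sk \<rho> k \<mu>)\<^sup>2) = (\<Sum>x\<in>#\<mu>. of_bool (ball_count \<mu> x \<rho> \<le> k)) * (\<Sum>y\<in>#\<mu>. of_bool (ball_count \<mu> y \<rho> \<le> k))"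
      by (simp add: I_sk_eq sum_mset_of_bool' ennreal_of_nat_eq_real_of_nat power2_eq_square ennreal_mult)
    also have "\<dots> = (\<Sum>x\<in>#\<mu>. \<Sum>y\<in>#\<mu>. of_bool (ball_count \<mu> x \<rho> \<le> k) * of_bool (ball_count \<mu> y \<rho> \<le> k))"
      unfolding sum_mset_distrib_right unfolding sum_mset_distrib_left ..
    finally show ?thesis
      unfolding sum_mset.distrib[symmetric]
      by (simp only:) (intro arg_cong[where f = sum_mset] image_mset_cong, auto simp: of_bool_def)
  qed
  moreover have "(\<lambda>\<omega>. \<Sum>x\<in>#PPconf \<omega>. \<Sum>y\<in>#PPconf \<omega>. of_bool (tdist x y \<le> 2 * \<rho> \<and> ball_count (PPconf \<omega>) x \<rho> \<le> k \<and> ball_count (PPconf \<omega>) y \<rho> \<le> k) :: ennreal)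
      \<in> borel_measurable (pp (unif_T :: (real^'d) measure) s)"
    by (rule pp_measurable[OF prob_space_unif_T]) (simp only: PPconf_pair sum_mset_conf, measurable)
  moreover have "(\<lambda>\<omega>. \<Sum>x\<in>#PPconf \<omega>. \<Sum>y\<in>#PPconf \<omega>. of_bool (tdist x y > 2 * \<rho> \<and> ball_count (PPconf \<omega>) x \<rho> \<le> k \<and> ball_count (PPconf \<omega>) y \<rho> \<le> k) :: ennreal)
      \<in> borel_measurable (pp (unif_T :: (real^'d) measure) s)"
    by (rule pp_measurable[OF prob_space_unif_T]) (simp only: PPconf_pair sum_mset_conf, measurable)
  ultimately show ?thesis by (simp only: nn_integral_add near2_def far2_def)
qed

lemma far2_prod2: "far2 + prod2 = ennreal ((low s k)\<^sup>2)"
proof -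
  let ?p = "\<lambda>x :: real^'d. ennreal (pois_less k (s * vol \<rho> x))"
  have "far2 + prod2 = ennreal s * (\<integral>\<^sup>+x. ennreal s * (\<integral>\<^sup>+y. (of_bool (tdist x y > 2 * \<rho>) + of_bool (tdist x y \<le> 2 * \<rho>)) * (?p x * ?p y) \<partial>unif_T) \<partial>unif_T)"
    unfolding far2_def prod2_def PE_far_pairs[OF s less_imp_le[OF \<rho>_pos]]
    by (simp add: nn_integral_add distrib_left distrib_right)
  also have "\<dots> = ennreal s * (\<integral>\<^sup>+x. ennreal s * (\<integral>\<^sup>+y. ?p x * ?p y \<partial>unif_T) \<partial>unif_T)"
  proof -
    have "of_bool (t > 2 * \<rho>) + of_bool (t \<le> 2 * \<rho>) = (1 :: ennreal)" for t :: real
      by (cases "t \<le> 2 * \<rho>") auto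
    then show ?thesis by (simp only: mult_1)
  qed
  also have "\<dots> = ennreal (low s k) * ennreal (low s k)"
    by (simp add: nn_integral_cmult nn_integral_multc nn_low[symmetric] mult_ac)
  finally show ?thesis using low_nonneg by (simp add: power2_eq_square ennreal_mult)
qed

text \<open>The inner integral runs over a ball of radius 2 \<rho>, so it is at most p0 times the
  volume of that ball. \<open>VarI_comparable\<close> applies this where the factor s p0 K
  \<open>hi\<close> is at most 1/2.\<close>

lemma prod2_le:
  assumes "\<And>x :: real^'d. pois_less k (s * vol \<rho> x) \<le> p0"
  shows "prod2 \<le> ennreal (low s k * (s * p0 * (real K * hi)))"
proof -
  let ?p = "\<lambda>x :: real^'d. ennreal (pois_less k (s * vol \<rho> x))"
  have p0: "0 \<le> p0" using assms[of undefined] pois_less_nonneg[of "s * vol \<rho> undefined" k] s vol_nonneg[of \<rho> undefined]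
    by (meson mult_nonneg_nonneg order_trans)
  have "prod2 \<le> ennreal s * (\<integral>\<^sup>+x. ennreal s * (\<integral>\<^sup>+y. of_bool (tdist x y \<le> 2 * \<rho>) * (?p x * ennreal p0) \<partial>unif_T) \<partial>unif_T)"
    unfolding prod2_def using assms by (intro mult_left_mono nn_integral_mono) (auto intro!: ennreal_leI)
  also have "\<dots> = ennreal s * (\<integral>\<^sup>+x. ennreal s * (ennreal (vol (2 * \<rho>) x) * (?p x * ennreal p0)) \<partial>unif_T)"
    by (simp add: nn_integral_multc nn_integral_tball)
  also have "\<dots> \<le> ennreal s * (\<integral>\<^sup>+x. ennreal s * (ennreal (real K * hi) * (?p x * ennreal p0)) \<partial>unif_T)"
    using vol_2_le by (intro mult_left_mono nn_integral_mono mult_right_mono) (auto intro!: ennreal_leI)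
  also have "\<dots> = ennreal s * (\<integral>\<^sup>+x. ?p x * ennreal (s * p0 * (real K * hi)) \<partial>unif_T)"
    using s p0 hi_nonneg by (simp add: ennreal_mult mult_ac)
  also have "\<dots> = ennreal (low s k) * ennreal (s * p0 * (real K * hi))"
    by (simp add: nn_integral_multc nn_low[symmetric] mult.assoc)
  finally show ?thesis using s p0 hi_nonneg low_nonneg by (simp add: ennreal_mult)
qed

text \<open>Written as a sum because \<open>near2\<close> and \<open>prod2\<close> are extended
  reals. The proof adds \<open>far2\<close> to both sides and cancels it, which is possible because
  \<open>far2\<close> is finite.\<close>

lemma VarI_eq:
  "ennreal (VarI TYPE('d) s \<rho> k) + prod2 = near2" "0 \<le> VarI TYPE('d) s \<rho> k"
proof -
  have fin: "near2 < top" "far2 < top"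
    using le_less_trans[OF near2_le ennreal_less_top] le_less_trans[OF _ ennreal_less_top, of far2 "(low s k)\<^sup>2"]
    by (auto simp flip: far2_prod2)
  have int2: "integrable (pp (unif_T :: (real^'d) measure) s) (\<lambda>\<omega>. (I_sk \<rho> k (PPconf \<omega>))\<^sup>2)"
    using fin by (intro integrableI_nonneg) (simp_all add: nn_integral_I_sk_sq)
  define e2 where "e2 = (\<integral>\<omega>. (I_sk \<rho> k (PPconf \<omega>))\<^sup>2 \<partial>pp (unif_T :: (real^'d) measure) s)"
  have e2: "ennreal e2 = near2 + far2"
    unfolding e2_def nn_integral_I_sk_sq[symmetric] using int2 by (intro nn_integral_eq_integral[symmetric]) auto
  have e20: "0 \<le> e2" by (simp add: e2_def)
  have EI: "(\<integral>\<omega>. I_sk \<rho> k (PPconf \<omega>) \<partial>pp (unif_T :: (real^'d) measure) s) = low s k"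
    using EI_eq by (simp add: EI_def PPspace_eq)
  have V: "VarI TYPE('d) s \<rho> k = e2 - (low s k)\<^sup>2"
    unfolding VarI_def EI_eq PPspace_eq e2_def using P.variance_eq[OF integrable_I_sk int2] by (simp add: EI)
  show V0: "0 \<le> VarI TYPE('d) s \<rho> k" by (simp add: VarI_def)
  have "ennreal (VarI TYPE('d) s \<rho> k) + prod2 + far2 = ennreal (VarI TYPE('d) s \<rho> k) + ennreal ((low s k)\<^sup>2)"
    by (simp add: far2_prod2[symmetric] add_ac)
  also have "\<dots> = near2 + far2"
    using V V0 by (simp add: e2[symmetric] flip: ennreal_plus)
  finally show "ennreal (VarI TYPE('d) s \<rho> k) + prod2 = near2"
    using fin(2) by (auto simp: add.commute[of _ far2] ennreal_add_left_cancel)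
qed

lemma VarI_le: "VarI TYPE('d) s \<rho> k \<le> real (K * k) * low s k"
proof -
  have "ennreal (VarI TYPE('d) s \<rho> k) \<le> near2"
    using VarI_eq(1) by (metis le_iff_add)
  also note near2_le
  finally show ?thesis using low_nonneg by (subst (asm) ennreal_le_iff) auto
qed

lemma VarI_ge:
  assumes "\<And>x :: real^'d. pois_less k (s * vol \<rho> x) \<le> p0"
  shows "low s k * (1 - s * p0 * (real K * hi)) \<le> VarI TYPE('d) s \<rho> k"
proof -
  have p0: "0 \<le> p0" using assms[of undefined] pois_less_nonneg[of "s * vol \<rho> undefined" k] s vol_nonneg[of \<rho> undefined]
    by (meson mult_nonneg_nonneg order_trans)
  have "ennreal (low s k) \<le> ennreal (VarI TYPE('d) s \<rho> k) + prod2" using near2_ge VarI_eq(1) by simp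
  also have "\<dots> \<le> ennreal (VarI TYPE('d) s \<rho> k) + ennreal (low s k * (s * p0 * (real K * hi)))"
    using prod2_le[OF assms] by (rule add_left_mono)
  finally have "low s k \<le> VarI TYPE('d) s \<rho> k + low s k * (s * p0 * (real K * hi))"
    using VarI_eq(2) low_nonneg s p0 hi_nonneg by (subst (asm) ennreal_plus[symmetric]) (auto simp del: ennreal_plus)
  then show ?thesis by (simp add: algebra_simps)
qed

end

end

section \<open>The difference operator\<close>

context cell_cover
begin

interpretation U: prob_space "unif_T :: (real^'d) measure" by (rule prob_space_unif_T)

context
  fixes s :: real and k :: nat
  assumes s: "0 \<le> s"
begin

interpretation P: prob_space "pp (unif_T :: (real^'d) measure) s"
  by (rule prob_space_pp[OF prob_space_unif_T])

lemma Dop_bounded: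
  fixes x :: "real^'d"
  shows "(Dop (I_sk \<rho> k) x \<mu>)\<^sup>2 \<le> (1 + real (K * k))\<^sup>2"
proof -
  have "size (filter_mset (\<lambda>y. tdist x y \<le> \<rho> \<and> ball_count \<mu> y \<rho> = k) \<mu>)
      \<le> size (filter_mset (\<lambda>y. tdist x y \<le> 2 * \<rho> \<and> ball_count \<mu> y \<rho> \<le> k) \<mu>)"
    using \<rho>_pos by (intro size_mset_mono filter_mset_mono_strong) auto
  also note packing
  finally have "real (size (filter_mset (\<lambda>y. tdist x y \<le> \<rho> \<and> ball_count \<mu> y \<rho> = k) \<mu>)) \<le> real (K * k)"
    by (rule of_nat_mono)
  then have "\<bar>Dop (I_sk \<rho> k) x \<mu>\<bar> \<le> 1 + real (K * k)"
    unfolding Dop_I_sk[OF less_imp_le[OF \<rho>_pos]] by (cases "ball_count \<mu> x \<rho> < k") auto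
  then show ?thesis using power_mono[of "\<bar>Dop (I_sk \<rho> k) x \<mu>\<bar>" _ 2] by simp
qed

lemma measurable_Dop:
  "(\<lambda>(\<omega>, x). (Dop (I_sk \<rho> k) x (PPconf \<omega>))\<^sup>2) \<in> borel_measurable (pp (unif_T :: (real^'d) measure) s \<Otimes>\<^sub>M unif_T)"
proof (rule measurable_pp_pair)
  fix n
  have "(\<lambda>(X, x). (of_bool (ball_count (conf n X) x \<rho> < k) -
      real (\<Sum>i<n. of_bool (tdist x (X i) \<le> \<rho> \<and> ball_count (conf n X) (X i) \<rho> = k)))\<^sup>2)
    \<in> borel_measurable (seq_space (unif_T :: (real^'d) measure) \<Otimes>\<^sub>M unif_T)"
    unfolding of_nat_sum of_nat_of_bool by measurable
  then show "(\<lambda>(X, x). (Dop (I_sk \<rho> k) x (PPconf (n, X)))\<^sup>2)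
    \<in> borel_measurable (seq_space (unif_T :: (real^'d) measure) \<Otimes>\<^sub>M unif_T)"
    using \<rho>_pos by (simp only: Dop_I_sk[OF less_imp_le] PPconf_pair size_filter_conf)
qed

text \<open>Turns the Bochner double integral into a nonnegative one with the space variable
  outside, so that Poisson expectations can be taken at fixed x. Integrability comes from
  \<open>Dop_bounded\<close>.\<close>

lemma EDsq_eq:
  "ennreal (EDsq TYPE('d) s \<rho> k) = ennreal s * (\<integral>\<^sup>+x. PE s (\<lambda>\<mu>. ennreal ((Dop (I_sk \<rho> k) x \<mu>)\<^sup>2)) \<partial>(unif_T :: (real^'d) measure))"
  "0 \<le> EDsq TYPE('d) s \<rho> k"
proof -
  define B where "B = (1 + real (K * k))\<^sup>2"
  define D2 where "D2 \<omega> x = (Dop (I_sk \<rho> k) x (PPconf \<omega>))\<^sup>2" for \<omega> and x :: "real^'d"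
  have D2: "0 \<le> D2 \<omega> x" "D2 \<omega> x \<le> B" for \<omega> x
    using Dop_bounded by (simp_all add: D2_def B_def)
  have m [measurable]: "case_prod D2 \<in> borel_measurable (pp unif_T s \<Otimes>\<^sub>M unif_T)"
    unfolding D2_def by (rule measurable_Dop)
  have m' [measurable]: "D2 \<omega> \<in> borel_measurable borel" for \<omega>
  proof -
    obtain n X where \<omega>: "\<omega> = (n, X)" by force
    show ?thesis
      unfolding D2_def \<omega> PPconf_pair Dop_I_sk[OF less_imp_le[OF \<rho>_pos]] size_filter_conf of_nat_sum of_nat_of_bool
      by measurable
  qed
  have int: "integrable unif_T (D2 \<omega>)" for \<omega>
    by (rule U.integrable_const_bound[of _ B]) (auto simp: D2)
  define f where "f \<omega> = (\<integral>x. D2 \<omega> x \<partial>unif_T)" for \<omega>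
  have f: "0 \<le> f \<omega>" "f \<omega> \<le> B" for \<omega>
    unfolding f_def using U.integral_le_const[OF int] D2 by (auto intro: integral_nonneg_AE)
  have [measurable]: "f \<in> borel_measurable (pp unif_T s)" unfolding f_def by measurable
  have intf: "integrable (pp unif_T s) f"
    by (rule P.integrable_const_bound[of _ B]) (auto simp: f)
  have E: "EDsq TYPE('d) s \<rho> k = s * (\<integral>\<omega>. f \<omega> \<partial>pp unif_T s)"
  proof -
    have "set_lebesgue_integral lborel cube (\<lambda>x. (Dop (I_sk \<rho> k) x (PPconf \<omega>))\<^sup>2) = f \<omega>" for \<omega>
      using set_integral_cube[OF m'[of \<omega>], unfolded D2_def] by (simp add: f_def D2_def)
    then show ?thesis by (simp add: EDsq_def PPspace_eq)
  qed
  show "0 \<le> EDsq TYPE('d) s \<rho> k" unfolding E using s f by (intro mult_nonneg_nonneg integral_nonneg_AE) auto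
  have "ennreal (EDsq TYPE('d) s \<rho> k) = ennreal s * (\<integral>\<^sup>+\<omega>. ennreal (f \<omega>) \<partial>pp unif_T s)"
    unfolding E using s f intf by (simp add: nn_integral_eq_integral ennreal_mult)
  also have "\<dots> = ennreal s * (\<integral>\<^sup>+\<omega>. \<integral>\<^sup>+x. ennreal (D2 \<omega> x) \<partial>unif_T \<partial>pp unif_T s)"
    unfolding f_def by (simp add: nn_integral_eq_integral int D2)
  also have "\<dots> = ennreal s * (\<integral>\<^sup>+x. \<integral>\<^sup>+\<omega>. ennreal (D2 \<omega> x) \<partial>pp unif_T s \<partial>unif_T)"
  proof -
    interpret pair_sigma_finite "pp (unif_T :: (real^'d) measure) s" "unif_T :: (real^'d) measure" ..
    show ?thesis by (subst Fubini') simp_all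
  qed
  finally show "ennreal (EDsq TYPE('d) s \<rho> k) = ennreal s * (\<integral>\<^sup>+x. PE s (\<lambda>\<mu>. ennreal ((Dop (I_sk \<rho> k) x \<mu>)\<^sup>2)) \<partial>(unif_T :: (real^'d) measure))"
    by (simp add: D2_def)
qed

text \<open>If the ball around x is empty, the new point has low degree and no old point is
  affected, so D_x I = 1. This bound is used where s r^d is bounded.\<close>

lemma EDsq_ge_exp:
  assumes "0 < k" and A: "\<And>x :: real^'d. vol \<rho> x \<le> A"
  shows "s * exp (- (s * A)) \<le> EDsq TYPE('d) s \<rho> k"
proof -
  have "ennreal (exp (- (s * A))) \<le> PE s (\<lambda>\<mu>. ennreal ((Dop (I_sk \<rho> k) x \<mu>)\<^sup>2))" for x :: "real^'d"
  proof -
    have "ennreal (exp (- (s * A))) \<le> ennreal (pois (s * vol \<rho> x) 0)"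
      using A s by (auto simp: pois_def intro!: ennreal_leI mult_left_mono)
    also have "\<dots> = PE s (\<lambda>\<mu>. of_bool (ball_count \<mu> x \<rho> = 0))"
      by (rule PE_ball_count(1)[OF s, symmetric])
    also have "\<dots> \<le> PE s (\<lambda>\<mu>. ennreal ((Dop (I_sk \<rho> k) x \<mu>)\<^sup>2))"
    proof (rule nn_integral_mono)
      fix \<omega>
      have "Dop (I_sk \<rho> k) x (PPconf \<omega>) = 1" if "ball_count (PPconf \<omega>) x \<rho> = 0"
      proof -
        have "filter_mset (\<lambda>y. tdist x y \<le> \<rho>) (PPconf \<omega>) = {#}"
          using that by (simp add: ball_count_def mem_tball)
        then have "filter_mset (\<lambda>y. tdist x y \<le> \<rho> \<and> ball_count (PPconf \<omega>) y \<rho> = k) (PPconf \<omega>) = {#}"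
          by (auto simp: filter_mset_eq_conv)
        then show ?thesis using that \<open>0 < k\<close> \<rho>_pos by (simp add: Dop_I_sk)
      qed
      then show "of_bool (ball_count (PPconf \<omega>) x \<rho> = 0) \<le> ennreal ((Dop (I_sk \<rho> k) x (PPconf \<omega>))\<^sup>2)"
        by (cases "ball_count (PPconf \<omega>) x \<rho> = 0") auto
    qed
    finally show ?thesis .
  qed
  then have "ennreal s * (\<integral>\<^sup>+x. ennreal (exp (- (s * A))) \<partial>(unif_T :: (real^'d) measure)) \<le> ennreal (EDsq TYPE('d) s \<rho> k)"
    unfolding EDsq_eq(1) by (intro mult_left_mono nn_integral_mono) auto
  then have "ennreal (s * exp (- (s * A))) \<le> ennreal (EDsq TYPE('d) s \<rho> k)"
    using s U.emeasure_space_1 by (simp add: ennreal_mult)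
  then show ?thesis using EDsq_eq(2) by (subst (asm) ennreal_le_iff) auto
qed

text \<open>\<open>D\<^sub>xI\<close> is an integer, so \<open>(D\<^sub>xI)\<^sup>2\<close> dominates the number of points losing low degree,
  up to the indicator that the added point has low degree itself.\<close>

lemma EDsq_ge_low:
  assumes k: "k = Suc j" and c: "0 \<le> c"
    and le: "\<And>x :: real^'d. (c + 1) * pois_less k (s * vol \<rho> x) \<le> s * vol \<rho> x * pois (s * vol \<rho> x) j"
  shows "c * low s k \<le> EDsq TYPE('d) s \<rho> k"
proof -
  have W: "ennreal s * (\<integral>\<^sup>+y. of_bool (tdist x y \<le> \<rho>) * ennreal (pois (s * vol \<rho> y) j) \<partial>unif_T)
      \<le> PE s (\<lambda>\<mu>. ennreal ((Dop (I_sk \<rho> k) x \<mu>)\<^sup>2)) + ennreal (pois_less k (s * vol \<rho> x))" for x :: "real^'d"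
  proof -
    have "PE s (\<lambda>\<mu>. \<Sum>y\<in>#\<mu>. of_bool (tdist x y \<le> \<rho> \<and> ball_count \<mu> y \<rho> = k))
        = ennreal s * (\<integral>\<^sup>+y. PE s (\<lambda>\<mu>. of_bool (tdist x y \<le> \<rho> \<and> ball_count (add_mset y \<mu>) y \<rho> = k)) \<partial>unif_T)"
      by (rule mecke_torus[OF s, where f = "\<lambda>y \<mu>. of_bool (tdist x y \<le> \<rho> \<and> ball_count \<mu> y \<rho> = k)"]) measurable
    also have "\<dots> = ennreal s * (\<integral>\<^sup>+y. of_bool (tdist x y \<le> \<rho>) * ennreal (pois (s * vol \<rho> y) j) \<partial>unif_T)"
    proof (intro arg_cong2[where f = "(*)"] nn_integral_cong refl)
      fix y :: "real^'d"
      show "PE s (\<lambda>\<mu>. of_bool (tdist x y \<le> \<rho> \<and> ball_count (add_mset y \<mu>) y \<rho> = k)) = of_bool (tdist x y \<le> \<rho>) * ennreal (pois (s * vol \<rho> y) j)"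
        using PE_ball_count(1)[OF s, of y \<rho> j] k \<rho>_pos by (cases "tdist x y \<le> \<rho>") (simp_all add: ball_count_add)
    qed
    finally have "ennreal s * (\<integral>\<^sup>+y. of_bool (tdist x y \<le> \<rho>) * ennreal (pois (s * vol \<rho> y) j) \<partial>unif_T)
        = PE s (\<lambda>\<mu>. of_nat (size (filter_mset (\<lambda>y. tdist x y \<le> \<rho> \<and> ball_count \<mu> y \<rho> = k) \<mu>)))"
      by (simp only: sum_mset_of_bool')
    also have "\<dots> \<le> PE s (\<lambda>\<mu>. ennreal ((Dop (I_sk \<rho> k) x \<mu>)\<^sup>2) + of_bool (ball_count \<mu> x \<rho> < k))"
    proof (rule nn_integral_mono)
      fix \<omega>
      define w where "w = size (filter_mset (\<lambda>y. tdist x y \<le> \<rho> \<and> ball_count (PPconf \<omega>) y \<rho> = k) (PPconf \<omega>))"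
      define b where "b = (of_bool (ball_count (PPconf \<omega>) x \<rho> < k) :: real)"
      have "b = 0 \<or> b = 1" by (simp add: b_def)
      moreover have "w = 0 \<or> w = 1 \<or> 2 \<le> w" by linarith
      \<comment> \<open>For b = 1 the claim below amounts to (w - 1)(w - 2) \<ge> 0, which fails
        strictly between 1 and 2; hence the appeal to w being an integer.\<close>
      moreover have "0 \<le> (real w - 1) * (real w - 2)" if "2 \<le> w" using that by simp
      ultimately have "real w \<le> (b - real w)\<^sup>2 + b"
        by (auto simp: power2_eq_square algebra_simps)
      then have "ennreal (real w) \<le> ennreal ((b - real w)\<^sup>2) + ennreal b"
        by (simp add: b_def ennreal_leI flip: ennreal_plus)
      then show "of_nat w \<le> ennreal ((Dop (I_sk \<rho> k) x (PPconf \<omega>))\<^sup>2) + of_bool (ball_count (PPconf \<omega>) x \<rho> < k)"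
        using \<rho>_pos by (simp add: Dop_I_sk w_def b_def ennreal_of_nat_eq_real_of_nat split: if_splits) (auto simp: of_bool_def)
    qed
    also have "\<dots> = PE s (\<lambda>\<mu>. ennreal ((Dop (I_sk \<rho> k) x \<mu>)\<^sup>2)) + PE s (\<lambda>\<mu>. of_bool (ball_count \<mu> x \<rho> < k))"
    proof (rule nn_integral_add)
      show "(\<lambda>\<omega>. ennreal ((Dop (I_sk \<rho> k) x (PPconf \<omega>))\<^sup>2)) \<in> borel_measurable (pp unif_T s)"
        using measurable_compose[OF measurable_Pair2' measurable_Dop] by simp
      show "(\<lambda>\<omega>. of_bool (ball_count (PPconf \<omega>) x \<rho> < k)) \<in> borel_measurable (pp unif_T s)"
        by (rule pp_measurable[OF prob_space_unif_T]) (simp only: PPconf_pair, measurable)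
    qed
    finally show ?thesis by (simp add: PE_ball_count(2)[OF s])
  qed
  \<comment> \<open>One copy of \<open>low s k\<close> pays for the indicator in \<open>W\<close>,
    which explains the factor c + 1 in \<open>le\<close>.\<close>
  have "ennreal ((c + 1) * low s k) = ennreal (c + 1) * (ennreal s * (\<integral>\<^sup>+x. ennreal (pois_less k (s * vol \<rho> x)) \<partial>(unif_T :: (real^'d) measure)))"
    using c low_nonneg[OF s] by (simp add: nn_low[OF s] ennreal_mult del: ennreal_plus)
  also have "\<dots> = ennreal s * (\<integral>\<^sup>+x. ennreal ((c + 1) * pois_less k (s * vol \<rho> x)) \<partial>(unif_T :: (real^'d) measure))"
  proof -
    have "ennreal ((c + 1) * pois_less k (s * vol \<rho> x)) = ennreal (c + 1) * ennreal (pois_less k (s * vol \<rho> x))" for x :: "real^'d"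
      using c s by (intro ennreal_mult) (auto simp: pois_less_nonneg vol_nonneg)
    then show ?thesis by (simp add: nn_integral_cmult mult_ac)
  qed
  also have "\<dots> \<le> ennreal s * (\<integral>\<^sup>+y. ennreal (s * vol \<rho> y * pois (s * vol \<rho> y) j) \<partial>(unif_T :: (real^'d) measure))"
    using le by (intro mult_left_mono nn_integral_mono ennreal_leI) auto
  \<comment> \<open>The factor \<open>vol\<close> is read as the integral over x of the indicator
    that x and y are within \<rho>. After exchanging x and y this is the left-hand side of
    \<open>W\<close>.\<close>
  also have "\<dots> = ennreal s * (\<integral>\<^sup>+y. \<integral>\<^sup>+x. ennreal s * (of_bool (tdist x y \<le> \<rho>) * ennreal (pois (s * vol \<rho> y) j)) \<partial>unif_T \<partial>(unif_T :: (real^'d) measure))"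
  proof -
    have "(\<integral>\<^sup>+x. of_bool (tdist x y \<le> \<rho>) \<partial>unif_T) = ennreal (vol \<rho> y)" for y :: "real^'d"
      using nn_integral_tball[of y \<rho>] by (simp add: tdist_commute)
    moreover have "ennreal (s * vol \<rho> y * pois (s * vol \<rho> y) j) = ennreal s * (ennreal (vol \<rho> y) * ennreal (pois (s * vol \<rho> y) j))" for y :: "real^'d"
      using s vol_nonneg[of \<rho> y] by (simp add: ennreal_mult pois_nonneg mult.assoc)
    ultimately show ?thesis
      by (simp add: nn_integral_cmult nn_integral_multc)
  qed
  also have "\<dots> = ennreal s * (\<integral>\<^sup>+x. ennreal s * (\<integral>\<^sup>+y. of_bool (tdist x y \<le> \<rho>) * ennreal (pois (s * vol \<rho> y) j) \<partial>unif_T) \<partial>(unif_T :: (real^'d) measure))"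
  proof -
    interpret pair_sigma_finite "unif_T :: (real^'d) measure" "unif_T :: (real^'d) measure" ..
    show ?thesis by (subst Fubini') (simp_all add: nn_integral_cmult)
  qed
  also have "\<dots> \<le> ennreal s * (\<integral>\<^sup>+x. PE s (\<lambda>\<mu>. ennreal ((Dop (I_sk \<rho> k) x \<mu>)\<^sup>2)) + ennreal (pois_less k (s * vol \<rho> x)) \<partial>(unif_T :: (real^'d) measure))"
    using W by (intro mult_left_mono nn_integral_mono) auto
  also have "\<dots> = ennreal (EDsq TYPE('d) s \<rho> k) + ennreal (low s k)"
  proof -
    have [measurable]: "(\<lambda>x. PE s (\<lambda>\<mu>. ennreal ((Dop (I_sk \<rho> k) x \<mu>)\<^sup>2))) \<in> borel_measurable (unif_T :: (real^'d) measure)"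
      using measurable_compose[OF measurable_pair_swap' measurable_Dop]
      by (intro P.borel_measurable_nn_integral) (simp add: case_prod_beta)
    show ?thesis unfolding EDsq_eq(1) nn_low[OF s, symmetric] by (simp add: nn_integral_add distrib_left)
  qed
  finally have "(c + 1) * low s k \<le> EDsq TYPE('d) s \<rho> k + low s k"
    using EDsq_eq(2) low_nonneg[OF s] by (subst (asm) ennreal_plus[symmetric]) (auto simp del: ennreal_plus)
  then show ?thesis by (simp add: algebra_simps)
qed

end

end

section \<open>The coupling\<close>

definition kept :: "real \<Rightarrow> nat \<Rightarrow> (nat \<Rightarrow> 'a) \<Rightarrow> (nat \<Rightarrow> real) \<Rightarrow> 'a multiset" where
  "kept t n x u = mset (map x (filter (\<lambda>i. u i \<le> exp (- t)) [0..<n]))"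

lemma CPconf0_eq [simp]: "CPconf0 (n, x, \<omega>) = conf n x"
  by (cases \<omega>) (simp add: CPconf0_def conf_def)

lemma CPconft_eq [simp]: "CPconft t (n, x, u, \<omega>) = kept t n x u + PPconf \<omega>"
  by (cases \<omega>) (simp add: CPconft_def conf_def kept_def)

lemma kept_0 [simp]: "kept t 0 x u = {#}"
  by (simp add: kept_def)

lemma kept_Suc: "kept t (Suc n) x u = (if u n \<le> exp (- t) then add_mset (x n) (kept t n x u) else kept t n x u)"
  by (simp add: kept_def)

lemma size_filter_kept: "size (filter_mset P (kept t n x u)) = (\<Sum>i<n. of_bool (u i \<le> exp (- t) \<and> P (x i)))"
  by (induction n) (auto simp: kept_Suc)

lemma in_kept: "y \<in># kept t n x u \<longleftrightarrow> (\<exists>i<n. u i \<le> exp (- t) \<and> x i = y)"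
  by (auto simp: kept_def)

lemma in_conf: "y \<in># conf n x \<longleftrightarrow> (\<exists>i<n. x i = y)"
  by (auto simp: conf_def)

lemma ball_count_plus: "ball_count (\<mu> + \<nu>) y \<rho> = ball_count \<mu> y \<rho> + ball_count \<nu> y \<rho>"
  by (simp add: ball_count_def)

lemma ball_count_kept: "ball_count (kept t n x u) y \<rho> = (\<Sum>i<n. of_bool (u i \<le> exp (- t) \<and> tdist y (x i) \<le> \<rho>))"
  by (simp add: ball_count_def size_filter_kept mem_tball)

lemma measurable_ball_count_kept [measurable (raw)]:
  assumes [measurable]: "\<And>i. (\<lambda>w. X w i) \<in> borel_measurable N" "\<And>i. (\<lambda>w. u w i) \<in> borel_measurable N"
    "T \<in> borel_measurable N" "f \<in> borel_measurable N"
  shows "(\<lambda>w. ball_count (kept (T w) n (X w) (u w)) (f w) \<rho>) \<in> measurable N (count_space UNIV)"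
  unfolding ball_count_kept by measurable

text \<open>Each distinct point is charged to its first index, so a cardinality becomes a finite sum
  of indicators and is accessible to measurability proofs.\<close>

lemma card_in_conf: "card {y. y \<in># conf n x \<and> P y} = (\<Sum>i<n. of_bool (P (x i) \<and> (\<forall>j<i. x j \<noteq> x i)))"
proof (induction n)
  case (Suc n)
  have "{y. y \<in># conf (Suc n) x \<and> P y} = (if P (x n) then insert (x n) {y. y \<in># conf n x \<and> P y} else {y. y \<in># conf n x \<and> P y})"
    by (auto simp: conf_Suc)
  moreover have "finite {y. y \<in># conf n x \<and> P y}" by simp
  ultimately show ?case using Suc by (auto simp: card_insert_if in_conf)
qed simp

lemma measurable_card_Nset:
  fixes X :: "'w \<Rightarrow> nat \<Rightarrow> real^'d"
  assumes [measurable]: "\<And>i. (\<lambda>w. X w i) \<in> borel_measurable N"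
  shows "(\<lambda>w. real (card (Nset \<rho> k (conf n (X w))))) \<in> borel_measurable N"
proof -
  have member: "(\<exists>x. x \<in># conf n x' \<and> P x) \<longleftrightarrow> (\<exists>i<n. P (x' i))" for x' :: "nat \<Rightarrow> real^'d" and P
    by (auto simp: in_conf)
  show ?thesis
    unfolding Nset_def card_in_conf unfolding member mem_tball of_nat_sum of_nat_of_bool
    by measurable
qed

text \<open>The time \<open>T\<close> may vary with w, so the statement serves both at a fixed t and
  for measurability in t.\<close>

lemma measurable_overlap_aux:
  fixes X Z :: "'w \<Rightarrow> nat \<Rightarrow> real^'d"
  assumes [measurable]: "\<And>i. (\<lambda>w. X w i) \<in> borel_measurable N" "\<And>i. (\<lambda>w. Z w i) \<in> borel_measurable N"
    "\<And>i. (\<lambda>w. u w i) \<in> borel_measurable N" "T \<in> borel_measurable N"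
  shows "(\<lambda>w. real (card (Nset \<rho> k (conf n (X w)) \<inter> Nset \<rho> k (kept (T w) n (X w) (u w) + conf m (Z w))))) \<in> borel_measurable N"
proof -
  have member: "(\<exists>x. x \<in># kept t n x' u' + conf m z \<and> P x) \<longleftrightarrow>
      (\<exists>i<n. u' i \<le> exp (- t) \<and> P (x' i)) \<or> (\<exists>i<m. P (z i))" for t and x' z :: "nat \<Rightarrow> real^'d" and u' P
    by (auto simp: in_kept in_conf)
  have member0: "(\<exists>x. x \<in># conf n x' \<and> P x) \<longleftrightarrow> (\<exists>i<n. P (x' i))" for x' :: "nat \<Rightarrow> real^'d" and P
    by (auto simp: in_conf)
  have inter: "Nset \<rho> k \<mu> \<inter> Nset \<rho> k \<nu> = {y. y \<in># \<mu> \<and> ((\<exists>x. x \<in># \<mu> \<and> tdist y x \<le> \<rho> \<and> x \<noteq> y \<and> ball_count \<mu> x \<rho> = k + 1)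
      \<and> (\<exists>x. x \<in># \<nu> \<and> x = y) \<and> (\<exists>x. x \<in># \<nu> \<and> tdist y x \<le> \<rho> \<and> x \<noteq> y \<and> ball_count \<nu> x \<rho> = k + 1))}"
    for \<mu> \<nu> :: "(real^'d) multiset"
    by (auto simp: Nset_def mem_tball)
  have [measurable]: "(\<lambda>w. real (ball_count (conf n (X w)) (f w) \<rho>)) \<in> borel_measurable N"
    "(\<lambda>w. real (ball_count (kept (T w) n (X w) (u w)) (f w) \<rho>)) \<in> borel_measurable N"
    "(\<lambda>w. real (ball_count (conf m (Z w)) (f w) \<rho>)) \<in> borel_measurable N"
    if [measurable]: "f \<in> borel_measurable N" for f
    by measurable
  have real_eq: "ball_count \<mu> x \<rho> + ball_count \<nu> x \<rho> = k + 1 \<longleftrightarrow> real (ball_count \<mu> x \<rho>) + real (ball_count \<nu> x \<rho>) = real (k + 1)"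
    for \<mu> \<nu> :: "(real^'d) multiset" and x
    by linarith
  show ?thesis
    unfolding inter card_in_conf unfolding member member0 ball_count_plus real_eq of_nat_sum of_nat_of_bool
    by measurable
qed

lemma measurable_overlap:
  fixes X Z :: "'w \<Rightarrow> nat \<Rightarrow> real^'d"
  assumes [measurable]: "n \<in> measurable N (count_space UNIV)" "m \<in> measurable N (count_space UNIV)"
    "\<And>i. (\<lambda>w. X w i) \<in> borel_measurable N" "\<And>i. (\<lambda>w. Z w i) \<in> borel_measurable N"
    "\<And>i. (\<lambda>w. u w i) \<in> borel_measurable N" "T \<in> borel_measurable N"
  shows "(\<lambda>w. real (card (Nset \<rho> k (conf (n w) (X w)) \<inter> Nset \<rho> k (kept (T w) (n w) (X w) (u w) + conf (m w) (Z w))))) \<in> borel_measurable N"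
proof (rule measurable_compose_countable[OF _ assms(1)], rule measurable_compose_countable[OF _ assms(2)])
  fix n m
  show "(\<lambda>w. real (card (Nset \<rho> k (conf n (X w)) \<inter> Nset \<rho> k (kept (T w) n (X w) (u w) + conf m (Z w))))) \<in> borel_measurable N"
    by (intro measurable_overlap_aux) measurable
qed

abbreviation unif01 :: "real measure" where
  "unif01 \<equiv> uniform_measure lborel {0..1}"

lemma prob_space_unif01: "prob_space unif01"
  by (rule prob_space_uniform_measure) simp_all

lemma emeasure_unif01:
  assumes "0 \<le> e" "e \<le> 1" shows "emeasure unif01 {..e} = ennreal e"
proof -
  have "{0..1} \<inter> {..e} = {0..e}" using assms by auto
  then show ?thesis using assms by (simp add: divide_ennreal_def)
qed

lemma nn_integral_marks:
  assumes "0 \<le> t" "finite J"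
  shows "(\<integral>\<^sup>+u. of_bool (\<forall>j\<in>J. u j \<le> exp (- t)) \<partial>seq_space unif01) = ennreal (exp (- t) ^ card J)"
proof -
  interpret M: prob_space unif01 by (rule prob_space_unif01)
  interpret S: sequence_space unif01 ..
  have "(\<integral>\<^sup>+u. of_bool (\<forall>j\<in>J. u j \<le> exp (- t)) \<partial>seq_space unif01)
      = (\<integral>\<^sup>+u. indicator {u\<in>space (seq_space unif01). \<forall>j\<in>J. u j \<in> {..exp (- t)}} u \<partial>seq_space unif01)"
    by (intro nn_integral_cong) (auto simp: indicator_def)
  also have "\<dots> = emeasure (seq_space unif01) {u\<in>space (seq_space unif01). \<forall>j\<in>J. u j \<in> {..exp (- t)}}"
    using \<open>finite J\<close> by (intro nn_integral_indicator) measurable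
  also have "\<dots> = (\<Prod>j\<in>J. emeasure unif01 {..exp (- t)})"
    using \<open>finite J\<close> by (intro S.emeasure_PiM_Collect) auto
  also have "emeasure unif01 {..exp (- t)} = ennreal (exp (- t))"
    using \<open>0 \<le> t\<close> by (intro emeasure_unif01) auto
  finally show ?thesis by (simp only: prod_constant ennreal_power exp_ge_zero)
qed

lemma PPconf_eq: "PPconf \<omega> = conf (fst \<omega>) (snd \<omega>)"
  by (metis PPconf_pair prod.collapse)

definition intensity :: "real \<Rightarrow> real \<Rightarrow> real" where
  "intensity s t = (1 - exp (- t)) * s"

lemma intensity_nonneg: "0 \<le> s \<Longrightarrow> 0 \<le> t \<Longrightarrow> 0 \<le> intensity s t"
  by (simp add: intensity_def)

lemma CPspace_eq: "CPspace TYPE('d::finite) s t = measure_pmf (poi s) \<Otimes>\<^sub>M (seq_space (unif_T :: (real^'d) measure) \<Otimes>\<^sub>M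
   (seq_space unif01 \<Otimes>\<^sub>M pp unif_T (intensity s t)))"
  by (simp add: CPspace_def pp_def intensity_def)

text \<open>Fubini in the order used from here on: added points innermost, then marks, then the
  initial process, whose number and positions are joined again into \<open>pp\<close>.\<close>

lemma nn_integral_CP:
  fixes F :: "_ \<Rightarrow> ennreal"
  assumes [measurable]: "F \<in> borel_measurable (CPspace TYPE('d::finite) s t)"
  shows "(\<integral>\<^sup>+\<omega>. F \<omega> \<partial>CPspace TYPE('d) s t) = (\<integral>\<^sup>+\<omega>. \<integral>\<^sup>+u. \<integral>\<^sup>+\<beta>. F (fst \<omega>, snd \<omega>, u, \<beta>) \<partial>pp (unif_T :: (real^'d) measure) (intensity s t)
     \<partial>seq_space unif01 \<partial>pp unif_T s)"
proof -
  let ?U = "unif_T :: (real^'d) measure"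
  interpret B: prob_space "pp ?U (intensity s t)" by (rule prob_space_pp[OF prob_space_unif_T])
  interpret V: prob_space "seq_space unif01" by (intro prob_space_PiM prob_space_unif01)
  interpret S: prob_space "seq_space ?U" by (intro prob_space_PiM prob_space_unif_T)
  interpret VB: prob_space "seq_space unif01 \<Otimes>\<^sub>M pp ?U (intensity s t)"
    by (intro prob_space_pair V.prob_space_axioms B.prob_space_axioms)
  interpret SVB: prob_space "seq_space ?U \<Otimes>\<^sub>M (seq_space unif01 \<Otimes>\<^sub>M pp ?U (intensity s t))"
    by (intro prob_space_pair S.prob_space_axioms VB.prob_space_axioms)
  have m [measurable]: "F \<in> borel_measurable (measure_pmf (poi s) \<Otimes>\<^sub>M (seq_space ?U \<Otimes>\<^sub>M
   (seq_space unif01 \<Otimes>\<^sub>M pp unif_T (intensity s t))))"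
    using assms unfolding CPspace_eq .
  have "(\<integral>\<^sup>+\<omega>. F \<omega> \<partial>CPspace TYPE('d) s t) = (\<integral>\<^sup>+n. \<integral>\<^sup>+w. F (n, w) \<partial>(seq_space ?U \<Otimes>\<^sub>M (seq_space unif01 \<Otimes>\<^sub>M pp ?U (intensity s t))) \<partial>measure_pmf (poi s))"
    unfolding CPspace_eq by (rule SVB.nn_integral_fst[symmetric]) (rule m)
  also have "\<dots> = (\<integral>\<^sup>+n. \<integral>\<^sup>+x. \<integral>\<^sup>+w. F (n, x, w) \<partial>(seq_space unif01 \<Otimes>\<^sub>M pp ?U (intensity s t)) \<partial>seq_space ?U \<partial>measure_pmf (poi s))"
    by (intro nn_integral_cong VB.nn_integral_fst[symmetric]) measurable
  also have "\<dots> = (\<integral>\<^sup>+n. \<integral>\<^sup>+x. \<integral>\<^sup>+u. \<integral>\<^sup>+\<beta>. F (n, x, u, \<beta>) \<partial>pp ?U (intensity s t) \<partial>seq_space unif01 \<partial>seq_space ?U \<partial>measure_pmf (poi s))"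
    by (intro nn_integral_cong B.nn_integral_fst[symmetric]) measurable
  also have "\<dots> = (\<integral>\<^sup>+\<omega>. \<integral>\<^sup>+u. \<integral>\<^sup>+\<beta>. F (fst \<omega>, snd \<omega>, u, \<beta>) \<partial>pp ?U (intensity s t) \<partial>seq_space unif01 \<partial>pp ?U s)"
    unfolding pp_def[of _ s]
    by (subst S.nn_integral_fst[symmetric]) simp_all
  finally show ?thesis .
qed

definition overlap :: "real \<Rightarrow> nat \<Rightarrow> real \<Rightarrow> nat \<times> (nat \<Rightarrow> real^'d) \<Rightarrow> (nat \<Rightarrow> real) \<Rightarrow> nat \<times> (nat \<Rightarrow> real^'d) \<Rightarrow> nat" where
  "overlap \<rho> k t \<omega> u \<beta> = card (Nset \<rho> k (PPconf \<omega>) \<inter> Nset \<rho> k (kept t (fst \<omega>) (snd \<omega>) u + PPconf \<beta>))"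

definition ENn :: "'d::finite itself \<Rightarrow> real \<Rightarrow> real \<Rightarrow> nat \<Rightarrow> real \<Rightarrow> ennreal" where
  "ENn D s \<rho> k t = (\<integral>\<^sup>+\<omega>. \<integral>\<^sup>+u. \<integral>\<^sup>+\<beta>. of_nat (overlap \<rho> k t \<omega> u \<beta>) \<partial>pp (unif_T :: (real^'d) measure) (intensity s t)
     \<partial>seq_space unif01 \<partial>pp unif_T s)"

lemma ENoverlap_eq: "ENoverlap TYPE('d::finite) s \<rho> k t = enn2real (ENn TYPE('d) s \<rho> k t)"
proof -
  let ?F = "\<lambda>(n, x :: nat \<Rightarrow> real^'d, u, m, z :: nat \<Rightarrow> real^'d). real (card (Nset \<rho> k (conf n x) \<inter> Nset \<rho> k (kept t n x u + conf m z)))"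
  have count: "sets (measure_pmf p) = sets (count_space UNIV)" for p :: "nat pmf" by simp
  have m [measurable]: "?F \<in> borel_measurable (CPspace TYPE('d) s t)"
    unfolding CPspace_eq pp_def case_prod_beta
    by (rule measurable_overlap) (auto intro!: measurable_compose[OF measurable_snd] simp: measurable_cong_sets[OF refl count, symmetric])
  have "ENoverlap TYPE('d) s \<rho> k t = (\<integral>\<omega>. ?F \<omega> \<partial>CPspace TYPE('d) s t)"
    unfolding ENoverlap_def by (intro Bochner_Integration.integral_cong) auto
  also have "\<dots> = enn2real (\<integral>\<^sup>+\<omega>. ennreal (?F \<omega>) \<partial>CPspace TYPE('d) s t)"
    by (rule integral_eq_nn_integral[OF m]) (simp add: case_prod_beta)
  also have "(\<integral>\<^sup>+\<omega>. ennreal (?F \<omega>) \<partial>CPspace TYPE('d) s t) = ENn TYPE('d) s \<rho> k t"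
    unfolding nn_integral_CP[OF measurable_compose[OF m measurable_ennreal]]
    by (simp add: ENn_def overlap_def case_prod_beta PPconf_eq ennreal_of_nat_eq_real_of_nat)
  finally show ?thesis .
qed

lemma AE_unif_T_neq: "AE z in (unif_T :: (real^'d) measure). z \<noteq> y"
proof (rule AE_I[of _ _ "{y}"])
  have "emeasure lborel (cube \<inter> {y}) \<le> emeasure lborel {y}" by (intro emeasure_mono) auto
  then show "emeasure unif_T {y} = 0" by (simp add: emeasure_unif_T)
qed auto

lemma AE_pp_distinct: "AE \<omega> in pp (unif_T :: (real^'d) measure) s. inj (snd \<omega>)"
proof -
  have "AE x in seq_space (unif_T :: (real^'d) measure). \<forall>i j. i \<noteq> j \<longrightarrow> x i \<noteq> x j"
    by (rule AE_seq_distinct[OF prob_space_unif_T _ AE_unif_T_neq]) measurable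
  then have "AE x in seq_space (unif_T :: (real^'d) measure). inj x"
    by eventually_elim (auto simp: inj_def)
  then show ?thesis by (rule AE_pp_snd[OF prob_space_unif_T])
qed

text \<open>p_j(a) equals 2^j p_j(a/2) e^(-a/2): half of the exponent absorbs the polynomial factor,
  the other half is left over.\<close>

lemma pois_less_tail:
  assumes "0 \<le> a" shows "pois_less k a \<le> 2 ^ k * exp (- a / 2)"
proof -
  have "pois_less k a \<le> (\<Sum>j<k. 2 ^ k * (pois (a / 2) j * exp (- a / 2)))"
    unfolding pois_less_def
  proof (rule sum_mono)
    fix j assume "j \<in> {..<k}"
    then have "(2::real) ^ j \<le> 2 ^ k" by simp
    moreover have "pois a j = 2 ^ j * (pois (a / 2) j * exp (- a / 2))"
      by (simp add: pois_def power_divide flip: exp_add)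
    ultimately show "pois a j \<le> 2 ^ k * (pois (a / 2) j * exp (- a / 2))"
      using assms by (simp add: mult_right_mono pois_nonneg)
  qed
  also have "\<dots> = 2 ^ k * (pois_less k (a / 2) * exp (- a / 2))"
    by (simp add: pois_less_def sum_distrib_left sum_distrib_right)
  also have "\<dots> \<le> 2 ^ k * (1 * exp (- a / 2))"
    using assms by (intro mult_left_mono mult_right_mono pois_less_le_1) auto
  finally show ?thesis by simp
qed

section \<open>Upper bounds for the expected overlap\<close>

context cell_cover
begin

interpretation U: prob_space "unif_T :: (real^'d) measure" by (rule prob_space_unif_T)
interpretation V: prob_space "seq_space unif01" by (intro prob_space_PiM prob_space_unif01)

text \<open>A union bound over the cells near y. The centre that puts y into \<open>Nset\<close>
  depends on the kept points, but this sum sees only the added ones, so it can be averaged with the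
  initial process and the marks fixed.\<close>

definition sparse_cells :: "nat \<Rightarrow> real^'d \<Rightarrow> (real^'d) multiset \<Rightarrow> ennreal" where
  "sparse_cells k y \<beta> = (\<Sum>j\<in>cell ` {z. tdist y z \<le> 2 * \<rho>}. of_bool (size (filter_mset (\<lambda>z. z \<in> {z. cell z = j}) \<beta>) < k + 2))"

lemma sparse_cells_ge_1:
  assumes y: "y \<in> Nset \<rho> k (\<mu> + \<beta>)" shows "1 \<le> sparse_cells k y \<beta>"
proof -
  obtain x where x: "tdist y x \<le> \<rho>" "ball_count (\<mu> + \<beta>) x \<rho> = k + 1"
    using y by (auto simp: Nset_def mem_tball)
  have "size (filter_mset (\<lambda>z. z \<in> {z. cell z = cell x}) \<beta>) \<le> ball_count (\<mu> + \<beta>) x \<rho>"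
    unfolding ball_count_def
  proof (rule size_mset_mono)
    have "filter_mset (\<lambda>z. z \<in> {z. cell z = cell x}) \<beta> \<subseteq># filter_mset (\<lambda>z. z \<in> tball x \<rho>) \<beta>"
      by (rule filter_mset_mono_strong) (auto simp: mem_tball tdist_cell)
    also have "\<dots> \<subseteq># filter_mset (\<lambda>z. z \<in> tball x \<rho>) (\<mu> + \<beta>)"
      by (rule multiset_filter_mono) simp
    finally show "filter_mset (\<lambda>z. z \<in> {z. cell z = cell x}) \<beta> \<subseteq># filter_mset (\<lambda>z. z \<in> tball x \<rho>) (\<mu> + \<beta>)" .
  qed
  then have "of_bool (size (filter_mset (\<lambda>z. z \<in> {z. cell z = cell x}) \<beta>) < k + 2) = (1 :: ennreal)"
    using x(2) by simp
  moreover have "cell x \<in> cell ` {z. tdist y z \<le> 2 * \<rho>}" using x(1) \<rho>_pos by auto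
  ultimately show ?thesis
    unfolding sparse_cells_def
    using member_le_sum[OF _ _ finite_near, of "cell x" y "\<lambda>j. of_bool (size (filter_mset (\<lambda>z. z \<in> {z. cell z = j}) \<beta>) < k + 2) :: ennreal"]
    by simp
qed

text \<open>At most K cells near y, each holding at least s' \<open>lo\<close> added points in the
  mean, combined with \<open>pois_less_tail\<close> at k + 2.\<close>

definition sparse_bound :: "nat \<Rightarrow> real \<Rightarrow> real" where
  "sparse_bound k s' = real K * 2 ^ (k + 2) * exp (- (s' * lo) / 2)"

lemma sparse_bound_nonneg: "0 \<le> sparse_bound k s'"
  by (simp add: sparse_bound_def)

lemma measurable_sparse_cells [measurable]:
  "(\<lambda>\<beta>. sparse_cells k y (PPconf \<beta>)) \<in> borel_measurable (pp (unif_T :: (real^'d) measure) s')"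
  by (rule pp_measurable[OF prob_space_unif_T]) (unfold sparse_cells_def PPconf_pair size_filter_conf, measurable)

lemma nn_integral_sparse_cells:
  assumes s': "0 \<le> s'"
  shows "(\<integral>\<^sup>+\<beta>. sparse_cells k y (PPconf \<beta>) \<partial>pp (unif_T :: (real^'d) measure) s') \<le> ennreal (sparse_bound k s')"
proof -
  let ?J = "cell ` {z. tdist y z \<le> 2 * \<rho>}"
  have [measurable]: "(\<lambda>\<beta>. of_bool (size (filter_mset (\<lambda>z. z \<in> {z. cell z = j}) (PPconf \<beta>)) < k + 2)) \<in> borel_measurable (pp (unif_T :: (real^'d) measure) s')" for j
    by (rule pp_measurable[OF prob_space_unif_T]) (unfold PPconf_pair size_filter_conf, measurable)
  have "(\<integral>\<^sup>+\<beta>. sparse_cells k y (PPconf \<beta>) \<partial>pp (unif_T :: (real^'d) measure) s')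
      = (\<Sum>j\<in>?J. \<integral>\<^sup>+\<beta>. of_bool (size (filter_mset (\<lambda>z. z \<in> {z. cell z = j}) (PPconf \<beta>)) < k + 2) \<partial>pp (unif_T :: (real^'d) measure) s')"
    unfolding sparse_cells_def by (rule nn_integral_sum) measurable
  also have "\<dots> = (\<Sum>j\<in>?J. ennreal (pois_less (k + 2) (s' * measure unif_T {z. cell z = j})))"
    by (intro sum.cong refl poisson_count(2)[OF prob_space_unif_T s']) simp
  also have "\<dots> \<le> (\<Sum>j\<in>?J. ennreal (2 ^ (k + 2) * exp (- (s' * lo) / 2)))"
  proof (intro sum_mono ennreal_leI)
    fix j assume "j \<in> ?J"
    then have lo: "s' * lo \<le> s' * measure unif_T {z. cell z = j}"
      using cell_ge s' by (intro mult_left_mono) auto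
    have "pois_less (k + 2) (s' * measure unif_T {z. cell z = j}) \<le> 2 ^ (k + 2) * exp (- (s' * measure unif_T {z. cell z = j}) / 2)"
      using s' by (intro pois_less_tail) simp
    also have "\<dots> \<le> 2 ^ (k + 2) * exp (- (s' * lo) / 2)"
      using lo by (intro mult_left_mono) auto
    finally show "pois_less (k + 2) (s' * measure unif_T {z. cell z = j}) \<le> 2 ^ (k + 2) * exp (- (s' * lo) / 2)" .
  qed
  also have "\<dots> = ennreal (real (card ?J) * (2 ^ (k + 2) * exp (- (s' * lo) / 2)))"
    by (simp add: ennreal_mult ennreal_of_nat_eq_real_of_nat)
  also have "\<dots> \<le> ennreal (sparse_bound k s')"
    unfolding sparse_bound_def mult.assoc using card_near by (intro ennreal_leI mult_right_mono) auto
  finally show ?thesis .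
qed

lemma overlap_le_sum:
  "of_nat (overlap \<rho> k t \<omega> u \<beta>) \<le> (\<Sum>y\<in>Nset \<rho> k (PPconf \<omega>). sparse_cells k y (PPconf \<beta>))"
proof -
  have fin: "finite (Nset \<rho> k (PPconf \<omega>))" by (rule finite_subset[of _ "set_mset (PPconf \<omega>)"]) (auto simp: Nset_def)
  have "of_nat (overlap \<rho> k t \<omega> u \<beta>) = (\<Sum>y\<in>Nset \<rho> k (PPconf \<omega>) \<inter> Nset \<rho> k (kept t (fst \<omega>) (snd \<omega>) u + PPconf \<beta>). 1 :: ennreal)"
    by (simp add: overlap_def)
  also have "\<dots> \<le> (\<Sum>y\<in>Nset \<rho> k (PPconf \<omega>) \<inter> Nset \<rho> k (kept t (fst \<omega>) (snd \<omega>) u + PPconf \<beta>). sparse_cells k y (PPconf \<beta>))"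
    by (intro sum_mono sparse_cells_ge_1) auto
  also have "\<dots> \<le> (\<Sum>y\<in>Nset \<rho> k (PPconf \<omega>). sparse_cells k y (PPconf \<beta>))"
    using fin by (intro sum_mono2) auto
  finally show ?thesis .
qed

lemma measurable_card_Nset_pp:
  "(\<lambda>\<omega>. of_nat (card (Nset \<rho> k (PPconf \<omega>))) :: ennreal) \<in> borel_measurable (pp (unif_T :: (real^'d) measure) s)"
proof (rule pp_measurable[OF prob_space_unif_T])
  fix n
  have "(\<lambda>x. real (card (Nset \<rho> k (conf n x)))) \<in> borel_measurable (seq_space (unif_T :: (real^'d) measure))"
    by (rule measurable_card_Nset) measurable
  then show "(\<lambda>x. of_nat (card (Nset \<rho> k (PPconf (n, x)))) :: ennreal) \<in> borel_measurable (seq_space (unif_T :: (real^'d) measure))"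
    by (simp add: ennreal_of_nat_eq_real_of_nat)
qed

text \<open>The survival marks are discarded here: (iii) carries its own factor e^-t and compares
  with E|N_k|. The variant \<open>ENn_le_crit\<close> retains the survival probability for the time
  integral in (ii).\<close>

lemma ENn_le_EN:
  assumes "0 \<le> s" "0 \<le> t"
  shows "ENn TYPE('d) s \<rho> k t \<le> ennreal (sparse_bound k (intensity s t)) * (\<integral>\<^sup>+\<omega>. of_nat (card (Nset \<rho> k (PPconf \<omega>))) \<partial>pp (unif_T :: (real^'d) measure) s)"
proof -
  have "(\<integral>\<^sup>+\<beta>. of_nat (overlap \<rho> k t \<omega> u \<beta>) \<partial>pp (unif_T :: (real^'d) measure) (intensity s t))
      \<le> of_nat (card (Nset \<rho> k (PPconf \<omega>))) * ennreal (sparse_bound k (intensity s t))" for \<omega> and u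
  proof -
    have "(\<integral>\<^sup>+\<beta>. of_nat (overlap \<rho> k t \<omega> u \<beta>) \<partial>pp (unif_T :: (real^'d) measure) (intensity s t))
      \<le> (\<integral>\<^sup>+\<beta>. (\<Sum>y\<in>Nset \<rho> k (PPconf \<omega>). sparse_cells k y (PPconf \<beta>)) \<partial>pp (unif_T :: (real^'d) measure) (intensity s t))"
      by (intro nn_integral_mono overlap_le_sum)
    also have "\<dots> = (\<Sum>y\<in>Nset \<rho> k (PPconf \<omega>). \<integral>\<^sup>+\<beta>. sparse_cells k y (PPconf \<beta>) \<partial>pp (unif_T :: (real^'d) measure) (intensity s t))"
      by (rule nn_integral_sum) measurable
    also have "\<dots> \<le> (\<Sum>y\<in>Nset \<rho> k (PPconf \<omega>). ennreal (sparse_bound k (intensity s t)))"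
      by (intro sum_mono nn_integral_sparse_cells intensity_nonneg assms)
    finally show ?thesis by simp
  qed
  then have "ENn TYPE('d) s \<rho> k t \<le> (\<integral>\<^sup>+\<omega>. \<integral>\<^sup>+u. of_nat (card (Nset \<rho> k (PPconf \<omega>))) * ennreal (sparse_bound k (intensity s t)) \<partial>seq_space unif01 \<partial>pp (unif_T :: (real^'d) measure) s)"
    unfolding ENn_def by (intro nn_integral_mono)
  also have "\<dots> = (\<integral>\<^sup>+\<omega>. of_nat (card (Nset \<rho> k (PPconf \<omega>))) * ennreal (sparse_bound k (intensity s t)) \<partial>pp (unif_T :: (real^'d) measure) s)"
    by (simp add: V.emeasure_space_1)
  also have "\<dots> = (\<integral>\<^sup>+\<omega>. of_nat (card (Nset \<rho> k (PPconf \<omega>))) \<partial>pp (unif_T :: (real^'d) measure) s) * ennreal (sparse_bound k (intensity s t))"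
    by (intro nn_integral_multc measurable_card_Nset_pp)
  finally show ?thesis by (simp add: mult.commute)
qed

text \<open>Double counting: a centre x with k + 1 points in its ball vouches for at most these k +
  1 points y.\<close>

lemma size_Nset_le:
  "size (filter_mset (\<lambda>y. y \<in> Nset \<rho> k \<mu>) \<mu>) \<le> (k + 1) * size (filter_mset (\<lambda>x. ball_count \<mu> x \<rho> = Suc k) \<mu>)"
proof -
  have "size (filter_mset (\<lambda>y. y \<in> Nset \<rho> k \<mu>) \<mu>) = (\<Sum>y\<in>#\<mu>. of_bool (y \<in> Nset \<rho> k \<mu>))"
    by (simp add: sum_mset_of_bool')
  also have "\<dots> \<le> (\<Sum>y\<in>#\<mu>. \<Sum>x\<in>#\<mu>. of_bool (ball_count \<mu> x \<rho> = Suc k \<and> tdist x y \<le> \<rho>))"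
  proof (rule sum_mset_mono)
    fix y
    show "of_bool (y \<in> Nset \<rho> k \<mu>) \<le> (\<Sum>x\<in>#\<mu>. of_bool (ball_count \<mu> x \<rho> = Suc k \<and> tdist x y \<le> \<rho>) :: nat)"
    proof (cases "y \<in> Nset \<rho> k \<mu>")
      case True
      then obtain x where "x \<in># filter_mset (\<lambda>x. ball_count \<mu> x \<rho> = Suc k \<and> tdist x y \<le> \<rho>) \<mu>"
        by (auto simp: Nset_def mem_tball tdist_commute)
      then have "1 \<le> size (filter_mset (\<lambda>x. ball_count \<mu> x \<rho> = Suc k \<and> tdist x y \<le> \<rho>) \<mu>)"
        by (metis Suc_le_eq One_nat_def empty_not_add_mset multi_member_split nonempty_has_size)
      then show ?thesis by (simp add: sum_mset_of_bool')
    qed simp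
  qed
  also have "\<dots> = (\<Sum>x\<in>#\<mu>. \<Sum>y\<in>#\<mu>. of_bool (ball_count \<mu> x \<rho> = Suc k \<and> tdist x y \<le> \<rho>))"
    by (rule sum_mset.swap)
  also have "\<dots> = (\<Sum>x\<in>#\<mu>. of_bool (ball_count \<mu> x \<rho> = Suc k) * Suc k)"
  proof (intro arg_cong[where f = sum_mset] image_mset_cong)
    fix x
    have "(\<Sum>y\<in>#\<mu>. of_bool (tdist x y \<le> \<rho>)) = ball_count \<mu> x \<rho>"
      by (simp add: sum_mset_of_bool' ball_count_def mem_tball)
    then show "(\<Sum>y\<in>#\<mu>. of_bool (ball_count \<mu> x \<rho> = Suc k \<and> tdist x y \<le> \<rho>)) = of_bool (ball_count \<mu> x \<rho> = Suc k) * Suc k"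
      by (cases "ball_count \<mu> x \<rho> = Suc k") simp_all
  qed
  also have "\<dots> = (k + 1) * size (filter_mset (\<lambda>x. ball_count \<mu> x \<rho> = Suc k) \<mu>)"
    by (simp only: sum_mset_of_bool) simp
  finally show ?thesis .
qed

text \<open>The mean number of centres that can put their neighbours into
  \<open>Nset\<close>.\<close>

definition crit :: "real \<Rightarrow> nat \<Rightarrow> ennreal" where
  "crit s k = PE s (\<lambda>\<mu> :: (real^'d) multiset. of_nat (size (filter_mset (\<lambda>x. ball_count \<mu> x \<rho> = Suc k) \<mu>)))"

lemma measurable_crit [measurable]:
  "(\<lambda>\<omega>. of_nat (size (filter_mset (\<lambda>x. ball_count (PPconf \<omega>) x \<rho> = Suc k) (PPconf \<omega>))) :: ennreal) \<in> borel_measurable (pp (unif_T :: (real^'d) measure) s)"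
  by (rule pp_measurable[OF prob_space_unif_T]) (unfold PPconf_pair size_filter_conf of_nat_sum of_nat_of_bool, measurable)

lemma ENn_le_crit:
  assumes "0 \<le> s" "0 \<le> t"
  shows "ENn TYPE('d) s \<rho> k t \<le> ennreal (sparse_bound k (intensity s t) * exp (- t) * real (k + 1)) * crit s k"
proof -
  let ?b = "ennreal (sparse_bound k (intensity s t))"
  define h where "h \<omega> i = (of_bool (snd \<omega> i \<in> Nset \<rho> k (PPconf \<omega>)) :: ennreal)" for \<omega> :: "nat \<times> (nat \<Rightarrow> real^'d)" and i
  have 1: "(\<integral>\<^sup>+\<beta>. of_nat (overlap \<rho> k t \<omega> u \<beta>) \<partial>pp (unif_T :: (real^'d) measure) (intensity s t))
      \<le> (\<Sum>i<fst \<omega>. h \<omega> i * of_bool (u i \<le> exp (- t)) * ?b)" for \<omega> and u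
  proof -
    have "(\<integral>\<^sup>+\<beta>. of_nat (overlap \<rho> k t \<omega> u \<beta>) \<partial>pp (unif_T :: (real^'d) measure) (intensity s t))
      \<le> (\<integral>\<^sup>+\<beta>. (\<Sum>i<fst \<omega>. h \<omega> i * of_bool (u i \<le> exp (- t)) * sparse_cells k (snd \<omega> i) (PPconf \<beta>)) \<partial>pp (unif_T :: (real^'d) measure) (intensity s t))"
    proof (rule nn_integral_mono_AE)
      \<comment> \<open>Added points almost surely miss the initial ones, so a common point must be
        an initial point whose mark allows it to survive.\<close>
      have "AE \<beta> in pp (unif_T :: (real^'d) measure) (intensity s t). \<forall>i j. snd \<beta> j \<noteq> snd \<omega> i"
        by (rule AE_pp_avoid[OF prob_space_unif_T AE_unif_T_neq])
      then show "AE \<beta> in pp (unif_T :: (real^'d) measure) (intensity s t). of_nat (overlap \<rho> k t \<omega> u \<beta>)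
          \<le> (\<Sum>i<fst \<omega>. h \<omega> i * of_bool (u i \<le> exp (- t)) * sparse_cells k (snd \<omega> i) (PPconf \<beta>))"
      proof eventually_elim
        fix \<beta> :: "nat \<times> (nat \<Rightarrow> real^'d)" assume neq: "\<forall>i j. snd \<beta> j \<noteq> snd \<omega> i"
        define Nt where "Nt = Nset \<rho> k (kept t (fst \<omega>) (snd \<omega>) u + PPconf \<beta>)"
        define I where "I = {i. i < fst \<omega> \<and> snd \<omega> i \<in> Nset \<rho> k (PPconf \<omega>) \<and> u i \<le> exp (- t) \<and> snd \<omega> i \<in> Nt}"
        have sub: "Nset \<rho> k (PPconf \<omega>) \<inter> Nt \<subseteq> snd \<omega> ` I"
        proof
          fix y assume y: "y \<in> Nset \<rho> k (PPconf \<omega>) \<inter> Nt"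
          then have "y \<in># PPconf \<omega>" "y \<in># kept t (fst \<omega>) (snd \<omega>) u + PPconf \<beta>" by (auto simp: Nset_def Nt_def)
          moreover have "y \<notin># PPconf \<beta>" using \<open>y \<in># PPconf \<omega>\<close> neq by (auto simp: PPconf_eq in_conf)
          ultimately obtain i where "i < fst \<omega>" "u i \<le> exp (- t)" "snd \<omega> i = y" by (auto simp: in_kept)
          then show "y \<in> snd \<omega> ` I" using y by (auto simp: I_def)
        qed
        have fI: "finite I" by (simp add: I_def)
        have "overlap \<rho> k t \<omega> u \<beta> \<le> card (snd \<omega> ` I)"
          unfolding overlap_def Nt_def[symmetric] using sub fI by (intro card_mono) auto
        also have "\<dots> \<le> card I" by (rule card_image_le[OF fI])
        finally have "(of_nat (overlap \<rho> k t \<omega> u \<beta>) :: ennreal) \<le> of_nat (card I)"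
          by (simp add: ennreal_of_nat_eq_real_of_nat ennreal_leI)
        also have "\<dots> = (\<Sum>i\<in>I. 1)" by simp
        also have "\<dots> \<le> (\<Sum>i\<in>I. h \<omega> i * of_bool (u i \<le> exp (- t)) * sparse_cells k (snd \<omega> i) (PPconf \<beta>))"
          by (intro sum_mono) (auto simp: I_def Nt_def h_def dest!: sparse_cells_ge_1)
        also have "\<dots> \<le> (\<Sum>i<fst \<omega>. h \<omega> i * of_bool (u i \<le> exp (- t)) * sparse_cells k (snd \<omega> i) (PPconf \<beta>))"
          by (intro sum_mono2) (auto simp: I_def)
        finally show "of_nat (overlap \<rho> k t \<omega> u \<beta>) \<le> (\<Sum>i<fst \<omega>. h \<omega> i * of_bool (u i \<le> exp (- t)) * sparse_cells k (snd \<omega> i) (PPconf \<beta>))" .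
      qed
    qed
    also have "\<dots> = (\<Sum>i<fst \<omega>. h \<omega> i * of_bool (u i \<le> exp (- t)) * (\<integral>\<^sup>+\<beta>. sparse_cells k (snd \<omega> i) (PPconf \<beta>) \<partial>pp (unif_T :: (real^'d) measure) (intensity s t)))"
      by (simp add: nn_integral_sum nn_integral_cmult)
    also have "\<dots> \<le> (\<Sum>i<fst \<omega>. h \<omega> i * of_bool (u i \<le> exp (- t)) * ?b)"
      by (intro sum_mono mult_left_mono nn_integral_sparse_cells intensity_nonneg assms) auto
    finally show ?thesis .
  qed
  have 2: "(\<integral>\<^sup>+u. (\<Sum>i<fst \<omega>. h \<omega> i * of_bool (u i \<le> exp (- t)) * ?b) \<partial>seq_space unif01)
      \<le> ennreal (sparse_bound k (intensity s t) * exp (- t) * real (k + 1)) * of_nat (size (filter_mset (\<lambda>x. ball_count (PPconf \<omega>) x \<rho> = Suc k) (PPconf \<omega>)))" for \<omega>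
  proof -
    have "(\<integral>\<^sup>+u. of_bool (u i \<le> exp (- t)) \<partial>seq_space unif01) = ennreal (exp (- t))" for i
      using nn_integral_marks[OF \<open>0 \<le> t\<close>, of "{i}"] by simp
    then have "(\<integral>\<^sup>+u. (\<Sum>i<fst \<omega>. h \<omega> i * of_bool (u i \<le> exp (- t)) * ?b) \<partial>seq_space unif01)
        = (\<Sum>i<fst \<omega>. h \<omega> i * ennreal (exp (- t)) * ?b)"
      by (simp add: nn_integral_sum nn_integral_cmult nn_integral_multc)
    also have "\<dots> = (\<Sum>i<fst \<omega>. h \<omega> i) * (ennreal (exp (- t)) * ?b)"
      by (simp add: sum_distrib_right mult.assoc)
    also have "(\<Sum>i<fst \<omega>. h \<omega> i) = of_nat (size (filter_mset (\<lambda>y. y \<in> Nset \<rho> k (PPconf \<omega>)) (PPconf \<omega>)))"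
      by (simp add: h_def PPconf_eq size_filter_conf)
    also have "\<dots> * (ennreal (exp (- t)) * ?b) \<le> of_nat ((k + 1) * size (filter_mset (\<lambda>x. ball_count (PPconf \<omega>) x \<rho> = Suc k) (PPconf \<omega>))) * (ennreal (exp (- t)) * ?b)"
      by (intro mult_right_mono of_nat_mono size_Nset_le) simp
    also have "\<dots> = ennreal (sparse_bound k (intensity s t) * exp (- t) * real (k + 1)) * of_nat (size (filter_mset (\<lambda>x. ball_count (PPconf \<omega>) x \<rho> = Suc k) (PPconf \<omega>)))"
    proof -
      have "ennreal (sparse_bound k (intensity s t) * exp (- t) * real (k + 1)) = ?b * ennreal (exp (- t)) * of_nat (k + 1)"
        unfolding ennreal_of_nat_eq_real_of_nat
        by (simp only: ennreal_mult sparse_bound_nonneg exp_ge_zero of_nat_0_le_iff mult_nonneg_nonneg)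
      then show ?thesis by (simp only: of_nat_mult mult_ac)
    qed
    finally show ?thesis .
  qed
  have "ENn TYPE('d) s \<rho> k t \<le> (\<integral>\<^sup>+\<omega>. \<integral>\<^sup>+u. (\<Sum>i<fst \<omega>. h \<omega> i * of_bool (u i \<le> exp (- t)) * ?b) \<partial>seq_space unif01 \<partial>pp (unif_T :: (real^'d) measure) s)"
    unfolding ENn_def by (intro nn_integral_mono 1)
  also have "\<dots> \<le> (\<integral>\<^sup>+\<omega>. ennreal (sparse_bound k (intensity s t) * exp (- t) * real (k + 1)) * of_nat (size (filter_mset (\<lambda>x. ball_count (PPconf \<omega>) x \<rho> = Suc k) (PPconf \<omega>))) \<partial>pp (unif_T :: (real^'d) measure) s)"
    by (intro nn_integral_mono 2)
  also have "\<dots> = ennreal (sparse_bound k (intensity s t) * exp (- t) * real (k + 1)) * crit s k"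
    unfolding crit_def by (rule nn_integral_cmult) measurable
  finally show ?thesis .
qed

end

section \<open>Measurability of the overlap in time\<close>

lemma measurable_fst_pp: "fst \<in> measurable (pp M s) (count_space UNIV)"
proof -
  have "fst \<in> measurable (pp M s) (measure_pmf (poi s))" unfolding pp_def by measurable
  then show ?thesis by simp
qed

lemma measurable_snd_pp: "(\<lambda>\<omega>. snd \<omega> i) \<in> borel_measurable (pp (unif_T :: (real^'d) measure) s)"
  unfolding pp_def by measurable

lemma measurable_overlap_ennreal:
  fixes om be :: "'w \<Rightarrow> nat \<times> (nat \<Rightarrow> real^'d)"
  assumes om: "om \<in> measurable N (pp unif_T s)" and be: "be \<in> measurable N (pp unif_T s')"
    and u: "u \<in> measurable N (seq_space unif01)" and T: "T \<in> borel_measurable N"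
  shows "(\<lambda>w. of_nat (overlap \<rho> k (T w) (om w) (u w) (be w)) :: ennreal) \<in> borel_measurable N"
proof -
  have u': "(\<lambda>w. u w i) \<in> borel_measurable N" for i
  proof -
    have "(\<lambda>f. f i) \<in> borel_measurable (seq_space unif01)" by measurable
    then show ?thesis by (rule measurable_compose[OF u])
  qed
  have om': "(\<lambda>w. snd (om w) i) \<in> borel_measurable N" for i
    by (rule measurable_compose[OF om measurable_snd_pp])
  have be': "(\<lambda>w. snd (be w) i) \<in> borel_measurable N" for i
    by (rule measurable_compose[OF be measurable_snd_pp])
  show ?thesis
    using measurable_compose[OF measurable_overlap[OF measurable_compose[OF om measurable_fst_pp]
      measurable_compose[OF be measurable_fst_pp] om' be' u' T] measurable_ennreal]
    by (simp add: overlap_def PPconf_eq ennreal_of_nat_eq_real_of_nat)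
qed

lemma space_pp: "space (pp (unif_T :: (real^'d) measure) s) = UNIV"
  by (simp add: pp_def space_pair_measure space_PiM)

lemma measurable_Pair_pp: "z \<in> measurable N (seq_space M) \<Longrightarrow> (\<lambda>w. (m, z w)) \<in> measurable N (pp M s)"
  unfolding pp_def by measurable

context
  fixes \<rho> s :: real and k :: nat
  assumes s: "0 \<le> s"
begin

interpretation V: prob_space "seq_space unif01" by (intro prob_space_PiM prob_space_unif01)

lemma measurable_overlap_u:
  "(\<lambda>u. \<integral>\<^sup>+\<beta>. of_nat (overlap \<rho> k t \<omega> u \<beta>) \<partial>pp (unif_T :: (real^'d) measure) s') \<in> borel_measurable (seq_space unif01)"
  and measurable_overlap_\<omega>:
  "(\<lambda>\<omega>. \<integral>\<^sup>+u. \<integral>\<^sup>+\<beta>. of_nat (overlap \<rho> k t \<omega> u \<beta>) \<partial>pp (unif_T :: (real^'d) measure) s' \<partial>seq_space unif01) \<in> borel_measurable (pp unif_T s)"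
  and measurable_overlap_\<beta>:
  "(\<lambda>\<beta>. of_nat (overlap \<rho> k t \<omega> u \<beta>) :: ennreal) \<in> borel_measurable (pp (unif_T :: (real^'d) measure) s')"
proof -
  interpret B: prob_space "pp (unif_T :: (real^'d) measure) s'" by (rule prob_space_pp[OF prob_space_unif_T])
  have joint: "(\<lambda>((\<omega>, u), \<beta>). of_nat (overlap \<rho> k t \<omega> u \<beta>) :: ennreal)
    \<in> borel_measurable ((pp (unif_T :: (real^'d) measure) s \<Otimes>\<^sub>M seq_space unif01) \<Otimes>\<^sub>M pp (unif_T :: (real^'d) measure) s')"
    unfolding case_prod_beta by (rule measurable_overlap_ennreal) measurable
  have inner: "(\<lambda>(\<omega>, u). \<integral>\<^sup>+\<beta>. of_nat (overlap \<rho> k t \<omega> u \<beta>) \<partial>pp (unif_T :: (real^'d) measure) s') \<in> borel_measurable (pp (unif_T :: (real^'d) measure) s \<Otimes>\<^sub>M seq_space unif01)"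
    using B.borel_measurable_nn_integral_fst[OF joint] by (simp add: case_prod_beta)
  show "(\<lambda>\<omega>. \<integral>\<^sup>+u. \<integral>\<^sup>+\<beta>. of_nat (overlap \<rho> k t \<omega> u \<beta>) \<partial>pp (unif_T :: (real^'d) measure) s' \<partial>seq_space unif01) \<in> borel_measurable (pp unif_T s)"
    using V.borel_measurable_nn_integral_fst[OF inner] by simp
  have "(\<lambda>(u, \<beta>). of_nat (overlap \<rho> k t \<omega> u \<beta>) :: ennreal) \<in> borel_measurable (seq_space unif01 \<Otimes>\<^sub>M pp (unif_T :: (real^'d) measure) s')"
    unfolding case_prod_beta by (rule measurable_overlap_ennreal[where s = s and s' = s'], rule measurable_const) (simp add: space_pp, measurable)
  then show "(\<lambda>u. \<integral>\<^sup>+\<beta>. of_nat (overlap \<rho> k t \<omega> u \<beta>) \<partial>pp (unif_T :: (real^'d) measure) s') \<in> borel_measurable (seq_space unif01)"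
    by (rule B.borel_measurable_nn_integral)
  show "(\<lambda>\<beta>. of_nat (overlap \<rho> k t \<omega> u \<beta>) :: ennreal) \<in> borel_measurable (pp (unif_T :: (real^'d) measure) s')"
    by (rule measurable_overlap_ennreal[where s = s and s' = s'], rule measurable_const)
      (simp_all add: space_pp space_PiM)
qed

text \<open>The space \<open>CPspace\<close> itself depends on t, through the Poisson law of the
  number of added points. Expanding in that number moves t into the weights and the integrand, over
  spaces that no longer depend on t.\<close>

lemma measurable_ENoverlap:
  "(\<lambda>t. indicator {0..} t * ENoverlap TYPE('d::finite) s \<rho> k t) \<in> borel_measurable borel"
proof -
  let ?U = "unif_T :: (real^'d) measure"
  interpret P: prob_space "pp ?U s" by (rule prob_space_pp[OF prob_space_unif_T])
  interpret S: prob_space "seq_space ?U" by (intro prob_space_PiM prob_space_unif_T)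
  define f where "f m t \<omega> u = (\<integral>\<^sup>+z. of_nat (overlap \<rho> k t \<omega> u (m, z)) \<partial>seq_space ?U)" for m t \<omega> u
  define H where "H t = (\<integral>\<^sup>+\<omega>. \<integral>\<^sup>+u. (\<Sum>m. ennreal (pois (intensity s t) m) * f m t \<omega> u) \<partial>seq_space unif01 \<partial>pp ?U s)" for t
  have "(\<lambda>(((t, \<omega>), u), z). of_nat (overlap \<rho> k t \<omega> u (m, z)) :: ennreal)
    \<in> borel_measurable (((borel \<Otimes>\<^sub>M pp ?U s) \<Otimes>\<^sub>M seq_space unif01) \<Otimes>\<^sub>M seq_space ?U)" for m
    unfolding case_prod_beta by (rule measurable_overlap_ennreal[OF _ measurable_Pair_pp]) measurable
  from S.borel_measurable_nn_integral_fst[OF this]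
  have [measurable]: "(\<lambda>w. f m (fst (fst w)) (snd (fst w)) (snd w)) \<in> borel_measurable ((borel \<Otimes>\<^sub>M pp ?U s) \<Otimes>\<^sub>M seq_space unif01)" for m
    by (simp add: f_def case_prod_beta)
  have [measurable]: "intensity s \<in> borel_measurable borel"
    unfolding intensity_def by measurable
  have "(\<lambda>w. \<Sum>m. ennreal (pois (intensity s (fst (fst w))) m) * f m (fst (fst w)) (snd (fst w)) (snd w)) \<in> borel_measurable ((borel \<Otimes>\<^sub>M pp ?U s) \<Otimes>\<^sub>M seq_space unif01)"
    by measurable
  from V.borel_measurable_nn_integral_fst[OF this]
  have "(\<lambda>w. \<integral>\<^sup>+u. (\<Sum>m. ennreal (pois (intensity s (fst w)) m) * f m (fst w) (snd w) u) \<partial>seq_space unif01) \<in> borel_measurable (borel \<Otimes>\<^sub>M pp ?U s)"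
    by simp
  from P.borel_measurable_nn_integral_fst[OF this]
  have [measurable]: "H \<in> borel_measurable borel"
    by (simp add: H_def[abs_def])
  have "ENn TYPE('d) s \<rho> k t = H t" if "0 \<le> t" for t
  proof -
    have "0 \<le> intensity s t" using s that by (rule intensity_nonneg)
    then have "(\<integral>\<^sup>+\<beta>. of_nat (overlap \<rho> k t \<omega> u \<beta>) \<partial>pp ?U (intensity s t)) = (\<Sum>m. ennreal (pois (intensity s t) m) * f m t \<omega> u)" for \<omega> u
      by (subst nn_integral_pp[OF prob_space_unif_T])
        (simp_all add: f_def pmf_poi space_pp space_PiM
          measurable_overlap_ennreal[OF measurable_const[of _ "pp ?U s"] measurable_Pair_pp[of _ _ ?U _ s]])
    then show ?thesis by (simp add: ENn_def H_def)
  qed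
  then have "(\<lambda>t. indicator {0..} t * ENoverlap TYPE('d) s \<rho> k t) = (\<lambda>t. indicator {0..} t * enn2real (H t))"
    by (auto simp: fun_eq_iff ENoverlap_eq indicator_def)
  then show ?thesis by simp
qed

end

section \<open>Lower bound for the expected overlap\<close>

context cell_cover
begin

interpretation U: prob_space "unif_T :: (real^'d) measure" by (rule prob_space_unif_T)
interpretation V: prob_space "seq_space unif01" by (intro prob_space_PiM prob_space_unif01)

text \<open>If the whole ball of a point \<open>x\<close> with \<open>k\<close> neighbours is kept and receives no new points,
  then all neighbours of \<open>x\<close> belong to both sets; by packing, a neighbour is shared by boundedly many such \<open>x\<close>.\<close>

lemma overlap_ge:
  fixes x :: "nat \<Rightarrow> real^'d"
  assumes "inj x" "0 < k"
  shows "card {i. i < n \<and> ball_count (conf n x) (x i) \<rho> = Suc k \<and> (\<forall>j<n. tdist (x i) (x j) \<le> \<rho> \<longrightarrow> u j \<le> exp (- t))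
      \<and> ball_count (PPconf \<beta>) (x i) \<rho> = 0} \<le> K * (k + 1) * overlap \<rho> k t (n, x) u \<beta>"
proof -
  define L where "L = {i. i < n \<and> ball_count (conf n x) (x i) \<rho> = Suc k \<and> (\<forall>j<n. tdist (x i) (x j) \<le> \<rho> \<longrightarrow> u j \<le> exp (- t))
      \<and> ball_count (PPconf \<beta>) (x i) \<rho> = 0}"
  define C where "C = Nset \<rho> k (conf n x) \<inter> Nset \<rho> k (kept t n x u + PPconf \<beta>)"
  \<comment> \<open>Distance 2 \<rho> and counts up to k + 1 are allowed so that
    \<open>packing\<close> applies.\<close>
  define near where "near y = {i. i < n \<and> tdist y (x i) \<le> 2 * \<rho> \<and> ball_count (conf n x) (x i) \<rho> \<le> k + 1}" for y :: "real^'d"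
  have finC: "finite C" by (rule finite_subset[of _ "set_mset (conf n x)"]) (auto simp: C_def Nset_def)
  have "\<exists>y\<in>C. i \<in> near y" if i: "i \<in> L" for i
  proof -
    have i': "i < n" "ball_count (conf n x) (x i) \<rho> = Suc k" "\<And>j. j < n \<Longrightarrow> tdist (x i) (x j) \<le> \<rho> \<Longrightarrow> u j \<le> exp (- t)"
      "ball_count (PPconf \<beta>) (x i) \<rho> = 0"
      using i by (auto simp: L_def)
    have "\<exists>j<n. j \<noteq> i \<and> tdist (x i) (x j) \<le> \<rho>"
    proof (rule ccontr)
      assume "\<not> ?thesis"
      then have "{j. j < n \<and> tdist (x i) (x j) \<le> \<rho>} \<subseteq> {i}" by auto
      then have "card {j. j < n \<and> tdist (x i) (x j) \<le> \<rho>} \<le> 1" using card_mono[of "{i}"] by fastforce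
      moreover have "{..<n} \<inter> {j. tdist (x i) (x j) \<le> \<rho>} = {j. j < n \<and> tdist (x i) (x j) \<le> \<rho>}" by auto
      ultimately show False using i'(2) \<open>0 < k\<close> by (simp add: ball_count_conf)
    qed
    then obtain j where j: "j < n" "j \<noteq> i" "tdist (x i) (x j) \<le> \<rho>" by auto
    have neq: "x i \<noteq> x j" using \<open>inj x\<close> j(2) by (auto dest: injD)
    have "ball_count (kept t n x u) (x i) \<rho> = ball_count (conf n x) (x i) \<rho>"
      unfolding ball_count_kept ball_count_conf using i'(3) by (intro sum.cong) auto
    then have kept: "ball_count (kept t n x u + PPconf \<beta>) (x i) \<rho> = Suc k"
      using i'(2,4) by (simp add: ball_count_plus)
    have ui: "u i \<le> exp (- t)" "u j \<le> exp (- t)" using i' j \<rho>_pos by auto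
    have tb: "x i \<in> tball (x j) \<rho>" using j(3) by (simp add: mem_tball tdist_commute)
    have "x j \<in> Nset \<rho> k (conf n x)"
      unfolding Nset_def using i' j neq tb by (auto simp: in_conf intro!: exI[of _ "x i"])
    moreover have "x j \<in> Nset \<rho> k (kept t n x u + PPconf \<beta>)"
      unfolding Nset_def using i'(1) j neq tb kept ui by (auto simp: in_kept intro!: exI[of _ "x i"])
    moreover have "i \<in> near (x j)"
      using i' j(3) \<rho>_pos by (auto simp: near_def tdist_commute)
    ultimately show ?thesis unfolding C_def by blast
  qed
  then have "card L \<le> card (\<Union>y\<in>C. near y)"
    using finC by (intro card_mono) (auto simp: near_def)
  also have "\<dots> \<le> (\<Sum>y\<in>C. card (near y))" by (rule card_UN_le[OF finC])
  also have "\<dots> \<le> (\<Sum>y\<in>C. K * (k + 1))"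
  proof (rule sum_mono)
    fix y :: "real^'d"
    have "{..<n} \<inter> {i. tdist y (x i) \<le> 2 * \<rho> \<and> ball_count (conf n x) (x i) \<rho> \<le> k + 1} = near y"
      by (auto simp: near_def)
    then show "card (near y) \<le> K * (k + 1)"
      using packing[of y "conf n x" "k + 1"] by (simp add: size_filter_conf)
  qed
  finally show ?thesis by (simp add: L_def C_def overlap_def mult.commute)
qed

text \<open>Integrates \<open>overlap_ge\<close>. The ball of a critical centre holds k + 1 points
  including the centre, whose independent marks all survive with probability e^(-t (k + 1)), and the
  added process misses the ball with probability at least
  \<open>exp (- (intensity s t * A))\<close>.\<close>

lemma ENn_ge:
  assumes s: "0 \<le> s" and t: "0 \<le> t" and k: "0 < k" and A: "\<And>x :: real^'d. vol \<rho> x \<le> A"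
  shows "ennreal (exp (- t) ^ (k + 1) * exp (- (intensity s t * A))) * crit s k \<le> of_nat (K * (k + 1)) * ENn TYPE('d) s \<rho> k t"
proof -
  let ?U = "unif_T :: (real^'d) measure"
  have s': "0 \<le> intensity s t" using s t by (rule intensity_nonneg)
  define B where "B \<omega> i = {j. j < fst \<omega> \<and> tdist (snd \<omega> i) (snd \<omega> j) \<le> \<rho>}" for \<omega> :: "nat \<times> (nat \<Rightarrow> real^'d)" and i
  define a where "a \<omega> i = (of_bool (ball_count (PPconf \<omega>) (snd \<omega> i) \<rho> = Suc k) :: ennreal)" for \<omega> :: "nat \<times> (nat \<Rightarrow> real^'d)" and i
  define b where "b \<omega> u i = (of_bool (\<forall>j\<in>B \<omega> i. u j \<le> exp (- t)) :: ennreal)" for \<omega> i and u :: "nat \<Rightarrow> real"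
  define v where "v \<omega> \<beta> i = (of_bool (ball_count (PPconf \<beta>) (snd \<omega> i) \<rho> = 0) :: ennreal)" for \<omega> \<beta> :: "nat \<times> (nat \<Rightarrow> real^'d)" and i
  have cardB: "ball_count (PPconf \<omega>) (snd \<omega> i) \<rho> = card (B \<omega> i)" for \<omega> i
  proof -
    have "{..<fst \<omega>} \<inter> {j. tdist (snd \<omega> i) (snd \<omega> j) \<le> \<rho>} = B \<omega> i" by (auto simp: B_def)
    then show ?thesis by (simp add: PPconf_eq ball_count_conf)
  qed
  have [measurable]: "(\<lambda>\<beta>. v \<omega> \<beta> i) \<in> borel_measurable (pp ?U s')" for \<omega> i s'
    unfolding v_def by (rule pp_measurable[OF prob_space_unif_T]) (unfold PPconf_pair, measurable)
  have finB: "finite (B \<omega> i)" for \<omega> i by (simp add: B_def)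
  have [measurable]: "(\<lambda>u. b \<omega> u i) \<in> borel_measurable (seq_space unif01)" for \<omega> i
    unfolding b_def using finB by measurable
  have det: "(\<Sum>i<fst \<omega>. a \<omega> i * b \<omega> u i * v \<omega> \<beta> i) \<le> of_nat (K * (k + 1)) * of_nat (overlap \<rho> k t \<omega> u \<beta>)"
    if "inj (snd \<omega>)" for \<omega> u \<beta>
  proof -
    define L where "L = {i. i < fst \<omega> \<and> ball_count (conf (fst \<omega>) (snd \<omega>)) (snd \<omega> i) \<rho> = Suc k \<and>
      (\<forall>j<fst \<omega>. tdist (snd \<omega> i) (snd \<omega> j) \<le> \<rho> \<longrightarrow> u j \<le> exp (- t)) \<and> ball_count (PPconf \<beta>) (snd \<omega> i) \<rho> = 0}"
    have "(\<Sum>i<fst \<omega>. a \<omega> i * b \<omega> u i * v \<omega> \<beta> i) = (\<Sum>i<fst \<omega>. of_bool (i \<in> L))"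
      by (intro sum.cong refl) (auto simp: a_def b_def v_def B_def L_def PPconf_eq)
    also have "\<dots> = of_nat (card ({..<fst \<omega>} \<inter> L))" by simp
    also have "{..<fst \<omega>} \<inter> L = L" by (auto simp: L_def)
    also have "of_nat (card L) \<le> (of_nat (K * (k + 1) * overlap \<rho> k t (fst \<omega>, snd \<omega>) u \<beta>) :: ennreal)"
      unfolding L_def by (intro of_nat_mono overlap_ge that k)
    finally show ?thesis by (simp only: of_nat_mult prod.collapse)
  qed
  have v: "ennreal (exp (- (intensity s t * A))) \<le> (\<integral>\<^sup>+\<beta>. v \<omega> \<beta> i \<partial>pp ?U (intensity s t))" for \<omega> i
  proof -
    have "ennreal (exp (- (intensity s t * A))) \<le> ennreal (pois (intensity s t * vol \<rho> (snd \<omega> i)) 0)"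
      using A s' by (auto simp: pois_def intro!: ennreal_leI mult_left_mono)
    then show ?thesis by (simp add: v_def PE_ball_count(1)[OF s'])
  qed
  have inner: "ennreal (exp (- t) ^ (k + 1) * exp (- (intensity s t * A))) * of_nat (size (filter_mset (\<lambda>x. ball_count (PPconf \<omega>) x \<rho> = Suc k) (PPconf \<omega>)))
      \<le> (\<integral>\<^sup>+u. \<integral>\<^sup>+\<beta>. (\<Sum>i<fst \<omega>. a \<omega> i * b \<omega> u i * v \<omega> \<beta> i) \<partial>pp ?U (intensity s t) \<partial>seq_space unif01)" for \<omega>
  proof -
    have "ennreal (exp (- t) ^ (k + 1) * exp (- (intensity s t * A))) * of_nat (size (filter_mset (\<lambda>x. ball_count (PPconf \<omega>) x \<rho> = Suc k) (PPconf \<omega>)))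
        = (\<Sum>i<fst \<omega>. a \<omega> i * (ennreal (exp (- t) ^ (k + 1)) * ennreal (exp (- (intensity s t * A)))))"
      by (simp add: a_def PPconf_eq size_filter_conf ennreal_mult mult.commute flip: sum_distrib_right)
    also have "\<dots> = (\<Sum>i<fst \<omega>. a \<omega> i * ((\<integral>\<^sup>+u. b \<omega> u i \<partial>seq_space unif01) * ennreal (exp (- (intensity s t * A)))))"
    proof (intro sum.cong refl)
      fix i
      \<comment> \<open>The number of marks involved is \<open>card (B \<omega> i)\<close>, which is
        k + 1 whenever \<open>a \<omega> i\<close> is nonzero.\<close>
      show "a \<omega> i * (ennreal (exp (- t) ^ (k + 1)) * ennreal (exp (- (intensity s t * A)))) = a \<omega> i * ((\<integral>\<^sup>+u. b \<omega> u i \<partial>seq_space unif01) * ennreal (exp (- (intensity s t * A))))"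
        unfolding b_def nn_integral_marks[OF t finB] by (cases "card (B \<omega> i) = Suc k") (simp_all add: a_def cardB)
    qed
    also have "\<dots> = (\<integral>\<^sup>+u. (\<Sum>i<fst \<omega>. a \<omega> i * b \<omega> u i * ennreal (exp (- (intensity s t * A)))) \<partial>seq_space unif01)"
      by (simp add: nn_integral_sum nn_integral_cmult nn_integral_multc mult.assoc)
    also have "\<dots> \<le> (\<integral>\<^sup>+u. (\<Sum>i<fst \<omega>. a \<omega> i * b \<omega> u i * (\<integral>\<^sup>+\<beta>. v \<omega> \<beta> i \<partial>pp ?U (intensity s t))) \<partial>seq_space unif01)"
      by (intro nn_integral_mono sum_mono mult_left_mono v) auto
    also have "\<dots> = (\<integral>\<^sup>+u. \<integral>\<^sup>+\<beta>. (\<Sum>i<fst \<omega>. a \<omega> i * b \<omega> u i * v \<omega> \<beta> i) \<partial>pp ?U (intensity s t) \<partial>seq_space unif01)"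
      by (simp add: nn_integral_sum nn_integral_cmult)
    finally show ?thesis .
  qed
  have "ennreal (exp (- t) ^ (k + 1) * exp (- (intensity s t * A))) * crit s k
      = (\<integral>\<^sup>+\<omega>. ennreal (exp (- t) ^ (k + 1) * exp (- (intensity s t * A))) * of_nat (size (filter_mset (\<lambda>x. ball_count (PPconf \<omega>) x \<rho> = Suc k) (PPconf \<omega>))) \<partial>pp ?U s)"
    unfolding crit_def by (rule nn_integral_cmult[symmetric]) measurable
  also have "\<dots> \<le> (\<integral>\<^sup>+\<omega>. \<integral>\<^sup>+u. \<integral>\<^sup>+\<beta>. of_nat (K * (k + 1)) * of_nat (overlap \<rho> k t \<omega> u \<beta>) \<partial>pp ?U (intensity s t) \<partial>seq_space unif01 \<partial>pp ?U s)"
  proof (rule nn_integral_mono_AE)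
    show "AE \<omega> in pp ?U s. ennreal (exp (- t) ^ (k + 1) * exp (- (intensity s t * A))) * of_nat (size (filter_mset (\<lambda>x. ball_count (PPconf \<omega>) x \<rho> = Suc k) (PPconf \<omega>)))
      \<le> (\<integral>\<^sup>+u. \<integral>\<^sup>+\<beta>. of_nat (K * (k + 1)) * of_nat (overlap \<rho> k t \<omega> u \<beta>) \<partial>pp ?U (intensity s t) \<partial>seq_space unif01)"
      using AE_pp_distinct
    proof eventually_elim
      fix \<omega> :: "nat \<times> (nat \<Rightarrow> real^'d)" assume "inj (snd \<omega>)"
      then show "ennreal (exp (- t) ^ (k + 1) * exp (- (intensity s t * A))) * of_nat (size (filter_mset (\<lambda>x. ball_count (PPconf \<omega>) x \<rho> = Suc k) (PPconf \<omega>)))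
        \<le> (\<integral>\<^sup>+u. \<integral>\<^sup>+\<beta>. of_nat (K * (k + 1)) * of_nat (overlap \<rho> k t \<omega> u \<beta>) \<partial>pp ?U (intensity s t) \<partial>seq_space unif01)"
        by (intro order_trans[OF inner] nn_integral_mono det)
    qed
  qed
  also have "\<dots> = of_nat (K * (k + 1)) * ENn TYPE('d) s \<rho> k t"
    unfolding ENn_def
    by (simp only: nn_integral_cmult measurable_overlap_u[OF s] measurable_overlap_\<omega>[OF s] measurable_overlap_\<beta>[OF s])
  finally show ?thesis .
qed

end

section \<open>The three estimates\<close>

lemma pois_le_pois_less: "0 \<le> a \<Longrightarrow> pois a j \<le> pois_less (Suc j) a"
  by (simp add: pois_less_def sum_nonneg pois_nonneg)

text \<open>For a \<ge> 1 every term is at most a^j e^-a, that is j! p_j(a), and there are j + 1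
  terms.\<close>

lemma pois_less_le_pois:
  assumes "1 \<le> a" shows "pois_less (Suc j) a \<le> fact (Suc j) * pois a j"
proof -
  have "pois_less (Suc j) a \<le> (\<Sum>i<Suc j. a ^ j * exp (- a))"
    unfolding pois_less_def pois_def
  proof (intro sum_mono mult_right_mono)
    fix i assume "i \<in> {..<Suc j}"
    then have "a ^ i \<le> a ^ j" using assms by (intro power_increasing) auto
    moreover have "a ^ i / fact i \<le> a ^ i"
      using assms by (simp add: divide_le_eq mult_le_cancel_left1 fact_ge_1)
    ultimately show "a ^ i / fact i \<le> a ^ j" by linarith
  qed simp
  also have "\<dots> = fact (Suc j) * pois a j"
    by (simp add: pois_def)
  finally show ?thesis .
qed

text \<open>The substitution q = 1 - e^-t turns the integrand into e^(-b q) dq on [0,1);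
  \<open>?F\<close> is the corresponding primitive.\<close>

lemma integral_damped_exp_le:
  assumes b: "0 < b"
  shows "(\<integral>\<^sup>+t. ennreal (exp (- t) * exp (- (b * (1 - exp (- t))))) * indicator {0..} t \<partial>lborel) \<le> ennreal (1 / b)"
proof -
  let ?F = "\<lambda>t. - exp (- (b * (1 - exp (- t)))) / b"
  have "((\<lambda>t :: real. exp (- t)) \<longlongrightarrow> 0) at_top"
    by (rule filterlim_compose[OF exp_at_bot filterlim_uminus_at_bot_at_top])
  then have lim: "(?F \<longlongrightarrow> - exp (- (b * (1 - 0))) / b) at_top"
    using b by (intro tendsto_intros) auto
  have "(\<integral>\<^sup>+t. ennreal (exp (- t) * exp (- (b * (1 - exp (- t))))) * indicator {0..} t \<partial>lborel)
      = ennreal (- exp (- (b * (1 - 0))) / b - ?F 0)"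
    using b by (intro nn_integral_FTC_atLeast[OF _ _ _ lim]) (auto intro!: derivative_eq_intros)
  also have "\<dots> \<le> ennreal (1 / b)"
    using b by (intro ennreal_leI) (simp add: field_simps)
  finally show ?thesis .
qed

text \<open>A ball with one point holds only its centre x, yet by symmetry it would also contain y.
  For k = 0 this makes the overlap in (ii) vanish.\<close>

lemma Nset_0: "Nset \<rho> 0 \<mu> = {}" if "0 \<le> \<rho>"
proof (rule equals0I)
  fix y assume "y \<in> Nset \<rho> 0 \<mu>"
  then obtain x where x: "y \<in># \<mu>" "x \<in># \<mu>" "x \<in> tball y \<rho>" "x \<noteq> y" "ball_count \<mu> x \<rho> = 1"
    by (auto simp: Nset_def)
  have xy: "x \<in># filter_mset (\<lambda>z. z \<in> tball x \<rho>) \<mu>" "y \<in># filter_mset (\<lambda>z. z \<in> tball x \<rho>) \<mu>"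
    using x that by (auto simp: mem_tball tdist_commute)
  have "size (filter_mset (\<lambda>z. z \<in> tball x \<rho>) \<mu>) = 1" using x(5) by (simp add: ball_count_def)
  then obtain w where w: "filter_mset (\<lambda>z. z \<in> tball x \<rho>) \<mu> = {#w#}" by (metis size_1_singleton_mset)
  show False using xy[unfolded w] x(4) by simp
qed

section \<open>Averaged Poisson weights and the time integral of the overlap\<close>

context cell_cover
begin

interpretation U: prob_space "unif_T :: (real^'d) measure" by (rule prob_space_unif_T)

text \<open>By the Mecke formula, the mean number of points with j + 1 points in their ball,
  themselves included; see \<open>crit_eq\<close>.\<close>

definition pint :: "real \<Rightarrow> nat \<Rightarrow> real" where
  "pint s j = s * (\<integral>x. pois (s * vol \<rho> x) j \<partial>(unif_T :: (real^'d) measure))"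

context
  fixes s :: real
  assumes s: "0 \<le> s"
begin

lemma integrable_pois: "integrable (unif_T :: (real^'d) measure) (\<lambda>x. pois (s * vol \<rho> x) j)"
proof (rule U.integrable_const_bound[of _ 1])
  show "AE x in (unif_T :: (real^'d) measure). norm (pois (s * vol \<rho> x) j) \<le> 1"
    using s order_trans[OF pois_le_pois_less pois_less_le_1]
    by (intro always_eventually allI) (simp add: pois_nonneg vol_nonneg)
qed simp

lemma pint_nonneg: "0 \<le> pint s j"
  using s by (simp add: pint_def pois_nonneg vol_nonneg)

lemma crit_eq: "crit s k = ennreal (pint s k)"
proof -
  have "crit s k = ennreal s * (\<integral>\<^sup>+x. ennreal (pois (s * vol \<rho> x) k) \<partial>(unif_T :: (real^'d) measure))"
    unfolding crit_def PE_count_eq[OF s less_imp_le[OF \<rho>_pos], symmetric] by (simp only: sum_mset_of_bool')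
  then show ?thesis
    using s by (simp add: nn_integral_eq_integral integrable_pois pois_nonneg vol_nonneg pint_def ennreal_mult)
qed

lemma low_le: "low s k \<le> s"
proof -
  have "(\<integral>x. pois_less k (s * vol \<rho> x) \<partial>(unif_T :: (real^'d) measure)) \<le> 1"
    using s by (intro U.integral_le_const integrable_pois_less) (simp_all add: pois_less_le_1 vol_nonneg)
  then show ?thesis using s by (simp add: low_def mult_left_le)
qed

lemma pint_le_low: "pint s j \<le> low s (Suc j)"
  unfolding pint_def low_def using s
  by (intro mult_left_mono integral_mono integrable_pois integrable_pois_less) (simp_all add: pois_le_pois_less vol_nonneg)

lemma low_le_pint:
  assumes "\<And>x :: real^'d. 1 \<le> s * vol \<rho> x"
  shows "low s (Suc j) \<le> fact (Suc j) * pint s j"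
proof -
  have "low s (Suc j) \<le> s * (\<integral>x. fact (Suc j) * pois (s * vol \<rho> x) j \<partial>(unif_T :: (real^'d) measure))"
    unfolding low_def using s assms
    by (intro mult_left_mono integral_mono integrable_mult_right integrable_pois integrable_pois_less pois_less_le_pois)
  also have "\<dots> = fact (Suc j) * pint s j" by (simp add: pint_def del: fact_Suc)
  finally show ?thesis .
qed

text \<open>Raising the index inserts the factor a = s \<open>vol\<close> under the integral. The
  next bounds estimate this factor only and leave e^-a untouched.\<close>

lemma Suc_pint: "real (Suc j) * pint s (Suc j) = s * (\<integral>x. s * vol \<rho> x * pois (s * vol \<rho> x) j \<partial>(unif_T :: (real^'d) measure))"
  unfolding pint_def pois_Suc[symmetric] by (simp del: of_nat_Suc)

lemma integrable_vol_pois: "integrable (unif_T :: (real^'d) measure) (\<lambda>x. s * vol \<rho> x * pois (s * vol \<rho> x) j)"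
  unfolding pois_Suc[symmetric] by (intro integrable_mult_right integrable_pois)

lemma pint_Suc_ge:
  assumes "\<And>x :: real^'d. L \<le> s * vol \<rho> x"
  shows "L * pint s j \<le> real (Suc j) * pint s (Suc j)"
proof -
  have "L * pint s j = s * (\<integral>x. L * pois (s * vol \<rho> x) j \<partial>(unif_T :: (real^'d) measure))" by (simp add: pint_def)
  also have "\<dots> \<le> real (Suc j) * pint s (Suc j)"
    unfolding Suc_pint using s assms
    by (intro mult_left_mono integral_mono integrable_mult_right integrable_pois integrable_vol_pois mult_right_mono)
      (simp_all add: pois_nonneg vol_nonneg)
  finally show ?thesis .
qed

lemma pint_Suc_le:
  assumes "\<And>x :: real^'d. s * vol \<rho> x \<le> A"
  shows "real (Suc j) * pint s (Suc j) \<le> A * pint s j"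
proof -
  have "real (Suc j) * pint s (Suc j) \<le> s * (\<integral>x. A * pois (s * vol \<rho> x) j \<partial>(unif_T :: (real^'d) measure))"
    unfolding Suc_pint using s assms
    by (intro mult_left_mono integral_mono integrable_mult_right integrable_pois integrable_vol_pois mult_right_mono)
      (simp_all add: pois_nonneg vol_nonneg)
  also have "\<dots> = A * pint s j" by (simp add: pint_def)
  finally show ?thesis .
qed

lemma card_Nset_le:
  fixes \<mu> :: "(real^'d) multiset"
  shows "(of_nat (card (Nset \<rho> k \<mu>)) :: ennreal) \<le> of_nat ((k + 1) * size (filter_mset (\<lambda>x. ball_count \<mu> x \<rho> = Suc k) \<mu>))"
proof (rule of_nat_mono)
  have eq: "set_mset (filter_mset (\<lambda>y. y \<in> Nset \<rho> k \<mu>) \<mu>) = Nset \<rho> k \<mu>" by (auto simp: Nset_def)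
  have "card (set_mset M) \<le> size M" for M :: "(real^'d) multiset"
    by (induction M) (auto simp: card_insert_if)
  from this[of "filter_mset (\<lambda>y. y \<in> Nset \<rho> k \<mu>) \<mu>"]
  have "card (Nset \<rho> k \<mu>) \<le> size (filter_mset (\<lambda>y. y \<in> Nset \<rho> k \<mu>) \<mu>)"
    unfolding eq .
  also note size_Nset_le
  finally show "card (Nset \<rho> k \<mu>) \<le> (k + 1) * size (filter_mset (\<lambda>x. ball_count \<mu> x \<rho> = Suc k) \<mu>)" .
qed

lemma ENoverlap_le_EN:
  assumes t: "0 \<le> t"
  shows "ENoverlap TYPE('d) s \<rho> k t \<le> sparse_bound k (intensity s t) * EN TYPE('d) s \<rho> k"
proof -
  let ?N = "\<integral>\<^sup>+\<omega>. of_nat (card (Nset \<rho> k (PPconf \<omega>))) \<partial>pp (unif_T :: (real^'d) measure) s"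
  \<comment> \<open>Finiteness comes first because \<open>enn2real\<close> sends \<open>top\<close>
    to 0, which would break monotonicity.\<close>
  have "?N \<le> (\<integral>\<^sup>+\<omega>. of_nat (k + 1) * of_nat (size (filter_mset (\<lambda>x. ball_count (PPconf \<omega>) x \<rho> = Suc k) (PPconf \<omega>))) \<partial>pp (unif_T :: (real^'d) measure) s)"
    using card_Nset_le unfolding of_nat_mult by (intro nn_integral_mono)
  also have "\<dots> = of_nat (k + 1) * crit s k"
    unfolding crit_def by (rule nn_integral_cmult) measurable
  also have "\<dots> < top" by (simp add: crit_eq ennreal_mult_less_top ennreal_of_nat_eq_real_of_nat del: of_nat_Suc of_nat_add)
  finally have fin: "?N < top" .
  have EN: "EN TYPE('d) s \<rho> k = enn2real ?N"
  proof -
    have "(\<lambda>\<omega>. real (card (Nset \<rho> k (PPconf \<omega>)))) \<in> borel_measurable (pp (unif_T :: (real^'d) measure) s)"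
    proof -
      note measurable_card_Nset_pp [measurable]
      have "(\<lambda>\<omega>. enn2real (of_nat (card (Nset \<rho> k (PPconf \<omega>))))) \<in> borel_measurable (pp (unif_T :: (real^'d) measure) s)"
        by measurable
      then show ?thesis by (simp add: ennreal_of_nat_eq_real_of_nat)
    qed
    then show ?thesis
      unfolding EN_def PPspace_eq by (subst integral_eq_nn_integral) (simp_all add: ennreal_of_nat_eq_real_of_nat)
  qed
  have "ENoverlap TYPE('d) s \<rho> k t \<le> enn2real (ennreal (sparse_bound k (intensity s t)) * ?N)"
    unfolding ENoverlap_eq using ENn_le_EN[OF s t, of k] fin by (intro enn2real_mono) (auto simp: ennreal_mult_less_top)
  also have "\<dots> = sparse_bound k (intensity s t) * EN TYPE('d) s \<rho> k"
    by (simp add: EN enn2real_mult sparse_bound_nonneg)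
  finally show ?thesis .
qed

lemma ENn_finite: "0 \<le> t \<Longrightarrow> ENn TYPE('d) s \<rho> k t < top"
  using ENn_le_crit[OF s, of t k] by (rule le_less_trans) (auto simp: crit_eq ennreal_mult_less_top)

lemma ENoverlap_nonneg: "0 \<le> ENoverlap TYPE('d) s \<rho> k t"
  by (simp add: ENoverlap_eq)

lemma ENoverlap_le_pint:
  assumes t: "0 \<le> t"
  shows "ENoverlap TYPE('d) s \<rho> k t \<le> real K * 2 ^ (k + 2) * real (k + 1) * pint s k * (exp (- t) * exp (- (s * lo / 2 * (1 - exp (- t)))))"
proof -
  have "ENoverlap TYPE('d) s \<rho> k t \<le> sparse_bound k (intensity s t) * exp (- t) * real (k + 1) * pint s k"
    unfolding ENoverlap_eq using ENn_le_crit[OF s t, of k] pint_nonneg sparse_bound_nonneg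
    by (intro enn2real_leI) (simp_all add: crit_eq ennreal_mult del: of_nat_Suc of_nat_add)
  also have "\<dots> = real K * 2 ^ (k + 2) * real (k + 1) * pint s k * (exp (- t) * exp (- (s * lo / 2 * (1 - exp (- t)))))"
    by (simp add: sparse_bound_def intensity_def mult_ac)
  finally show ?thesis .
qed

lemma ENoverlap_ge:
  assumes t: "0 \<le> t" and k: "0 < k" and A: "\<And>x :: real^'d. vol \<rho> x \<le> A"
  shows "exp (- t) ^ (k + 1) * exp (- (intensity s t * A)) * pint s k \<le> real (K * (k + 1)) * ENoverlap TYPE('d) s \<rho> k t"
proof -
  have "ennreal (exp (- t) ^ (k + 1) * exp (- (intensity s t * A)) * pint s k) \<le> of_nat (K * (k + 1)) * ENn TYPE('d) s \<rho> k t"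
    using ENn_ge[OF s t k A] pint_nonneg by (simp add: crit_eq ennreal_mult)
  also have "ENn TYPE('d) s \<rho> k t = ennreal (ENoverlap TYPE('d) s \<rho> k t)"
    using ENn_finite[OF t] by (simp add: ENoverlap_eq)
  finally have "ennreal (exp (- t) ^ (k + 1) * exp (- (intensity s t * A)) * pint s k) \<le> ennreal (real (K * (k + 1)) * ENoverlap TYPE('d) s \<rho> k t)"
    by (simp only: ennreal_of_nat_eq_real_of_nat ennreal_mult[OF of_nat_0_le_iff ENoverlap_nonneg])
  then show ?thesis by (subst (asm) ennreal_le_iff) (auto simp: ENoverlap_nonneg)
qed

text \<open>\<open>integral_damped_exp_le\<close> with b = s \<open>lo\<close> / 2. The second claim
  excludes the default value 0 of a divergent integral, and the lower bound
  \<open>overlap_integral_ge\<close> rests on it.\<close>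

lemma overlap_integral_le:
  assumes "0 < s * lo"
  shows "set_lebesgue_integral lborel {0..} (\<lambda>t. ENoverlap TYPE('d) s \<rho> k t)
      \<le> real K * 2 ^ (k + 2) * real (k + 1) * pint s k * (2 / (s * lo))" (is ?le)
    and "(\<integral>\<^sup>+t. ennreal (indicator {0..} t * ENoverlap TYPE('d) s \<rho> k t) \<partial>lborel) < top" (is ?fin)
proof -
  define D where "D = real K * 2 ^ (k + 2) * real (k + 1) * pint s k"
  have D: "0 \<le> D" by (simp add: D_def pint_nonneg)
  have "(\<integral>\<^sup>+t. ennreal (indicator {0..} t * ENoverlap TYPE('d) s \<rho> k t) \<partial>lborel)
      \<le> (\<integral>\<^sup>+t. ennreal D * (ennreal (exp (- t) * exp (- (s * lo / 2 * (1 - exp (- t))))) * indicator {0..} t) \<partial>lborel)"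
  proof (rule nn_integral_mono)
    fix t :: real
    have "ENoverlap TYPE('d) s \<rho> k t \<le> D * (exp (- t) * exp (- (s * lo / 2 * (1 - exp (- t)))))" if "0 \<le> t"
      unfolding D_def by (rule ENoverlap_le_pint[OF that])
    then show "ennreal (indicator {0..} t * ENoverlap TYPE('d) s \<rho> k t) \<le> ennreal D * (ennreal (exp (- t) * exp (- (s * lo / 2 * (1 - exp (- t))))) * indicator {0..} t)"
      using D by (cases "0 \<le> t") (auto simp: ennreal_leI simp flip: ennreal_mult)
  qed
  also have "\<dots> = ennreal D * (\<integral>\<^sup>+t. ennreal (exp (- t) * exp (- (s * lo / 2 * (1 - exp (- t))))) * indicator {0..} t \<partial>lborel)"
    by (rule nn_integral_cmult) measurable
  also have "\<dots> \<le> ennreal D * ennreal (1 / (s * lo / 2))"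
    using assms by (intro mult_left_mono integral_damped_exp_le) auto
  also have "\<dots> = ennreal (D * (2 / (s * lo)))"
    using D assms by (simp flip: ennreal_mult)
  finally have le: "(\<integral>\<^sup>+t. ennreal (indicator {0..} t * ENoverlap TYPE('d) s \<rho> k t) \<partial>lborel) \<le> ennreal (D * (2 / (s * lo)))" .
  then show ?fin by (rule le_less_trans) simp
  have "set_lebesgue_integral lborel {0..} (\<lambda>t. ENoverlap TYPE('d) s \<rho> k t)
      = enn2real (\<integral>\<^sup>+t. ennreal (indicator {0..} t * ENoverlap TYPE('d) s \<rho> k t) \<partial>lborel)"
    unfolding set_lebesgue_integral_def real_scaleR_def
    using measurable_ENoverlap[OF s, of \<rho> k, where 'd = 'd] by (intro integral_eq_nn_integral) (auto simp: ENoverlap_nonneg)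
  also have "\<dots> \<le> D * (2 / (s * lo))" using le D assms by (intro enn2real_leI) auto
  finally show ?le by (simp add: D_def)
qed

lemma overlap_integral_ge:
  assumes "0 < s * lo" and T: "0 \<le> T" and c: "\<And>t. 0 \<le> t \<Longrightarrow> t \<le> T \<Longrightarrow> c \<le> ENoverlap TYPE('d) s \<rho> k t" and c0: "0 \<le> c"
  shows "c * T \<le> set_lebesgue_integral lborel {0..} (\<lambda>t. ENoverlap TYPE('d) s \<rho> k t)"
proof -
  have "ennreal (c * T) = (\<integral>\<^sup>+t. ennreal c * indicator {0..T} t \<partial>lborel)"
    using T c0 by (simp add: nn_integral_cmult_indicator ennreal_mult)
  also have "\<dots> \<le> (\<integral>\<^sup>+t. ennreal (indicator {0..} t * ENoverlap TYPE('d) s \<rho> k t) \<partial>lborel)"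
    using c by (intro nn_integral_mono) (auto simp: indicator_def intro!: ennreal_leI)
  finally have le: "ennreal (c * T) \<le> (\<integral>\<^sup>+t. ennreal (indicator {0..} t * ENoverlap TYPE('d) s \<rho> k t) \<partial>lborel)" .
  have "c * T = enn2real (ennreal (c * T))" using T c0 by simp
  also have "\<dots> \<le> enn2real (\<integral>\<^sup>+t. ennreal (indicator {0..} t * ENoverlap TYPE('d) s \<rho> k t) \<partial>lborel)"
    using le overlap_integral_le(2)[OF assms(1)] by (rule enn2real_mono)
  also have "\<dots> = set_lebesgue_integral lborel {0..} (\<lambda>t. ENoverlap TYPE('d) s \<rho> k t)"
    unfolding set_lebesgue_integral_def real_scaleR_def
    using measurable_ENoverlap[OF s, of \<rho> k, where 'd = 'd] by (intro integral_eq_nn_integral[symmetric]) (auto simp: ENoverlap_nonneg)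
  finally show ?thesis .
qed

end

end

section \<open>The estimates at a fixed intensity\<close>

context cell_cover
begin

text \<open>The threshold c0 \<tau> = M0 separates bounded from large \<tau> = s r^d, and the
  constant covers both cases. Its summand 1 keeps it positive for k = 0.\<close>

lemma VarI_le_EDsq:
  assumes s: "0 < s" and c0: "0 < c0" and lo: "lo = c0 * hi" and hi: "0 < hi"
  shows "VarI TYPE('d) s \<rho> k \<le>
    (real K * real k * (2 * fact k / c0) * exp (real K * (2 * fact k / c0)) + 1) / (s * hi) * EDsq TYPE('d) s \<rho> k"
proof -
  define M0 :: real where "M0 = 2 * fact k"
  define \<tau> where "\<tau> = s * hi"
  define E where "E = EDsq TYPE('d) s \<rho> k"
  have s0: "0 \<le> s" using s by simp
  have \<tau>: "0 < \<tau>" using s hi by (simp add: \<tau>_def)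
  have E0: "0 \<le> E" unfolding E_def by (rule EDsq_eq(2)[OF s0])
  have M0: "2 \<le> M0" unfolding M0_def using fact_ge_1[of k, where 'a = real] by linarith
  have V: "VarI TYPE('d) s \<rho> k \<le> real K * real k * low s k" using VarI_le[OF s0, of k] by simp
  have "real k * low s k \<le> (real k * (M0 / c0) * exp (real K * (M0 / c0))) / \<tau> * E"
  proof (cases k)
    case (Suc j)
    show ?thesis
    proof (cases "c0 * \<tau> < M0")
      case True
      \<comment> \<open>Here \<tau> is bounded, so \<open>low s k\<close> \<le> s and the empty-ball
        bound suffice. The required factor 1/\<tau> is supplied by 1 \<le> M0 / (c0 \<tau>).\<close>
      have "s * exp (- (s * (real K * hi))) \<le> E"
        unfolding E_def using vol_le Suc by (intro EDsq_ge_exp[OF s0]) auto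
      moreover have "exp (- (real K * (M0 / c0))) \<le> exp (- (s * (real K * hi)))"
      proof -
        have "\<tau> \<le> M0 / c0" using True c0 by (simp add: field_simps)
        then have "real K * \<tau> \<le> real K * (M0 / c0)" by (intro mult_left_mono) auto
        then show ?thesis by (simp add: \<tau>_def mult_ac)
      qed
      ultimately have "s * exp (- (real K * (M0 / c0))) \<le> E"
        using s by (meson less_imp_le mult_left_mono order_trans)
      then have sE: "s \<le> exp (real K * (M0 / c0)) * E"
        by (simp add: exp_minus field_simps)
      have "1 \<le> M0 / c0 / \<tau>" using True c0 \<tau> by (simp add: field_simps)
      define z where "z = real k * (exp (real K * (M0 / c0)) * E)"
      have "real k * low s k \<le> z"
        unfolding z_def using low_le[OF s0, of k] sE by (intro mult_left_mono) auto
      also have "\<dots> \<le> z * (M0 / c0 / \<tau>)"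
        using \<open>1 \<le> M0 / c0 / \<tau>\<close> E0 mult_left_mono[of 1 "M0 / c0 / \<tau>" z] by (simp add: z_def)
      finally have "real k * low s k \<le> real k * (exp (real K * (M0 / c0)) * E) * (M0 / c0 / \<tau>)"
        by (simp only: z_def)
      then show ?thesis by (simp add: field_simps)
    next
      case False
      \<comment> \<open>Since M0 = 2 k!, c k! equals c0 \<tau> / 2 and k! is at most that. So (c +
        1) k! \<le> c0 \<tau> \<le> a, which turns \<open>pois_less_le_pois\<close> into the
        hypothesis of \<open>EDsq_ge_low\<close>.\<close>
      define c where "c = c0 * \<tau> / M0"
      have "(c + 1) * pois_less k (s * vol \<rho> x) \<le> s * vol \<rho> x * pois (s * vol \<rho> x) j" for x :: "real^'d"
      proof -
        define a where "a = s * vol \<rho> x"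
        have a: "c0 * \<tau> \<le> a" unfolding a_def \<tau>_def using vol_ge[of x] s by (simp add: lo mult_left_mono mult_ac)
        have a1: "1 \<le> a" using a False M0 by linarith
        have c: "0 \<le> c" using c0 \<tau> M0 by (simp add: c_def)
        have "(c + 1) * pois_less k a \<le> (c + 1) * (fact k * pois a j)"
          using pois_less_le_pois[OF a1, of j] c Suc by (intro mult_left_mono) auto
        also have "\<dots> = ((c + 1) * fact k) * pois a j" by simp
        also have "\<dots> \<le> a * pois a j"
        proof (rule mult_right_mono)
          have "c * fact k = c0 * \<tau> / 2" by (simp add: c_def M0_def)
          moreover have "fact k \<le> c0 * \<tau> / 2" using False by (simp add: M0_def)
          ultimately show "(c + 1) * fact k \<le> a" using a by (simp add: algebra_simps)
        qed (use a1 in \<open>simp add: pois_nonneg\<close>)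
        finally show ?thesis by (simp add: a_def)
      qed
      then have cE: "c * low s k \<le> E"
        unfolding E_def using c0 \<tau> M0 by (intro EDsq_ge_low[OF s0 Suc]) (auto simp: c_def)
      have "low s k \<le> M0 / c0 / \<tau> * E"
        using cE c0 \<tau> M0 by (simp add: c_def field_simps)
      also have "\<dots> \<le> M0 / c0 / \<tau> * E * exp (real K * (M0 / c0))"
      proof -
        have "1 \<le> exp (real K * (M0 / c0))" using c0 M0 by simp
        moreover have "0 \<le> M0 / c0 / \<tau> * E" using E0 c0 \<tau> M0 by simp
        ultimately show ?thesis using mult_left_mono[of 1 _ "M0 / c0 / \<tau> * E"] by simp
      qed
      finally have "low s k \<le> M0 / c0 / \<tau> * E * exp (real K * (M0 / c0))" .
      from mult_left_mono[OF this, of "real k"] show ?thesis by (simp add: mult_ac)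
    qed
  qed simp
  then have "real K * (real k * low s k) \<le> real K * ((real k * (M0 / c0) * exp (real K * (M0 / c0))) / \<tau> * E)"
    by (rule mult_left_mono) simp
  moreover have "0 \<le> 1 / \<tau> * E" using \<tau> E0 by simp
  ultimately show ?thesis using V
    unfolding E_def[symmetric] \<tau>_def[symmetric] M0_def[symmetric] by (simp add: algebra_simps add_divide_distrib)
qed

text \<open>With q = 1 - e^-t and p = q c0 \<tau> / 2, the bound e^-p \<le> 1/p gives a factor 1/q,
  and t e^-t \<le> q with t \<ge> \<delta> gives e^-t \<le> q / \<delta>. The product is free of q
  and of order 1 / (\<delta> \<tau>).\<close>

lemma ENoverlap_chaotic:
  assumes s: "0 < s" and c0: "0 < c0" and lo: "lo = c0 * hi" and hi: "0 < hi" and t: "0 < \<delta>" "\<delta> \<le> t"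
  shows "exp (- t) * ENoverlap TYPE('d) s \<rho> k t
    \<le> (real K * 2 ^ (k + 2) * (2 / c0) + 1) / (\<delta> * (s * hi)) * EN TYPE('d) s \<rho> k"
proof -
  define q where "q = 1 - exp (- t)"
  define \<tau> where "\<tau> = s * hi"
  have \<tau>: "0 < \<tau>" using s hi by (simp add: \<tau>_def)
  have q: "0 < q" using t by (simp add: q_def)
  have EN0: "0 \<le> EN TYPE('d) s \<rho> k" by (simp add: EN_def)
  have "exp (- (intensity s t * lo) / 2) \<le> 1 / (q * c0 * \<tau> / 2)"
  proof -
    have x: "intensity s t * lo / 2 = q * c0 * \<tau> / 2" by (simp add: intensity_def q_def lo \<tau>_def)
    have pos: "0 < q * c0 * \<tau> / 2" using q c0 \<tau> by simp
    have "exp (- p) \<le> 1 / p" if "0 < p" for p :: real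
    proof -
      have "p \<le> exp p" using exp_ge_add_one_self[of p] by linarith
      then show ?thesis using le_imp_inverse_le[of p "exp p"] that by (simp add: exp_minus inverse_eq_divide)
    qed
    from this[OF pos] show ?thesis by (simp add: x[symmetric])
  qed
  moreover have "exp (- t) \<le> q / \<delta>"
  proof -
    have "t * exp (- t) \<le> q"
    proof -
      have "t \<le> exp t - 1" using exp_ge_add_one_self[of t] by linarith
      then have "t * exp (- t) \<le> (exp t - 1) * exp (- t)" by (intro mult_right_mono) auto
      also have "\<dots> = q" by (simp add: q_def algebra_simps flip: exp_add)
      finally show ?thesis .
    qed
    moreover have "\<delta> * exp (- t) \<le> t * exp (- t)" using t by (intro mult_right_mono) auto
    ultimately have "\<delta> * exp (- t) \<le> q" by linarith
    then show ?thesis using t by (simp add: field_simps)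
  qed
  ultimately have "exp (- t) * exp (- (intensity s t * lo) / 2) \<le> q / \<delta> * (1 / (q * c0 * \<tau> / 2))"
    by (intro mult_mono) (use q t in auto)
  also have "\<dots> = 2 / c0 / (\<delta> * \<tau>)" using q t c0 \<tau> by (simp add: field_simps)
  finally have b: "exp (- t) * sparse_bound k (intensity s t) \<le> real K * 2 ^ (k + 2) * (2 / c0 / (\<delta> * \<tau>))"
    unfolding sparse_bound_def by (subst mult.left_commute) (intro mult_left_mono, auto)
  have "exp (- t) * ENoverlap TYPE('d) s \<rho> k t \<le> exp (- t) * (sparse_bound k (intensity s t) * EN TYPE('d) s \<rho> k)"
    using s t by (intro mult_left_mono ENoverlap_le_EN) auto
  also have "\<dots> \<le> real K * 2 ^ (k + 2) * (2 / c0 / (\<delta> * \<tau>)) * EN TYPE('d) s \<rho> k"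
    using mult_right_mono[OF b EN0] by (simp add: mult.assoc)
  also have "\<dots> \<le> (real K * 2 ^ (k + 2) * (2 / c0) + 1) / (\<delta> * \<tau>) * EN TYPE('d) s \<rho> k"
    using EN0 t \<tau> by (intro mult_right_mono) (auto simp: add_divide_distrib)
  finally show ?thesis by (simp add: \<tau>_def)
qed

text \<open>With \<tau> = s \<open>hi\<close>, three comparisons are chained: the time integral with
  \<open>pint s k\<close> / \<tau>, \<open>pint s k\<close> with \<tau> \<open>low s k\<close>, and
  \<open>low s k\<close> with the variance. The hypothesis \<open>small\<close> makes the correction
  \<open>prod2\<close> at most half of \<open>low s k\<close>.\<close>

lemma VarI_comparable:
  assumes s: "0 < s" and c0: "0 < c0" and lo: "lo = c0 * hi" and hi: "0 < hi" and k: "k = Suc j" and K: "0 < K"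
    and large: "1 \<le> c0 * (s * hi)" "1 \<le> real K * (s * hi)"
    and small: "s * (2 ^ k * exp (- (c0 * (s * hi)) / 2)) * (real K * hi) \<le> 1 / 2"
  defines "I \<equiv> set_lebesgue_integral lborel {0..} (\<lambda>t. ENoverlap TYPE('d) s \<rho> k t)"
  shows "I \<le> 2 * (real K * 2 ^ (k + 2) * real (k + 1) * (2 / c0) * real K) * VarI TYPE('d) s \<rho> k"
    and "VarI TYPE('d) s \<rho> k \<le> real (K * k) * (exp (real k + 2) * (real K * real (k + 1)) * (real K * real k * fact k / c0)) * I"
proof -
  define \<tau> where "\<tau> = s * hi"
  have s0: "0 \<le> s" using s by simp
  have \<tau>: "0 < \<tau>" using s hi by (simp add: \<tau>_def)
  have a_ge: "c0 * \<tau> \<le> s * vol \<rho> x" for x :: "real^'d"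
    unfolding \<tau>_def using vol_ge[of x] s by (simp add: lo mult_left_mono mult_ac)
  have a_le: "s * vol \<rho> x \<le> real K * \<tau>" for x :: "real^'d"
    unfolding \<tau>_def using vol_le[of x] s by (simp add: mult_left_mono mult_ac)
  have slo: "s * lo = c0 * \<tau>" by (simp add: lo \<tau>_def)
  have slo0: "0 < s * lo" unfolding slo using c0 \<tau> by simp
  have low0: "0 \<le> low s k" by (rule low_nonneg[OF s0])
  have V_ge: "low s k \<le> 2 * VarI TYPE('d) s \<rho> k"
  proof -
    have "pois_less k (s * vol \<rho> x) \<le> 2 ^ k * exp (- (c0 * (s * hi)) / 2)" for x :: "real^'d"
    proof -
      have "pois_less k (s * vol \<rho> x) \<le> 2 ^ k * exp (- (s * vol \<rho> x) / 2)"
        using s0 vol_nonneg[of \<rho> x] by (intro pois_less_tail) simp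
      also have "\<dots> \<le> 2 ^ k * exp (- (c0 * (s * hi)) / 2)"
        using a_ge[of x] by (simp add: \<tau>_def)
      finally show ?thesis .
    qed
    from VarI_ge[OF s0 this]
    have "low s k * (1 - s * (2 ^ k * exp (- (c0 * (s * hi)) / 2)) * (real K * hi)) \<le> VarI TYPE('d) s \<rho> k" .
    moreover have "low s k * (1 / 2) \<le> low s k * (1 - s * (2 ^ k * exp (- (c0 * (s * hi)) / 2)) * (real K * hi))"
      using small low0 by (intro mult_left_mono) auto
    ultimately show ?thesis by linarith
  qed
  \<comment> \<open>With k = j + 1, passing from index j to k costs a factor between constant
    multiples of \<tau>; p_j is the top term of \<open>pois_less k\<close> and dominates it up to a
    constant once a \<ge> 1.\<close>
  have pk_le: "pint s k \<le> real K * \<tau> * low s k"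
  proof -
    have "pint s k \<le> real (Suc j) * pint s (Suc j)"
      using pint_nonneg[OF s0, of k] unfolding k by (simp add: mult_le_cancel_right1 del: of_nat_Suc)
    also have "\<dots> \<le> real K * \<tau> * pint s j" by (rule pint_Suc_le[OF s0 a_le])
    also have "\<dots> \<le> real K * \<tau> * low s k"
      unfolding k using \<tau> by (intro mult_left_mono pint_le_low[OF s0]) auto
    finally show ?thesis .
  qed
  have pk_ge: "c0 * \<tau> * low s k \<le> real k * fact k * pint s k"
  proof -
    have "low s k \<le> fact k * pint s j"
      unfolding k using large(1) a_ge by (intro low_le_pint[OF s0]) (auto simp: \<tau>_def intro: order_trans)
    then have "c0 * \<tau> * low s k \<le> c0 * \<tau> * (fact k * pint s j)" using c0 \<tau> by (intro mult_left_mono) auto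
    also have "\<dots> = fact k * (c0 * \<tau> * pint s j)" by simp
    also have "\<dots> \<le> fact k * (real (Suc j) * pint s (Suc j))"
      by (intro mult_left_mono pint_Suc_ge[OF s0 a_ge]) auto
    finally show ?thesis unfolding k by (simp add: mult_ac del: of_nat_Suc fact_Suc)
  qed
  define D where "D = real K * 2 ^ (k + 2) * real (k + 1)"
  have D: "0 \<le> D" by (simp add: D_def)
  have "I \<le> D * pint s k * (2 / (c0 * \<tau>))"
    unfolding I_def D_def slo[symmetric] by (rule overlap_integral_le(1)[OF s0 slo0])
  also have "\<dots> \<le> D * (real K * \<tau> * low s k) * (2 / (c0 * \<tau>))"
    using pk_le D c0 \<tau> by (intro mult_right_mono mult_left_mono) auto
  also have "\<dots> = D * (2 / c0) * real K * low s k" using c0 \<tau> by (simp add: field_simps)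
  also have "\<dots> \<le> D * (2 / c0) * real K * (2 * VarI TYPE('d) s \<rho> k)"
    using V_ge D c0 by (intro mult_left_mono) auto
  finally show "I \<le> 2 * (real K * 2 ^ (k + 2) * real (k + 1) * (2 / c0) * real K) * VarI TYPE('d) s \<rho> k"
    by (simp add: D_def mult_ac)
  \<comment> \<open>Up to time T a ball receives at most one added point in the mean, since
    \<open>vol\<close> \<le> K \<open>hi\<close>. As T \<le> 1, survival of k + 1 points costs at
    most e^-(k+1), and an empty ball another e^-1; hence the k + 2 in c.\<close>
  define T where "T = 1 / (real K * \<tau>)"
  define c where "c = exp (- (real k + 2)) * pint s k / real (K * (k + 1))"
  have T: "0 < T" "T \<le> 1" using K \<tau> large(2) by (auto simp: T_def \<tau>_def)
  have KK: "0 < real (K * (k + 1))" using K by (simp only: of_nat_0_less_iff) simp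
  have "c \<le> ENoverlap TYPE('d) s \<rho> k t" if t: "0 \<le> t" "t \<le> T" for t
  proof -
    have "t * (real K * \<tau>) \<le> 1" using t K \<tau> by (simp add: T_def field_simps)
    moreover have "intensity s t * (real K * hi) \<le> t * (real K * \<tau>)"
    proof -
      have "1 - exp (- t) \<le> t" using exp_ge_add_one_self[of "- t"] by linarith
      then have "(1 - exp (- t)) * (real K * \<tau>) \<le> t * (real K * \<tau>)" using \<tau> by (intro mult_right_mono) auto
      then show ?thesis by (simp add: intensity_def \<tau>_def mult_ac)
    qed
    moreover have "real (k + 1) * t \<le> real (k + 1)" using t T by (intro mult_left_le) auto
    moreover have "real (k + 1) = real k + 1" by simp
    ultimately have "- (real k + 2) \<le> - (real (k + 1) * t) + - (intensity s t * (real K * hi))" by linarith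
    then have "exp (- (real k + 2)) \<le> exp (- t) ^ (k + 1) * exp (- (intensity s t * (real K * hi)))"
      by (simp only: exp_of_nat_mult[symmetric] exp_add[symmetric] mult_minus_right exp_le_cancel_iff)
    then have "exp (- (real k + 2)) * pint s k \<le> exp (- t) ^ (k + 1) * exp (- (intensity s t * (real K * hi))) * pint s k"
      by (intro mult_right_mono pint_nonneg[OF s0])
    also have "\<dots> \<le> real (K * (k + 1)) * ENoverlap TYPE('d) s \<rho> k t"
      using k vol_le t by (intro ENoverlap_ge[OF s0]) auto
    finally show ?thesis using KK by (simp add: c_def divide_le_eq mult.commute)
  qed
  then have "c * T \<le> I"
    unfolding I_def using T pint_nonneg[OF s0, of k] by (intro overlap_integral_ge[OF s0 slo0]) (auto simp: c_def)
  then have "exp (- (real k + 2)) * pint s k \<le> real (K * (k + 1)) * (real K * \<tau>) * I"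
    using KK K \<tau> by (simp add: c_def T_def divide_le_eq mult_ac)
  then have "exp (real k + 2) * (exp (- (real k + 2)) * pint s k) \<le> exp (real k + 2) * (real (K * (k + 1)) * (real K * \<tau>) * I)"
    by (intro mult_left_mono) auto
  moreover have "exp a * (exp (- a) * p) = p" for a p :: real
    by (simp add: exp_minus)
  ultimately have pI: "pint s k \<le> exp (real k + 2) * (real (K * (k + 1)) * (real K * \<tau>) * I)"
    by (simp only:)
  have "VarI TYPE('d) s \<rho> k \<le> real (K * k) * low s k" by (rule VarI_le[OF s0])
  also have "low s k \<le> (real k * fact k / (c0 * \<tau>)) * pint s k"
    using pk_ge c0 \<tau> by (simp add: field_simps)
  also have "\<dots> \<le> (real k * fact k / (c0 * \<tau>)) * (exp (real k + 2) * (real (K * (k + 1)) * (real K * \<tau>) * I))"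
    using c0 \<tau> by (intro mult_left_mono pI) auto
  also have "\<dots> = exp (real k + 2) * (real K * real (k + 1)) * (real K * real k * fact k / c0) * I"
    using c0 \<tau> by (simp add: field_simps)
  finally show "VarI TYPE('d) s \<rho> k \<le> real (K * k) * (exp (real k + 2) * (real K * real (k + 1)) * (real K * real k * fact k / c0)) * I"
    by (simp add: mult_left_mono mult.assoc)
qed

end

theorem theorem3p2:
  fixes r :: "real \<Rightarrow> real" and k :: nat
  assumes r_range: "\<forall>s>0. 0 < r s \<and> r s < 1/2"
    and r_lim: "filterlim (\<lambda>s. s * r s ^ CARD('d::finite)) at_top at_top"
  shows
    "(\<exists>C>0. \<forall>s>0. VarI TYPE('d) s (r s) k
          \<le> C / (s * r s ^ CARD('d)) * EDsq TYPE('d) s (r s) k)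
   \<and> (\<exists>C1 C2. 0 < C1 \<and> C1 \<le> C2 \<and>
        (\<forall>\<^sub>F s in at_top.
           C1 * set_lebesgue_integral lborel {0..} (\<lambda>t. ENoverlap TYPE('d) s (r s) k t)
             \<le> VarI TYPE('d) s (r s) k \<and>
           VarI TYPE('d) s (r s) k
             \<le> C2 * set_lebesgue_integral lborel {0..} (\<lambda>t. ENoverlap TYPE('d) s (r s) k t)))
   \<and> (\<exists>C'>0. \<forall>\<delta> :: real \<Rightarrow> real.
        (\<forall>s>0. 0 < \<delta> s) \<and> (\<delta> \<longlongrightarrow> 0) at_top \<and>
        filterlim (\<lambda>s. \<delta> s * (s * r s ^ CARD('d))) at_top at_top \<longrightarrow>
        (\<forall>s>0. \<forall>t\<ge>\<delta> s.
           exp (- t) * ENoverlap TYPE('d) s (r s) k t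
             \<le> C' / (\<delta> s * (s * r s ^ CARD('d))) * EN TYPE('d) s (r s) k))"
proof (intro conjI)
  \<comment> \<open>K and c0 are fixed before s and depend on the dimension only. The cells change
    with s, but the constants built from K, c0 and k are uniform in s.\<close>
  obtain K :: nat and c0 :: real where K: "K > 0" and c0: "c0 > 0"
    and cells: "\<And>\<rho>. 0 < \<rho> \<Longrightarrow> \<rho> < 1/2 \<Longrightarrow> \<exists>cell :: real^'d \<Rightarrow> 'd \<Rightarrow> int.
       (\<forall>j. {y. cell y = j} \<in> sets borel) \<and>
       (\<forall>y z. cell y = cell z \<longrightarrow> tdist y z \<le> \<rho>) \<and>
       (\<forall>x. finite (cell ` {y. tdist x y \<le> 2 * \<rho>}) \<and> card (cell ` {y. tdist x y \<le> 2 * \<rho>}) \<le> K) \<and>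
       (\<forall>y. c0 * \<rho> ^ CARD('d) \<le> measure unif_T {z. cell z = cell y} \<and>
            measure unif_T {z. cell z = cell y} \<le> \<rho> ^ CARD('d))"
    using torus_cells[where 'd = 'd] by blast
  have cover: "\<exists>cell :: real^'d \<Rightarrow> 'd \<Rightarrow> int. cell_cover cell (r s) (c0 * r s ^ CARD('d)) (r s ^ CARD('d)) K" if "0 < s" for s
  proof -
    have r: "0 < r s" "r s < 1/2" using r_range that by auto
    from cells[OF this] obtain cell :: "real^'d \<Rightarrow> 'd \<Rightarrow> int" where
      "(\<forall>j. {y. cell y = j} \<in> sets borel) \<and>
       (\<forall>y z. cell y = cell z \<longrightarrow> tdist y z \<le> r s) \<and>
       (\<forall>x. finite (cell ` {y. tdist x y \<le> 2 * r s}) \<and> card (cell ` {y. tdist x y \<le> 2 * r s}) \<le> K) \<and>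
       (\<forall>y. c0 * r s ^ CARD('d) \<le> measure unif_T {z. cell z = cell y} \<and>
            measure unif_T {z. cell z = cell y} \<le> r s ^ CARD('d))" ..
    then have "cell_cover cell (r s) (c0 * r s ^ CARD('d)) (r s ^ CARD('d)) K"
      using r by (intro cell_cover.intro) auto
    then show ?thesis by blast
  qed
  have hi: "0 < r s ^ CARD('d)" if "0 < s" for s using r_range that by simp
  let ?I = "\<lambda>s. set_lebesgue_integral lborel {0..} (\<lambda>t. ENoverlap TYPE('d) s (r s) k t)"
  show "\<exists>C>0. \<forall>s>0. VarI TYPE('d) s (r s) k \<le> C / (s * r s ^ CARD('d)) * EDsq TYPE('d) s (r s) k"
  proof (intro exI conjI allI impI)
    show "0 < real K * real k * (2 * fact k / c0) * exp (real K * (2 * fact k / c0)) + 1"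
      using c0 by (intro add_nonneg_pos) auto
    fix s :: real assume s: "0 < s"
    obtain cell :: "real^'d \<Rightarrow> 'd \<Rightarrow> int" where "cell_cover cell (r s) (c0 * r s ^ CARD('d)) (r s ^ CARD('d)) K"
      using cover[OF s] by blast
    then interpret cell_cover cell "r s" "c0 * r s ^ CARD('d)" "r s ^ CARD('d)" K .
    show "VarI TYPE('d) s (r s) k \<le> (real K * real k * (2 * fact k / c0) * exp (real K * (2 * fact k / c0)) + 1) / (s * r s ^ CARD('d)) * EDsq TYPE('d) s (r s) k"
      using s c0 hi[OF s] by (intro VarI_le_EDsq) auto
  qed
  show "\<exists>C'>0. \<forall>\<delta> :: real \<Rightarrow> real.
        (\<forall>s>0. 0 < \<delta> s) \<and> (\<delta> \<longlongrightarrow> 0) at_top \<and>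
        filterlim (\<lambda>s. \<delta> s * (s * r s ^ CARD('d))) at_top at_top \<longrightarrow>
        (\<forall>s>0. \<forall>t\<ge>\<delta> s.
           exp (- t) * ENoverlap TYPE('d) s (r s) k t
             \<le> C' / (\<delta> s * (s * r s ^ CARD('d))) * EN TYPE('d) s (r s) k)"
  proof (intro exI conjI allI impI)
    show "0 < real K * 2 ^ (k + 2) * (2 / c0) + 1" using c0 by (intro add_nonneg_pos) auto
    fix \<delta> :: "real \<Rightarrow> real" and s t :: real
    assume \<delta>: "(\<forall>s>0. 0 < \<delta> s) \<and> (\<delta> \<longlongrightarrow> 0) at_top \<and> filterlim (\<lambda>s. \<delta> s * (s * r s ^ CARD('d))) at_top at_top"
      and s: "0 < s" and t: "\<delta> s \<le> t"
    obtain cell :: "real^'d \<Rightarrow> 'd \<Rightarrow> int" where "cell_cover cell (r s) (c0 * r s ^ CARD('d)) (r s ^ CARD('d)) K"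
      using cover[OF s] by blast
    then interpret cell_cover cell "r s" "c0 * r s ^ CARD('d)" "r s ^ CARD('d)" K .
    show "exp (- t) * ENoverlap TYPE('d) s (r s) k t
        \<le> (real K * 2 ^ (k + 2) * (2 / c0) + 1) / (\<delta> s * (s * r s ^ CARD('d))) * EN TYPE('d) s (r s) k"
      using s c0 hi[OF s] \<delta> t by (intro ENoverlap_chaotic) auto
  qed
  show "\<exists>C1 C2. 0 < C1 \<and> C1 \<le> C2 \<and> (\<forall>\<^sub>F s in at_top. C1 * ?I s \<le> VarI TYPE('d) s (r s) k \<and> VarI TYPE('d) s (r s) k \<le> C2 * ?I s)"
  proof (cases k)
    case 0
    \<comment> \<open>A point lies in its own ball, so for k = 0 no point is counted; the overlap is
      empty as well, and both sides are 0.\<close>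
    have "1 * ?I s \<le> VarI TYPE('d) s (r s) k \<and> VarI TYPE('d) s (r s) k \<le> 1 * ?I s" if s: "0 < s" for s
    proof -
      obtain cell :: "real^'d \<Rightarrow> 'd \<Rightarrow> int" where "cell_cover cell (r s) (c0 * r s ^ CARD('d)) (r s ^ CARD('d)) K"
        using cover[OF s] by blast
      then interpret cell_cover cell "r s" "c0 * r s ^ CARD('d)" "r s ^ CARD('d)" K .
      have "VarI TYPE('d) s (r s) k = 0"
        using VarI_le[of s k] VarI_eq(2)[of s k] s 0 by simp
      moreover have "ENoverlap TYPE('d) s (r s) k t = 0" for t
      proof -
        have "0 \<le> r s" using r_range s by (simp add: less_imp_le)
        then show ?thesis by (simp add: 0 ENoverlap_def Nset_0)
      qed
      ultimately show ?thesis by (simp add: set_lebesgue_integral_def)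
    qed
    then have "\<forall>\<^sub>F s in at_top. 1 * ?I s \<le> VarI TYPE('d) s (r s) k \<and> VarI TYPE('d) s (r s) k \<le> 1 * ?I s"
      using eventually_gt_at_top[of 0] by (rule eventually_mono[rotated]) auto
    then show ?thesis by (intro exI[of _ "1::real"] conjI) auto
  next
    case (Suc j)
    define U where "U = 2 * (real K * 2 ^ (k + 2) * real (k + 1) * (2 / c0) * real K)"
    define V where "V = real (K * k) * (exp (real k + 2) * (real K * real (k + 1)) * (real K * real k * fact k / c0))"
    have U: "0 < U" using K c0 by (simp add: U_def)
    \<comment> \<open>With x = s r^d this decay yields the hypothesis \<open>small\<close> of
      \<open>VarI_comparable\<close> for large s.\<close>
    have "((\<lambda>x :: real. x * exp (- (c0 / 2 * x))) \<longlongrightarrow> 0) at_top"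
      using c0 by real_asymp
    then have "((\<lambda>x. 2 ^ k * real K * (x * exp (- (c0 / 2 * x)))) \<longlongrightarrow> 2 ^ k * real K * 0) at_top"
      by (intro tendsto_mult tendsto_const)
    then have "\<forall>\<^sub>F x in at_top. 2 ^ k * real K * (x * exp (- (c0 / 2 * x))) < 1 / 2"
      by (rule order_tendstoD) simp
    then have small: "\<forall>\<^sub>F s in at_top. 2 ^ k * real K * ((s * r s ^ CARD('d)) * exp (- (c0 / 2 * (s * r s ^ CARD('d))))) < 1 / 2"
      using r_lim by (rule eventually_compose_filterlim)
    have large: "\<forall>\<^sub>F s in at_top. max (1 / c0) 1 \<le> s * r s ^ CARD('d)"
      using r_lim unfolding filterlim_at_top by blast
    have "\<forall>\<^sub>F s in at_top. ?I s \<le> U * VarI TYPE('d) s (r s) k \<and> VarI TYPE('d) s (r s) k \<le> V * ?I s \<and> 0 \<le> ?I s"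
      using small large eventually_gt_at_top[of 0]
    proof eventually_elim
      case (elim s)
      then have s: "0 < s" by simp
      obtain cell :: "real^'d \<Rightarrow> 'd \<Rightarrow> int" where "cell_cover cell (r s) (c0 * r s ^ CARD('d)) (r s ^ CARD('d)) K"
        using cover[OF s] by blast
      then interpret cell_cover cell "r s" "c0 * r s ^ CARD('d)" "r s ^ CARD('d)" K .
      define \<tau> where "\<tau> = s * r s ^ CARD('d)"
      have \<tau>: "1 / c0 \<le> \<tau>" "1 \<le> \<tau>" using elim by (auto simp: \<tau>_def)
      have l1: "1 \<le> c0 * (s * r s ^ CARD('d))" using \<tau>(1) c0 by (simp add: \<tau>_def field_simps)
      have l2: "1 \<le> real K * (s * r s ^ CARD('d))"
        using mult_mono[of 1 "real K" 1 \<tau>] \<tau> K by (simp add: \<tau>_def)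
      have sm: "s * (2 ^ k * exp (- (c0 * (s * r s ^ CARD('d))) / 2)) * (real K * r s ^ CARD('d)) \<le> 1 / 2"
        using elim(1) by (simp add: mult_ac)
      note V = VarI_comparable[OF s c0 refl hi[OF s] Suc K l1 l2 sm]
      have "0 \<le> ?I s"
        unfolding set_lebesgue_integral_def using ENoverlap_nonneg[of s k] s by (intro integral_nonneg_AE) (auto simp: indicator_def)
      then show ?case using V by (simp add: U_def V_def)
    qed
    \<comment> \<open>The maximum secures C1 \<le> C2; enlarging V keeps the upper bound because the
      time integral is nonnegative.\<close>
    then have "\<forall>\<^sub>F s in at_top. 1 / U * ?I s \<le> VarI TYPE('d) s (r s) k \<and> VarI TYPE('d) s (r s) k \<le> max (1 / U) V * ?I s"
    proof eventually_elim
      case (elim s)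
      have "V * ?I s \<le> max (1 / U) V * ?I s" using elim by (intro mult_right_mono) auto
      then show ?case using elim U by (simp add: field_simps)
    qed
    then show ?thesis using U by (intro exI[of _ "1 / U"] exI[of _ "max (1 / U) V"] conjI) auto
  qed
qed

end
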